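(* Consider the following two assertions. (A) There is a constant $C>0$ such that for every analytic function $f\colon\mathbb{D}\to\mathbb{C}$: $f$ belongs to the Bergman space $\mathcal{A}^2(\mathbb{D})$ if and only if $\|f\|_{L^1+H^{-1/2}(S^1)}:=\limsup_{r\to1^-}\|f(re^{i\theta})\|_{L^1+H^{-1/2}(S^1)}<+\infty$; moreover $\|f\|_{L^2(\mathbb{D})}\le C\|f\|_{L^1+H^{-1/2}(S^1)}$. (B) There is a constant $C>0$ such that for every $u\in\mathcal{D}'(S^1)$ with $(-\Delta)^{1/4}u,\ \mathcal{R}(-\Delta)^{1/4}u\in\dot H^{-1/2}(S^1)+L^1(S^1)$, one has $u-\bar u\in L^2_*(S^1)$, where $\bar u$ is the mean of $u$, and $$\|u-\bar u\|_{L^2(S^1)}\le C\left(\|(-\Delta)^{1/4}u\|_{\dot H^{-1/2}(S^1)+L^1(S^1)}+\|\mathcal{R}(-\Delta)^{1/4}u\|_{\dot H^{-1/2}(S^1)+L^1(S^1)}\right).$$ Then (A) implies (B), and (A) and (B) are equivalent.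
   Context: $\mathbb{D}$ is the open unit disc in $\mathbb{C}$, $S^1=\mathbb{R}/2\pi\mathbb{Z}$. $\mathcal{A}^2(\mathbb{D})$ is the space of holomorphic $f\colon\mathbb{D}\to\mathbb{C}$ with $\|f\|_{L^2(\mathbb{D})}<+\infty$. For $u\in\mathcal{D}'(S^1)$ (complex-valued distributions), $\hat u(m)=\frac{1}{2\pi}\langle u,e^{-im\cdot}\rangle$; the mean of $u$ is $\bar u=\hat u(0)$; $L^2_*(S^1)$ is the space of mean-zero functions in $L^2(S^1)$. $(-\Delta)^{1/4}$ and the Riesz transform $\mathcal{R}$ are the Fourier multiplier operators on $\mathcal{D}'(S^1)$ with multipliers $|m|^{1/2}$ and $i\,\mathrm{sign}(m)$ (with $\mathrm{sign}(0)=0$). $H^{-1/2}(S^1)$: distributions $v$ with $\|v\|_{H^{-1/2}}^2=\sum_{k\in\mathbb{Z}}(1+|k|^2)^{-1/2}|\hat v(k)|^2<\infty$. $\dot H^{-1/2}(S^1)$: distributions $f=(-\Delta)^{1/4}g$ with $g\in L^2(S^1)$ (so $\hat f(0)=0$), with $\|f\|_{\dot H^{-1/2}}^2=\sum_{m\ne0}|m|^{-1}|\hat f(m)|^2$. For $X=H^{-1/2}(S^1)$ or $X=\dot H^{-1/2}(S^1)$, the sum space $L^1+X$ consists of distributions $v=g+h$, $g\in L^1(S^1)$, $h\in X$, with norm $\inf\{\|g\|_{L^1}+\|h\|_X: v=g+h\}$. For $0<r<1$, $f(re^{i\theta})$ is regarded as a function of $\theta\in S^1$. *)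

theory Defs
  imports "HOL-Analysis.Analysis"
begin

text \<open>Functions on \<open>S\<^sup>1 = \<real>/2\<pi>\<int>\<close> that are only defined almost everywhere are represented by functions on the
  fundamental domain \<open>[0, 2\<pi>)\<close>; smooth ones by \<open>2\<pi>\<close>-periodic functions on the line.\<close>

definition circle :: "real measure" where
  "circle = restrict_space lborel {0..<2 * pi}"

definition disc :: "complex measure" where
  "disc = restrict_space lborel (ball 0 1)"

definition L1 :: "'a measure \<Rightarrow> ('a \<Rightarrow> complex) set" where
  "L1 M = {f. integrable M f}"

definition L1_norm :: "'a measure \<Rightarrow> ('a \<Rightarrow> complex) \<Rightarrow> real" where
  "L1_norm M f = (LINT x|M. norm (f x))"

definition L2 :: "'a measure \<Rightarrow> ('a \<Rightarrow> complex) set" where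
  "L2 M = {f \<in> borel_measurable M. integrable M (\<lambda>x. (norm (f x))\<^sup>2)}"

definition L2_norm :: "'a measure \<Rightarrow> ('a \<Rightarrow> complex) \<Rightarrow> ennreal" where
  "L2_norm M f = (if f \<in> L2 M then ennreal (sqrt (LINT x|M. (norm (f x))\<^sup>2)) else \<infinity>)"

definition bergman :: "(complex \<Rightarrow> complex) set" where
  "bergman = {f. f holomorphic_on ball 0 1 \<and> L2_norm disc f < \<infinity>}"

definition nth_deriv :: "nat \<Rightarrow> (real \<Rightarrow> complex) \<Rightarrow> real \<Rightarrow> complex" where
  "nth_deriv k = (\<lambda>\<phi> \<theta>. vector_derivative \<phi> (at \<theta>)) ^^ k"

definition test_functions :: "(real \<Rightarrow> complex) set" where
  "test_functions = {\<phi>. (\<forall>\<theta>. \<phi> (\<theta> + 2 * pi) = \<phi> \<theta>) \<and> (\<forall>k \<theta>. nth_deriv k \<phi> differentiable at \<theta>)}"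

text \<open>A distribution is a functional whose values matter only on \<open>test_functions\<close>; equality of
  distributions is \<open>dist_eq\<close>, not HOL equality. Continuity for the topology of uniform convergence of all derivatives is
  stated as a bound by finitely many of the defining seminorms.\<close>

type_synonym functional = "(real \<Rightarrow> complex) \<Rightarrow> complex"

definition distributions :: "functional set" where
  "distributions = {u.
     (\<forall>\<phi>\<in>test_functions. \<forall>\<psi>\<in>test_functions. u (\<lambda>\<theta>. \<phi> \<theta> + \<psi> \<theta>) = u \<phi> + u \<psi>) \<and>
     (\<forall>c. \<forall>\<phi>\<in>test_functions. u (\<lambda>\<theta>. c * \<phi> \<theta>) = c * u \<phi>) \<and>
     (\<exists>N K. \<forall>\<phi>\<in>test_functions. norm (u \<phi>) \<le> K * (\<Sum>k\<le>N. SUP \<theta>. norm (nth_deriv k \<phi> \<theta>)))}"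

definition dist_eq :: "functional \<Rightarrow> functional \<Rightarrow> bool" where
  "dist_eq u v \<longleftrightarrow> (\<forall>\<phi>\<in>test_functions. u \<phi> = v \<phi>)"

definition dist_of :: "(real \<Rightarrow> complex) \<Rightarrow> functional" where
  "dist_of g = (\<lambda>\<phi>. LINT \<theta>|circle. g \<theta> * \<phi> \<theta>)"

definition fourier_coeff :: "functional \<Rightarrow> int \<Rightarrow> complex" where
  "fourier_coeff u m = u (\<lambda>\<theta>. cis (- (of_int m * \<theta>))) / (2 * pi)"

abbreviation mean :: "functional \<Rightarrow> complex" where
  "mean u \<equiv> fourier_coeff u 0"

definition L2_star :: "(real \<Rightarrow> complex) set" where
  "L2_star = {w \<in> L2 circle. mean (dist_of w) = 0}"

text \<open>The multiplier operator sends \<open>u\<close> to the distribution \<open>\<Sum>m. \<mu> m * fourier_coeff u m * cis (m \<theta>)\<close>; when \<open>\<mu>\<close> has polynomial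
  growth the series converges absolutely on every test function.\<close>

definition fourier_multiplier :: "(int \<Rightarrow> complex) \<Rightarrow> functional \<Rightarrow> functional" where
  "fourier_multiplier \<mu> u =
     (\<lambda>\<phi>. \<Sum>\<^sub>\<infinity>m\<in>UNIV. \<mu> m * fourier_coeff u m * dist_of (\<lambda>\<theta>. cis (of_int m * \<theta>)) \<phi>)"

definition quarter_laplacian :: "functional \<Rightarrow> functional" where
  "quarter_laplacian = fourier_multiplier (\<lambda>m. complex_of_real (\<bar>of_int m\<bar> powr (1/2)))"

definition riesz_transform :: "functional \<Rightarrow> functional" where
  "riesz_transform = fourier_multiplier (\<lambda>m. \<i> * of_int (sgn m))"

definition H_space :: "functional set" where
  "H_space = {v \<in> distributions.
     (\<lambda>k::int. (1 + \<bar>of_int k\<bar>\<^sup>2) powr (-1/2) * (norm (fourier_coeff v k))\<^sup>2) summable_on UNIV}"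

definition H_norm :: "functional \<Rightarrow> real" where
  "H_norm v = sqrt (\<Sum>\<^sub>\<infinity>k::int\<in>UNIV. (1 + \<bar>of_int k\<bar>\<^sup>2) powr (-1/2) * (norm (fourier_coeff v k))\<^sup>2)"

definition Hdot_space :: "functional set" where
  "Hdot_space = {f \<in> distributions. \<exists>g\<in>L2 circle. dist_eq f (quarter_laplacian (dist_of g))}"

definition Hdot_norm :: "functional \<Rightarrow> real" where
  "Hdot_norm f = sqrt (\<Sum>\<^sub>\<infinity>m::int\<in>-{0}. inverse \<bar>of_int m\<bar> * (norm (fourier_coeff f m))\<^sup>2)"

definition decompositions :: "functional set \<Rightarrow> functional \<Rightarrow> ((real \<Rightarrow> complex) \<times> functional) set" where
  "decompositions X v =
     {(g, h). g \<in> L1 circle \<and> h \<in> X \<and> dist_eq v (\<lambda>\<phi>. dist_of g \<phi> + h \<phi>)}"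

definition L1_plus :: "functional set \<Rightarrow> functional set" where
  "L1_plus X = {v \<in> distributions. decompositions X v \<noteq> {}}"

text \<open>The infimum is \<open>\<infinity>\<close> when there is no decomposition.\<close>

definition L1_plus_norm :: "functional set \<Rightarrow> (functional \<Rightarrow> real) \<Rightarrow> functional \<Rightarrow> ennreal" where
  "L1_plus_norm X norm_X v =
     (INF (g, h)\<in>decompositions X v. ennreal (L1_norm circle g + norm_X h))"

definition boundary_norm :: "(complex \<Rightarrow> complex) \<Rightarrow> ennreal" where
  "boundary_norm f = Limsup (at_left (1::real))
     (\<lambda>r. L1_plus_norm H_space H_norm (dist_of (\<lambda>\<theta>. f (of_real r * cis \<theta>))))"

definition assertion_A :: bool where
  "assertion_A \<longleftrightarrow> (\<exists>C::real. C > 0 \<and> (\<forall>f. f holomorphic_on ball 0 1 \<longrightarrow>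
     (f \<in> bergman \<longleftrightarrow> boundary_norm f < \<infinity>) \<and>
     L2_norm disc f \<le> ennreal C * boundary_norm f))"

definition assertion_B :: bool where
  "assertion_B \<longleftrightarrow> (\<exists>C::real. C > 0 \<and> (\<forall>u\<in>distributions.
     quarter_laplacian u \<in> L1_plus Hdot_space \<and>
     riesz_transform (quarter_laplacian u) \<in> L1_plus Hdot_space \<longrightarrow>
     (\<exists>w\<in>L2_star. dist_eq (\<lambda>\<phi>. u \<phi> - dist_of (\<lambda>\<theta>. mean u) \<phi>) (dist_of w) \<and>
        L2_norm circle w \<le> ennreal C *
          (L1_plus_norm Hdot_space Hdot_norm (quarter_laplacian u) +
           L1_plus_norm Hdot_space Hdot_norm (riesz_transform (quarter_laplacian u))))))"

end

theory Submission
  imports Defs "HOL-Complex_Analysis.Complex_Analysis"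
begin

text \<open>Everything is read off Fourier coefficients. For a power series \<open>f z = (\<Sum>n. a n * z ^ n)\<close> the squared norm in
  \<open>L\<^sup>2\<close> of the disc is \<open>\<pi> * (\<Sum>n. \<bar>a n\<bar>\<^sup>2 / (n + 1))\<close>.

  From A to B, \<open>v = (-\<Delta>)\<^sup>1\<^sup>/\<^sup>4 u\<close> splits into the two half-line parts \<open>(v \<mp> \<i> R v) / 2\<close>. Each of them (the second one after
  complex conjugation) is the boundary value of a power series whose circle restrictions are Poisson means of the given
  decomposition. Poisson means do not increase the norms, so A bounds \<open>\<Sum>n. \<bar>v n\<bar>\<^sup>2 / (n + 1)\<close>, which is comparable to the
  squared norm of \<open>u\<close> minus its mean.

  From B to A, apply B to the function with coefficients \<open>a n * r ^ n / sqrt n\<close>, on which \<open>R\<close> acts as multiplication by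
  \<open>\<i>\<close>, and let \<open>r\<close> tend to \<open>1\<close>.\<close>

subsection \<open>Integration over the circle\<close>

text \<open>Sum-space norms are infima over decompositions, and distributions are meaningful only on
  test functions. Estimates are therefore proved for one fixed decomposition \<open>(g, h)\<close>,
  or for a pair of them, and the infimum is taken at the end. Two bridges lead back from
  coefficients: \<open>dist_eqI\<close> (equal coefficients give equal distributions) and
  \<open>riesz_fischer\<close> (square summable coefficients come from a function).

  The half lines appear because v - \<i> R v has the coefficients (1 + sgn m) v(m). For n \<ge> 1
  the weights 1/(n+1), (1+n^2)^(-1/2) and 1/n are comparable, so the Bergman norm and the Sobolev
  norms measure the same sequences up to constants. The L^1 part has no such description: it must be
  kept as a function, and positivity of the Poisson kernel is what allows it to be smoothed without
  increasing its norm.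

  In the step from B to A the limit r to 1 is taken in finite partial sums only, and the zeroth
  coefficient, which B does not see, is estimated separately. That Bergman functions have finite
  boundary norm follows directly from decompositions with zero L^1 part.\<close>

abbreviation chr :: "int \<Rightarrow> real \<Rightarrow> complex" where
  "chr m \<equiv> (\<lambda>\<theta>. cis (of_int m * \<theta>))"

lemma fourier_coeff_chr: "fourier_coeff u m = u (chr (- m)) / (2 * pi)"
  by (simp add: fourier_coeff_def)

lemma space_circle [simp]: "space circle = {0..<2*pi}"
  by (simp add: circle_def space_restrict_space)

lemma emeasure_circle: "emeasure circle (space circle) = ennreal (2 * pi)"
  unfolding circle_def by (subst emeasure_restrict_space) (auto simp: space_restrict_space)

lemma finite_measure_circle: "finite_measure circle"
  by (rule finite_measureI) (simp only: emeasure_circle, simp)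

interpretation circle: finite_measure circle
  by (rule finite_measure_circle)

lemma measurable_circle: "f \<in> borel_measurable borel \<Longrightarrow> f \<in> borel_measurable circle"
  unfolding circle_def by (rule measurable_restrict_space1) simp

lemma measurable_continuous_circle:
  fixes f :: "real \<Rightarrow> 'b::euclidean_space"
  assumes "continuous_on UNIV f" shows "f \<in> borel_measurable circle"
  using borel_measurable_continuous_onI[OF assms] by (rule measurable_circle)

lemma measurable_chr [measurable]: "chr m \<in> borel_measurable circle"
  by (intro measurable_continuous_circle continuous_intros)

lemma integrable_circle_iff:
  fixes f :: "real \<Rightarrow> 'b::euclidean_space"
  shows "integrable circle f \<longleftrightarrow> integrable lborel (\<lambda>x. indicator {0..<2*pi} x *\<^sub>R f x)"
  unfolding circle_def by (subst integrable_restrict_space) auto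

lemma integral_circle_eq:
  fixes f :: "real \<Rightarrow> 'b::euclidean_space"
  shows "(LINT x|circle. f x) = (LINT x|lborel. indicator {0..<2*pi} x *\<^sub>R f x)"
  unfolding circle_def by (subst integral_restrict_space) auto

text \<open>The fundamental domain is half-open; adding its null endpoint gives a compact interval,
  on which continuous functions are integrable and the fundamental theorem of calculus
  applies.\<close>

lemma AE_circle_indicator: "AE x in lborel. (indicator {0..<2*pi} x :: real) = indicator {0..2*pi} x"
  using AE_lborel_singleton[of "2*pi"] by eventually_elim (auto simp: indicator_def)

lemma integrable_circle_continuous:
  fixes f :: "real \<Rightarrow> 'b::euclidean_space"
  assumes "continuous_on UNIV f" shows "integrable circle f"
proof -
  have *: "integrable lborel (\<lambda>x. indicator {0..2*pi} x *\<^sub>R f x)"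
    using assms by (intro borel_integrable_compact) (auto intro: continuous_on_subset)
  have m: "f \<in> borel_measurable borel" using assms by (rule borel_measurable_continuous_onI)
  show ?thesis unfolding integrable_circle_iff
    by (rule integrable_cong_AE_imp[OF *]) (use m AE_circle_indicator in \<open>auto elim!: eventually_mono\<close>)
qed

lemma integral_circle_Icc:
  fixes f :: "real \<Rightarrow> 'b::euclidean_space"
  assumes "continuous_on UNIV f"
  shows "(LINT x|circle. f x) = (LINT x|lborel. indicator {0..2*pi} x *\<^sub>R f x)"
proof -
  have m: "f \<in> borel_measurable borel" using assms by (rule borel_measurable_continuous_onI)
  show ?thesis unfolding integral_circle_eq
    by (rule integral_cong_AE) (use m AE_circle_indicator in \<open>auto elim!: eventually_mono\<close>)
qed

lemma integral_circle_derivative: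
  fixes F :: "real \<Rightarrow> 'b::euclidean_space"
  assumes "\<And>x. (F has_vector_derivative f x) (at x)" and cont: "continuous_on UNIV f"
  shows "(LINT x|circle. f x) = F (2 * pi) - F 0"
  unfolding integral_circle_Icc[OF cont]
  by (rule integral_FTC_atLeastAtMost)
     (use assms in \<open>auto intro: has_vector_derivative_at_within continuous_on_subset\<close>)

lemma has_vector_derivative_chr:
  "(chr m has_vector_derivative \<i> * of_int m * chr m x) (at x)"
  unfolding has_vector_derivative_def
  by (auto intro!: derivative_eq_intros simp: scaleR_conv_of_real algebra_simps)

lemma chr_mult: "chr m x * chr n x = chr (m + n) x"
  by (simp add: cis_mult algebra_simps)

lemma chr_2pi [simp]: "cis (of_int m * (2 * pi)) = 1"
  using cis_multiple_2pi[of "of_int m"] by (simp add: mult.commute)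

lemma chr_periodic: "chr m (x + 2 * pi) = chr m x"
  by (simp add: distrib_left cis_mult [symmetric])

lemma integral_chr: "(LINT x|circle. chr m x) = (if m = 0 then 2 * pi else 0)"
proof (cases "m = 0")
  case True
  then show ?thesis using emeasure_circle by (simp add: measure_def scaleR_conv_of_real)
next
  case False
  have "(LINT x|circle. chr m x) = chr m (2*pi) / (\<i> * of_int m) - chr m 0 / (\<i> * of_int m)"
  proof (rule integral_circle_derivative)
    show "((\<lambda>x. chr m x / (\<i> * of_int m)) has_vector_derivative chr m x) (at x)" for x
      using has_vector_derivative_divide[OF has_vector_derivative_chr[of m x], of "\<i> * of_int m"] False
      by simp
  qed (intro continuous_intros)
  then show ?thesis using False by simp
qed

lemma integral_chr_mult: "(LINT x|circle. chr m x * chr n x) = (if m + n = 0 then 2 * pi else 0)"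
  using integral_chr[of "m + n"] by (simp add: chr_mult del: of_int_add)

lemma integrable_mult_chr:
  assumes "integrable circle f" shows "integrable circle (\<lambda>x. f x * chr m x)"
  by (rule Bochner_Integration.integrable_bound[OF assms])
     (use assms in \<open>auto simp: norm_mult\<close>)

lemma integrable_mult_bounded:
  fixes f g :: "real \<Rightarrow> complex"
  assumes "integrable circle f" "g \<in> borel_measurable circle" "\<And>x. norm (g x) \<le> B"
  shows "integrable circle (\<lambda>x. f x * g x)"
proof (rule Bochner_Integration.integrable_bound)
  show "integrable circle (\<lambda>x. B * norm (f x))" using assms(1) by simp
  show "AE x in circle. norm (f x * g x) \<le> norm (B * norm (f x))"
  proof (rule AE_I2)
    fix x
    have "norm (f x) * norm (g x) \<le> norm (f x) * B" using assms(3) by (intro mult_left_mono) auto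
    then show "norm (f x * g x) \<le> norm (B * norm (f x))"
      using abs_ge_self[of "B * norm (f x)"] by (simp add: norm_mult mult.commute)
  qed
qed (use assms in measurable)

subsection \<open>Test functions\<close>

lemma periodic_int:
  assumes "\<And>\<theta>::real. f (\<theta> + 2 * pi) = f \<theta>"
  shows "f (\<theta> + 2 * pi * of_int k) = f \<theta>"
proof (induction k rule: int_induct[of _ 0])
  case (step1 i)
  then show ?case using assms[of "\<theta> + 2 * pi * of_int i"] by (simp add: algebra_simps)
next
  case (step2 i)
  then show ?case using assms[of "\<theta> + 2 * pi * of_int (i - 1)"] by (simp add: algebra_simps)
qed simp

text \<open>Two arguments of the same point differ by a multiple of 2 pi. Periodic functions can
  thus be evaluated through either \<open>Arg\<close> or \<open>Arg2pi\<close>, in particular at an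
  argument in [0, 2 pi].\<close>

lemma periodic_cis_eq:
  assumes "\<And>\<theta>::real. f (\<theta> + 2 * pi) = f \<theta>" and "cis a = cis b"
  shows "f a = f b"
proof -
  have "sin a = sin b \<and> cos a = cos b" using assms(2) by (auto simp: complex_eq_iff)
  then obtain n :: int where n: "a = b + 2 * pi * of_int n"
    using sin_cos_eq_iff[of a b] by (auto simp: mult_ac)
  show ?thesis unfolding n using assms(1) by (rule periodic_int)
qed

lemma periodic_bounded:
  fixes f :: "real \<Rightarrow> 'b::euclidean_space"
  assumes per: "\<And>\<theta>. f (\<theta> + 2 * pi) = f \<theta>" and cont: "continuous_on UNIV f"
  obtains B where "\<And>\<theta>. norm (f \<theta>) \<le> B"
proof -
  have "compact (f ` {0..2*pi})"
    using cont by (intro compact_continuous_image) (auto intro: continuous_on_subset)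
  then obtain B where "\<forall>y\<in>f ` {0..2*pi}. norm y \<le> B"
    unfolding compact_eq_bounded_closed bounded_iff by blast
  then have B: "\<And>x. x \<in> {0..2*pi} \<Longrightarrow> norm (f x) \<le> B" by blast
  have "norm (f \<theta>) \<le> B" for \<theta>
  proof -
    have "cis (Arg2pi (cis \<theta>)) = cis \<theta>"
      using Arg2pi_eq[of "cis \<theta>"] by (simp add: cis_conv_exp)
    then have "f (Arg2pi (cis \<theta>)) = f \<theta>" by (rule periodic_cis_eq[of f, OF per])
    moreover have "Arg2pi (cis \<theta>) \<in> {0..2*pi}"
      using Arg2pi[of "cis \<theta>"] by auto
    ultimately show ?thesis using B by metis
  qed
  then show ?thesis by (rule that)
qed

lemma nth_deriv_0 [simp]: "nth_deriv 0 \<phi> = \<phi>"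
  by (simp add: nth_deriv_def)

lemma nth_deriv_Suc: "nth_deriv (Suc k) \<phi> = (\<lambda>\<theta>. vector_derivative (nth_deriv k \<phi>) (at \<theta>))"
  by (simp add: nth_deriv_def)

lemma nth_deriv_nth_deriv: "nth_deriv j (nth_deriv k \<phi>) = nth_deriv (j + k) \<phi>"
  by (simp add: nth_deriv_def funpow_add)

lemma test_periodic: "\<phi> \<in> test_functions \<Longrightarrow> \<phi> (\<theta> + 2 * pi) = \<phi> \<theta>"
  by (simp add: test_functions_def)

lemma test_has_derivative:
  "\<phi> \<in> test_functions \<Longrightarrow>
    (nth_deriv k \<phi> has_vector_derivative nth_deriv (Suc k) \<phi> \<theta>) (at \<theta>)"
  by (simp add: test_functions_def nth_deriv_Suc vector_derivative_works[symmetric])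

lemma nth_deriv_test:
  assumes "\<phi> \<in> test_functions" shows "nth_deriv k \<phi> \<in> test_functions"
proof -
  have "nth_deriv k \<phi> (\<theta> + 2 * pi) = nth_deriv k \<phi> \<theta>" for \<theta>
  proof (induction k arbitrary: \<theta>)
    case 0
    then show ?case using assms by (simp add: test_periodic)
  next
    case (Suc k)
    \<comment> \<open>Differentiate the translate by 2 pi: by the induction hypothesis it is the
      same function, so the derivatives agree by uniqueness.\<close>
    have "((\<lambda>x. nth_deriv k \<phi> (x + 2*pi)) has_vector_derivative nth_deriv (Suc k) \<phi> (\<theta> + 2*pi)) (at \<theta>)"
    proof -
      have "((\<lambda>x. x + 2*pi) has_vector_derivative 1) (at \<theta>)"
        by (auto intro!: derivative_eq_intros)
      from vector_diff_chain_at[OF this test_has_derivative[OF assms]] show ?thesis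
        by (simp add: o_def)
    qed
    then have "(nth_deriv k \<phi> has_vector_derivative nth_deriv (Suc k) \<phi> (\<theta> + 2*pi)) (at \<theta>)"
      by (simp add: Suc)
    then show ?case
      using test_has_derivative[OF assms] vector_derivative_unique_at by blast
  qed
  then show ?thesis using assms by (auto simp: test_functions_def nth_deriv_nth_deriv)
qed

lemma test_continuous:
  assumes "\<phi> \<in> test_functions" shows "continuous_on UNIV \<phi>"
proof -
  have "isCont \<phi> x" for x
    using test_has_derivative[OF assms, of 0 x] has_vector_derivative_continuous by auto
  then show ?thesis by (simp add: continuous_at_imp_continuous_on)
qed

lemma test_bounded:
  assumes "\<phi> \<in> test_functions" obtains B where "\<And>\<theta>. norm (\<phi> \<theta>) \<le> B"
  using periodic_bounded[OF test_periodic[OF assms] test_continuous[OF assms]] by blast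

lemma test_bdd_above: "\<phi> \<in> test_functions \<Longrightarrow> bdd_above (range (\<lambda>\<theta>. norm (\<phi> \<theta>)))"
  using test_bounded[of \<phi>] by (metis bdd_aboveI2)

lemma norm_le_SUP_nth_deriv:
  "\<phi> \<in> test_functions \<Longrightarrow> norm (nth_deriv k \<phi> \<theta>) \<le> (SUP \<theta>. norm (nth_deriv k \<phi> \<theta>))"
  by (intro cSUP_upper test_bdd_above nth_deriv_test) auto

lemma test_measurable: "\<phi> \<in> test_functions \<Longrightarrow> \<phi> \<in> borel_measurable circle"
  by (intro measurable_continuous_circle test_continuous)

lemma integrable_mult_test:
  assumes "integrable circle f" "\<phi> \<in> test_functions"
  shows "integrable circle (\<lambda>x. f x * \<phi> x)"
  using test_bounded[OF assms(2)] integrable_mult_bounded[OF assms(1) test_measurable[OF assms(2)]]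
  by metis

lemma nth_deriv_add_scale:
  assumes "\<phi> \<in> test_functions" "\<psi> \<in> test_functions"
  shows "nth_deriv k (\<lambda>\<theta>. \<phi> \<theta> + c * \<psi> \<theta>) = (\<lambda>\<theta>. nth_deriv k \<phi> \<theta> + c * nth_deriv k \<psi> \<theta>)"
proof (induction k)
  case (Suc k)
  have "((\<lambda>\<theta>. nth_deriv k \<phi> \<theta> + c * nth_deriv k \<psi> \<theta>) has_vector_derivative
      nth_deriv (Suc k) \<phi> \<theta> + c * nth_deriv (Suc k) \<psi> \<theta>) (at \<theta>)" for \<theta>
    using assms by (intro derivative_intros test_has_derivative has_vector_derivative_mult_right)
  then show ?case unfolding nth_deriv_Suc[of k "\<lambda>\<theta>. \<phi> \<theta> + c * \<psi> \<theta>"] Suc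
    by (intro ext vector_derivative_at)
qed simp

lemma test_add_scale:
  assumes "\<phi> \<in> test_functions" "\<psi> \<in> test_functions"
  shows "(\<lambda>\<theta>. \<phi> \<theta> + c * \<psi> \<theta>) \<in> test_functions"
proof -
  have "nth_deriv k \<phi> differentiable at \<theta>" "nth_deriv k \<psi> differentiable at \<theta>" for k \<theta>
    using assms by (auto simp: test_functions_def)
  then show ?thesis
    unfolding test_functions_def mem_Collect_eq nth_deriv_add_scale[OF assms]
    using assms by (auto simp: test_periodic intro!: derivative_intros)
qed

lemma nth_deriv_zero: "nth_deriv k (\<lambda>_. 0) = (\<lambda>_. 0)"
  by (induction k) (auto simp: nth_deriv_Suc)

lemma test_zero: "(\<lambda>_. 0) \<in> test_functions"
  by (simp add: test_functions_def nth_deriv_zero)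

lemma test_add:
  "\<phi> \<in> test_functions \<Longrightarrow> \<psi> \<in> test_functions \<Longrightarrow> (\<lambda>\<theta>. \<phi> \<theta> + \<psi> \<theta>) \<in> test_functions"
  using test_add_scale[of \<phi> \<psi> 1] by simp

lemma test_scale: "\<phi> \<in> test_functions \<Longrightarrow> (\<lambda>\<theta>. c * \<phi> \<theta>) \<in> test_functions"
  using test_add_scale[OF test_zero, of \<phi> c] by simp

lemma nth_deriv_chr: "nth_deriv k (chr m) = (\<lambda>\<theta>. (\<i> * of_int m) ^ k * chr m \<theta>)"
proof (induction k)
  case (Suc k)
  have "((\<lambda>\<theta>. (\<i> * of_int m) ^ k * chr m \<theta>) has_vector_derivative
     (\<i> * of_int m) ^ k * (\<i> * of_int m * chr m \<theta>)) (at \<theta>)" for \<theta>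
    by (intro has_vector_derivative_mult_right has_vector_derivative_chr)
  then show ?case unfolding nth_deriv_Suc Suc
    by (intro ext vector_derivative_at) (simp add: mult_ac)
qed simp

lemma test_chr: "chr m \<in> test_functions"
proof -
  have "(\<lambda>\<theta>. (\<i> * of_int m) ^ k * chr m \<theta>) differentiable at \<theta>" for k \<theta>
    using has_vector_derivative_mult_right[OF has_vector_derivative_chr, of "(\<i> * of_int m) ^ k" m \<theta>]
    by (rule differentiableI_vector)
  then show ?thesis
    unfolding test_functions_def mem_Collect_eq nth_deriv_chr using chr_periodic by auto
qed

lemma test_sum_chr: "finite F \<Longrightarrow> (\<lambda>\<theta>. \<Sum>m\<in>F. c m * chr m \<theta>) \<in> test_functions"
  by (induction F rule: finite_induct) (auto simp: test_zero intro!: test_add test_scale test_chr)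

lemma nth_deriv_sum_chr:
  "finite F \<Longrightarrow> nth_deriv k (\<lambda>\<theta>. \<Sum>m\<in>F. c m * chr m \<theta>) =
     (\<lambda>\<theta>. \<Sum>m\<in>F. c m * (\<i> * of_int m) ^ k * chr m \<theta>)"
proof (induction F rule: finite_induct)
  case (insert x F)
  have "(\<lambda>\<theta>. \<Sum>m\<in>insert x F. c m * chr m \<theta>) = (\<lambda>\<theta>. (\<Sum>m\<in>F. c m * chr m \<theta>) + c x * chr x \<theta>)"
    using insert by (simp add: add.commute)
  then show ?case
    using insert nth_deriv_add_scale[OF test_sum_chr test_chr, OF insert(1), of k c "c x" x]
    by (simp add: nth_deriv_chr add.commute mult.assoc)
qed (simp add: nth_deriv_zero)

text \<open>Integration by parts; the boundary terms cancel by periodicity. This turns smoothness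
  into decay of coefficients.\<close>

lemma integral_deriv_chr:
  assumes "\<phi> \<in> test_functions"
  shows "(LINT x|circle. nth_deriv k \<phi> x * chr m x) = (- \<i> * of_int m) ^ k * (LINT x|circle. \<phi> x * chr m x)"
proof (induction k)
  case (Suc k)
  let ?p = "nth_deriv k \<phi>" and ?q = "nth_deriv (Suc k) \<phi>"
  have c: "continuous_on UNIV ?p" "continuous_on UNIV ?q"
    using assms by (auto intro!: test_continuous nth_deriv_test)
  have i: "integrable circle (\<lambda>x. ?q x * chr m x)"
    "integrable circle (\<lambda>x. ?p x * (\<i> * of_int m * chr m x))"
    by (intro integrable_circle_continuous continuous_intros c)+
  have "(LINT x|circle. ?p x * (\<i> * of_int m * chr m x) + ?q x * chr m x) =
      ?p (2*pi) * chr m (2*pi) - ?p 0 * chr m 0"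
    by (rule integral_circle_derivative)
       (intro has_vector_derivative_mult test_has_derivative assms has_vector_derivative_chr
         continuous_intros c)+
  also have "\<dots> = 0" using test_periodic[OF nth_deriv_test[OF assms], of k 0] by simp
  finally have "(LINT x|circle. ?q x * chr m x) = - (LINT x|circle. ?p x * (\<i> * of_int m * chr m x))"
    using i by (simp add: eq_neg_iff_add_eq_0 add.commute)
  also have "\<dots> = - (\<i> * of_int m) * (LINT x|circle. ?p x * chr m x)"
    by (subst integral_mult_right_zero[symmetric]) (simp add: mult_ac)
  finally show ?case using Suc by simp
qed simp

lemma norm_integral_chr_le:
  assumes "integrable circle f"
  shows "norm (LINT x|circle. f x * chr m x) \<le> (LINT x|circle. norm (f x))"
  using integral_norm_bound[of circle "\<lambda>x. f x * chr m x"] by (simp add: norm_mult)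

subsection \<open>Uniqueness of Fourier coefficients\<close>

text \<open>Multiplication by a polynomial in \<open>cos\<close> and \<open>sin\<close> preserves the vanishing of all Fourier coefficients, so by
  Stone--Weierstrass a continuous function with vanishing coefficients is orthogonal to itself.\<close>

lemma null_coeffs_mult_polynomial:
  assumes "real_polynomial_function p" "continuous_on UNIV d"
    and "\<And>m. (LINT x|circle. d x * chr m x) = 0"
  shows "(LINT x|circle. d x * of_real (p (cis x)) * chr m x) = 0"
  using assms
proof (induction p arbitrary: d m)
  case (linear h)
  interpret h: bounded_linear h by fact
  \<comment> \<open>Euler's formula: these weights rewrite h(1) cos x + h(\<i>) sin x in terms of
    \<open>chr 1\<close> and \<open>chr (-1)\<close>, so a linear factor only shifts the index of
    the coefficients.\<close>
  define A where "A = (of_real (h 1) - \<i> * of_real (h \<i>)) / 2"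
  define B where "B = (of_real (h 1) + \<i> * of_real (h \<i>)) / 2"
  have "of_real (h (cis x)) = A * chr 1 x + B * chr (-1) x" for x
  proof -
    have "cis x = cos x *\<^sub>R 1 + sin x *\<^sub>R \<i>" by (simp add: complex_eq_iff)
    then have "h (cis x) = cos x * h 1 + sin x * h \<i>" by (metis h.add h.scaleR real_scaleR_def)
    then show ?thesis by (simp add: A_def B_def complex_eq_iff field_simps)
  qed
  then have "(\<lambda>x. d x * of_real (h (cis x)) * chr m x) =
      (\<lambda>x. A * (d x * chr (m + 1) x) + B * (d x * chr (m - 1) x))"
    using chr_mult[of 1 _ m] chr_mult[of "-1" _ m] by (auto simp: fun_eq_iff algebra_simps)
  moreover have "integrable circle (\<lambda>x. d x * chr n x)" for n
    by (intro integrable_circle_continuous continuous_intros linear)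
  ultimately show ?case
    by (simp add: linear.prems(2) del: of_int_add of_int_diff)
next
  case (const c)
  have "(LINT x|circle. d x * of_real c * chr m x) = of_real c * (LINT x|circle. d x * chr m x)"
    by (subst integral_mult_right_zero[symmetric]) (simp add: mult_ac)
  then show ?case using const by simp
next
  case (add p q)
  have c: "continuous_on UNIV p" "continuous_on UNIV q"
    by (simp_all add: continuous_at_imp_continuous_on continuous_real_polymonial_function add.hyps)
  have "continuous_on UNIV (\<lambda>x. p (cis x))" "continuous_on UNIV (\<lambda>x. q (cis x))"
    by (auto intro!: continuous_on_compose2[OF c(1)] continuous_on_compose2[OF c(2)] continuous_intros)
  then have "integrable circle (\<lambda>x. d x * of_real (p (cis x)) * chr m x)"
      "integrable circle (\<lambda>x. d x * of_real (q (cis x)) * chr m x)"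
    by (auto intro!: integrable_circle_continuous continuous_intros add.prems)
  then show ?case using add.IH[OF add.prems] by (simp add: algebra_simps)
next
  case (mult p q)
  have c: "continuous_on UNIV p"
    by (simp add: continuous_at_imp_continuous_on continuous_real_polymonial_function mult.hyps)
  have "continuous_on UNIV (\<lambda>x. p (cis x))"
    by (auto intro!: continuous_on_compose2[OF c] continuous_intros)
  \<comment> \<open>The factor p is absorbed into d: the hypothesis for p says that the new function
    again has null coefficients, so the hypothesis for q applies to it. This is why d is generalized
    in the induction.\<close>
  then have "continuous_on UNIV (\<lambda>x. d x * of_real (p (cis x)))"
    by (intro continuous_intros mult.prems)
  from mult.IH(2)[OF this mult.IH(1)[OF mult.prems], of m] show ?case
    by (simp add: mult.assoc)
qed

text \<open>\<open>Arg\<close> jumps across the negative real axis and \<open>Arg2pi\<close> across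
  the positive one. On the unit circle these cuts do not meet, and composed with a periodic function
  both branches agree, so at each point one of them gives continuity.\<close>

lemma continuous_on_periodic_Arg:
  fixes d :: "real \<Rightarrow> complex"
  assumes per: "\<And>\<theta>. d (\<theta> + 2 * pi) = d \<theta>" and cont: "continuous_on UNIV d"
  shows "continuous_on (sphere 0 1) (\<lambda>z. d (Arg z))"
proof -
  have eq: "d (Arg z) = d (Arg2pi z)" if "z \<in> sphere 0 1" for z
  proof (rule periodic_cis_eq[of d, OF per])
    have "norm z = 1" "z \<noteq> 0" using that by auto
    then show "cis (Arg z) = cis (Arg2pi z)"
      using Arg2pi_eq[of z] cis_Arg[of z] by (simp add: cis_conv_exp sgn_eq)
  qed
  have "continuous (at z within sphere 0 1) (\<lambda>z. d (Arg z))" if z: "z \<in> sphere 0 1" for z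
  proof (cases "z \<in> \<real>\<^sub>\<le>\<^sub>0")
    case False
    have "isCont (\<lambda>z. d (Arg z)) z"
      by (rule isCont_o2[OF continuous_at_Arg[OF False]]) (use cont in \<open>simp add: continuous_on_eq_continuous_at\<close>)
    then show ?thesis by (rule continuous_at_imp_continuous_within)
  next
    case True
    with z have False: "z \<notin> \<real>\<^sub>\<ge>\<^sub>0" by (auto simp: complex_nonneg_Reals_iff complex_nonpos_Reals_iff cmod_def)
    have "isCont (\<lambda>z. d (Arg2pi z)) z"
      by (rule isCont_o2[OF continuous_at_Arg2pi[OF False]]) (use cont in \<open>simp add: continuous_on_eq_continuous_at\<close>)
    then have "continuous (at z within sphere 0 1) (\<lambda>z. d (Arg2pi z))" by (rule continuous_at_imp_continuous_within)
    then show ?thesis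
      by (rule continuous_transform_within[OF _ zero_less_one z]) (use eq in auto)
  qed
  then show ?thesis by (simp add: continuous_on_eq_continuous_within)
qed

lemma continuous_circle_integral_0:
  fixes f :: "real \<Rightarrow> real"
  assumes "continuous_on UNIV f" "\<And>x. 0 \<le> f x" "(LINT x|circle. f x) = 0" "x \<in> {0..2*pi}"
  shows "f x = 0"
proof (rule has_integral_0_cbox_imp_0[of 0 "2*pi" f])
  have "set_integrable lborel {0..2*pi} f"
    unfolding set_integrable_def using assms(1)
    by (intro borel_integrable_compact) (auto intro: continuous_on_subset)
  from set_borel_integral_eq_integral[OF this]
  have "f integrable_on {0..2*pi}" "integral {0..2*pi} f = 0"
    using assms(3) integral_circle_Icc[OF assms(1)] by (auto simp: set_lebesgue_integral_def)
  then show "(f has_integral 0) (cbox 0 (2*pi))"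
    by (simp add: has_integral_iff)
qed (use assms pi_gt_zero in \<open>auto intro: continuous_on_subset simp: not_le[symmetric]\<close>)

lemma null_coeffs_imp_zero:
  fixes d :: "real \<Rightarrow> complex"
  assumes per: "\<And>\<theta>. d (\<theta> + 2 * pi) = d \<theta>" and cont: "continuous_on UNIV d"
    and null: "\<And>m. (LINT x|circle. d x * chr m x) = 0"
  shows "d \<theta> = 0"
proof -
  \<comment> \<open>The conjugate is the function to approximate: a polynomial g close to it makes d
    * g close to |d|^2, while d * g integrates to zero.\<close>
  define D where "D = (\<lambda>z. cnj (d (Arg z)))"
  have D: "continuous_on (sphere 0 1) D"
    unfolding D_def by (intro continuous_intros continuous_on_periodic_Arg per cont)
  have Dcis: "D (cis x) = cnj (d x)" for x
  proof -
    have "cis (Arg (cis x)) = cis x" using cis_Arg[of "cis x"] by simp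
    then have "d (Arg (cis x)) = d x" by (rule periodic_cis_eq[of d, OF per])
    then show ?thesis by (simp add: D_def)
  qed
  define K where "K = (LINT x|circle. norm (d x))"
  have "K \<ge> 0" unfolding K_def by simp
  have nint: "integrable circle (\<lambda>x. norm (d x))"
    by (intro integrable_circle_continuous continuous_intros cont)
  have small: "norm (LINT x|circle. d x * cnj (d x)) \<le> e * K" if "e > 0" for e
  proof -
    obtain g where g: "polynomial_function g" "\<And>z. z \<in> sphere 0 1 \<Longrightarrow> norm (D z - g z) < e"
      using Stone_Weierstrass_polynomial_function[OF compact_sphere D \<open>e > 0\<close>] by blast
    have "real_polynomial_function (Re \<circ> g)" "real_polynomial_function (Im \<circ> g)"
      using g(1) bounded_linear_Re bounded_linear_Im by (auto simp: polynomial_function_def)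
    from this[THEN null_coeffs_mult_polynomial, OF cont null, of 0]
    have R: "(LINT x|circle. d x * of_real (Re (g (cis x)))) = 0"
      and I: "(LINT x|circle. d x * of_real (Im (g (cis x)))) = 0" by (simp_all add: o_def)
    have gc: "continuous_on UNIV (\<lambda>x. g (cis x))"
      by (rule continuous_on_compose2[OF continuous_on_polymonial_function[OF g(1), of UNIV]])
         (auto intro!: continuous_intros)
    have i: "integrable circle (\<lambda>x. d x * of_real (Re (g (cis x))))"
        "integrable circle (\<lambda>x. d x * of_real (Im (g (cis x))))"
        "integrable circle (\<lambda>x. d x * g (cis x))"
        "integrable circle (\<lambda>x. d x * cnj (d x))"
      by (intro integrable_circle_continuous continuous_intros cont gc)+
    have "(LINT x|circle. d x * g (cis x)) =
        (LINT x|circle. d x * of_real (Re (g (cis x))) + \<i> * (d x * of_real (Im (g (cis x)))))"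
      by (rule Bochner_Integration.integral_cong)
         (auto simp: complex_eq_iff algebra_simps)
    also have "\<dots> = 0" using i R I by simp
    finally have "(LINT x|circle. d x * cnj (d x)) = (LINT x|circle. d x * cnj (d x) - d x * g (cis x))"
      using i by simp
    also have "norm \<dots> \<le> (LINT x|circle. norm (d x * cnj (d x) - d x * g (cis x)))"
      by (rule integral_norm_bound)
    also have "\<dots> \<le> (LINT x|circle. e * norm (d x))"
    proof (rule integral_mono)
      show "integrable circle (\<lambda>x. norm (d x * cnj (d x) - d x * g (cis x)))"
        using i by (intro integrable_norm Bochner_Integration.integrable_diff)
      fix x
      have "norm (cnj (d x) - g (cis x)) \<le> e" using g(2)[of "cis x"] by (simp add: Dcis)
      then show "norm (d x * cnj (d x) - d x * g (cis x)) \<le> e * norm (d x)"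
        unfolding right_diff_distrib[symmetric] norm_mult
        by (subst mult.commute) (intro mult_right_mono, auto)
    qed (use nint in simp)
    also have "\<dots> = e * K" by (simp add: K_def)
    finally show ?thesis .
  qed
  have "norm (LINT x|circle. d x * cnj (d x)) \<le> 0 + e" if "e > 0" for e
  proof -
    \<comment> \<open>Dividing by K + 1 instead of K covers K = 0.\<close>
    have "norm (LINT x|circle. d x * cnj (d x)) \<le> e / (K + 1) * K"
      using that \<open>K \<ge> 0\<close> by (intro small) auto
    also have "\<dots> \<le> e" using that \<open>K \<ge> 0\<close> by (simp add: field_simps)
    finally show ?thesis by simp
  qed
  then have "norm (LINT x|circle. d x * cnj (d x)) \<le> 0" by (rule field_le_epsilon)
  moreover have "(LINT x|circle. d x * cnj (d x)) = of_real (LINT x|circle. (norm (d x))\<^sup>2)"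
    unfolding integral_complex_of_real[symmetric]
    by (intro Bochner_Integration.integral_cong refl) (simp only: complex_norm_square)
  ultimately have "(LINT x|circle. (norm (d x))\<^sup>2) \<le> 0" by simp
  moreover have "(LINT x|circle. (norm (d x))\<^sup>2) \<ge> 0" by simp
  ultimately have 0: "(LINT x|circle. (norm (d x))\<^sup>2) = 0" by linarith
  have "(norm (d x))\<^sup>2 = 0" if "x \<in> {0..2*pi}" for x
    by (rule continuous_circle_integral_0[OF _ _ 0 that]) (intro continuous_intros cont, simp)
  then have *: "d x = 0" if "x \<in> {0..2*pi}" for x using that by auto
  have "cis (Arg2pi (cis \<theta>)) = cis \<theta>"
    using Arg2pi_eq[of "cis \<theta>"] by (simp add: cis_conv_exp)
  then have "d (Arg2pi (cis \<theta>)) = d \<theta>" by (rule periodic_cis_eq[of d, OF per])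
  moreover have "Arg2pi (cis \<theta>) \<in> {0..2*pi}" using Arg2pi[of "cis \<theta>"] by auto
  ultimately show ?thesis using * by metis
qed

subsection \<open>Absolutely convergent Fourier series\<close>

definition fourier_series :: "(int \<Rightarrow> complex) \<Rightarrow> real \<Rightarrow> complex" where
  "fourier_series c = (\<lambda>x. \<Sum>\<^sub>\<infinity>m\<in>UNIV. c m * chr m x)"

context
  fixes c :: "int \<Rightarrow> complex"
  assumes summ: "(\<lambda>m. norm (c m)) summable_on UNIV"
begin

lemma fourier_series_uniform_limit:
  "uniform_limit UNIV (\<lambda>F x. \<Sum>m\<in>F. c m * chr m x) (fourier_series c) (finite_subsets_at_top UNIV)"
  unfolding fourier_series_def
  by (rule Weierstrass_m_test_general[OF _ summ]) (simp add: norm_mult)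

lemma fourier_series_has_sum: "((\<lambda>m. c m * chr m x) has_sum fourier_series c x) UNIV"
  unfolding fourier_series_def
  by (rule has_sum_infsum, rule abs_summable_summable) (use summ in \<open>simp add: norm_mult\<close>)

lemma continuous_fourier_series: "continuous_on UNIV (fourier_series c)"
  by (rule uniform_limit_theorem[OF _ fourier_series_uniform_limit])
     (auto intro!: always_eventually continuous_intros)

lemma fourier_series_periodic: "fourier_series c (x + 2 * pi) = fourier_series c x"
  unfolding fourier_series_def by (simp only: chr_periodic)

lemma integrable_fourier_series: "integrable circle (fourier_series c)"
  by (rule integrable_circle_continuous[OF continuous_fourier_series])

lemma integrable_mult_fourier_series:
  assumes "integrable circle f" shows "integrable circle (\<lambda>x. fourier_series c x * f x)"
proof -
  obtain B where "\<And>x. norm (fourier_series c x) \<le> B"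
    using periodic_bounded[OF fourier_series_periodic continuous_fourier_series] by blast
  from integrable_mult_bounded[OF assms measurable_continuous_circle[OF continuous_fourier_series] this]
  show ?thesis by (simp add: mult.commute)
qed

text \<open>Uniform convergence of the partial sums allows termwise integration against an
  integrable f. Coefficients, Parseval's identity, the Poisson integral and the action of
  multipliers are all read off from this.\<close>

lemma has_sum_integral_fourier_series:
  assumes f: "integrable circle f"
  shows "((\<lambda>m. c m * (LINT x|circle. chr m x * f x)) has_sum
    (LINT x|circle. fourier_series c x * f x)) UNIV"
  unfolding has_sum_def
proof (rule tendstoI)
  fix e :: real assume "e > 0"
  define K where "K = (LINT x|circle. norm (f x))"
  have "K \<ge> 0" unfolding K_def by simp
  then have "e / (K + 1) > 0" using \<open>e > 0\<close> by simp
  from uniform_limitD[OF fourier_series_uniform_limit this]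
  have "\<forall>\<^sub>F F in finite_subsets_at_top UNIV. \<forall>x. dist (\<Sum>m\<in>F. c m * chr m x) (fourier_series c x) < e / (K + 1)"
    by simp
  then show "\<forall>\<^sub>F F in finite_subsets_at_top UNIV.
      dist (\<Sum>m\<in>F. c m * (LINT x|circle. chr m x * f x)) (LINT x|circle. fourier_series c x * f x) < e"
  proof eventually_elim
    case (elim F)
    have i: "integrable circle (\<lambda>x. chr m x * f x)" for m
      using integrable_mult_chr[OF f] by (simp add: mult.commute)
    have iS: "integrable circle (\<lambda>x. (\<Sum>m\<in>F. c m * chr m x) * f x)"
      unfolding sum_distrib_right mult.assoc using i by simp
    have "(\<Sum>m\<in>F. c m * (LINT x|circle. chr m x * f x)) = (LINT x|circle. (\<Sum>m\<in>F. c m * chr m x) * f x)"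
      unfolding sum_distrib_right mult.assoc using i by (subst Bochner_Integration.integral_sum) auto
    then have "dist (\<Sum>m\<in>F. c m * (LINT x|circle. chr m x * f x)) (LINT x|circle. fourier_series c x * f x)
      = norm (LINT x|circle. (\<Sum>m\<in>F. c m * chr m x) * f x - fourier_series c x * f x)"
      using iS integrable_mult_fourier_series[OF f] by (simp add: dist_norm)
    also have "\<dots> \<le> (LINT x|circle. norm ((\<Sum>m\<in>F. c m * chr m x) * f x - fourier_series c x * f x))"
      by (rule integral_norm_bound)
    also have "\<dots> \<le> (LINT x|circle. e / (K + 1) * norm (f x))"
    proof (rule integral_mono)
      fix x
      have "norm ((\<Sum>m\<in>F. c m * chr m x) - fourier_series c x) \<le> e / (K + 1)"
        using elim[rule_format, of x] by (simp add: dist_norm)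
      then show "norm ((\<Sum>m\<in>F. c m * chr m x) * f x - fourier_series c x * f x) \<le> e / (K + 1) * norm (f x)"
        unfolding left_diff_distrib[symmetric] norm_mult by (intro mult_right_mono) auto
    qed (use iS integrable_mult_fourier_series[OF f] f in auto)
    also have "\<dots> = e / (K + 1) * K" by (simp add: K_def)
    also have "\<dots> < e" using \<open>e > 0\<close> \<open>K \<ge> 0\<close> by (simp add: field_simps)
    finally show ?case .
  qed
qed

lemma integral_fourier_series_chr: "(LINT x|circle. fourier_series c x * chr n x) = 2 * pi * c (- n)"
proof -
  have "integrable circle (chr n)" by (intro integrable_circle_continuous continuous_intros)
  from has_sum_integral_fourier_series[OF this]
  have "((\<lambda>m. c m * (if m + n = 0 then 2 * pi else 0)) has_sum (LINT x|circle. fourier_series c x * chr n x)) UNIV"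
    unfolding integral_chr_mult .
  moreover have "((\<lambda>m. c m * (if m + n = 0 then 2 * pi else 0)) has_sum (2 * pi * c (- n))) UNIV"
    by (rule has_sum_finite_neutralI[of "{- n}"]) auto
  ultimately show ?thesis by (rule has_sum_unique)
qed

lemma fourier_coeff_fourier_series: "fourier_coeff (dist_of (fourier_series c)) n = c n"
  using integral_fourier_series_chr[of "- n"] by (simp add: fourier_coeff_chr dist_of_def)

end

text \<open>The integers are the union of two images of the naturals; their overlap at 0 is harmless
  for summability.\<close>

lemma summable_on_int_abs:
  fixes f :: "nat \<Rightarrow> real"
  assumes "summable f" "\<And>n. f n \<ge> 0"
  shows "(\<lambda>m::int. f (nat \<bar>m\<bar>)) summable_on UNIV"
proof -
  have f: "f summable_on UNIV"
    using assms by (intro norm_summable_imp_summable_on) simp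
  have "(\<lambda>m::int. f (nat \<bar>m\<bar>)) summable_on range int"
    by (subst summable_on_reindex) (use f in \<open>auto simp: o_def\<close>)
  moreover have "(\<lambda>m::int. f (nat \<bar>m\<bar>)) summable_on range (\<lambda>n. - int n)"
    by (subst summable_on_reindex) (use f in \<open>auto simp: o_def inj_on_def\<close>)
  ultimately have "(\<lambda>m::int. f (nat \<bar>m\<bar>)) summable_on range int \<union> range (\<lambda>n. - int n)"
    by (rule summable_on_union)
  moreover have "range int \<union> range (\<lambda>n. - int n) = UNIV"
    by (auto simp: image_iff) (metis int_cases2)
  ultimately show ?thesis by simp
qed

lemma summable_on_decay:
  fixes c :: "int \<Rightarrow> complex"
  assumes "norm (c m) \<le> B" "\<And>m. m \<noteq> 0 \<Longrightarrow> \<bar>real_of_int m\<bar> ^ 2 * norm (c m) \<le> B"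
  shows "(\<lambda>m. norm (c m)) summable_on UNIV"
proof -
  have "summable (\<lambda>n. inverse (real n ^ 2))"
    using inverse_power_summable[of 2] by simp
  then have "(\<lambda>m::int. inverse (real (nat \<bar>m\<bar>) ^ 2)) summable_on UNIV"
    by (rule summable_on_int_abs) simp
  then have "(\<lambda>m::int. B * inverse (real (nat \<bar>m\<bar>) ^ 2)) summable_on (UNIV - {0})"
    by (intro summable_on_cmult_right) (auto intro: summable_on_subset)
  then have "(\<lambda>m. norm (c m)) summable_on (UNIV - {0})"
  proof (rule summable_on_comparison_test)
    fix m :: int assume "m \<in> UNIV - {0}"
    then show "norm (c m) \<le> B * inverse (real (nat \<bar>m\<bar>) ^ 2)"
      using assms(2)[of m] by (simp add: field_simps)
  qed simp
  then have "(\<lambda>m. norm (c m)) summable_on ((UNIV - {0}) \<union> {0})"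
    by (intro summable_on_union) auto
  then show ?thesis by (simp add: insert_absorb Un_commute)
qed

subsection \<open>Fourier expansion of test functions and distributions\<close>

definition test_coeff :: "(real \<Rightarrow> complex) \<Rightarrow> int \<Rightarrow> complex" where
  "test_coeff \<phi> m = (LINT x|circle. \<phi> x * chr (- m) x) / (2 * pi)"

lemma test_coeff_nth_deriv:
  "\<phi> \<in> test_functions \<Longrightarrow> test_coeff (nth_deriv k \<phi>) m = (\<i> * of_int m) ^ k * test_coeff \<phi> m"
  by (simp only: test_coeff_def integral_deriv_chr) simp

text \<open>Two derivatives give decay like 1/m^2, which is summable.\<close>

lemma test_coeff_summable:
  assumes "\<phi> \<in> test_functions" shows "(\<lambda>m. norm (test_coeff \<phi> m)) summable_on UNIV"
proof -
  have *: "norm (test_coeff \<psi> m) \<le> (LINT x|circle. norm (\<psi> x)) / (2 * pi)" if "\<psi> \<in> test_functions" for \<psi> m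
    unfolding test_coeff_def norm_divide
    using norm_integral_chr_le[of \<psi> "- m"] integrable_circle_continuous[OF test_continuous[OF that]]
    by (simp add: divide_right_mono)
  define B where "B = max ((LINT x|circle. norm (\<phi> x)) / (2 * pi))
     ((LINT x|circle. norm (nth_deriv 2 \<phi> x)) / (2 * pi))"
  show ?thesis
  proof (rule summable_on_decay)
    show "norm (test_coeff \<phi> 0) \<le> B" using *[OF assms, of 0] by (simp add: B_def)
    fix m :: int
    have "norm (test_coeff (nth_deriv 2 \<phi>) m) \<le> B"
      using *[OF nth_deriv_test[OF assms], of 2 m] by (simp add: B_def)
    then show "\<bar>real_of_int m\<bar> ^ 2 * norm (test_coeff \<phi> m) \<le> B"
      by (simp add: test_coeff_nth_deriv[OF assms] norm_mult norm_power)
  qed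
qed

text \<open>The difference of the two sides is continuous and periodic with null coefficients, hence
  zero by \<open>null_coeffs_imp_zero\<close>.\<close>

lemma test_fourier_series:
  assumes "\<phi> \<in> test_functions" shows "\<phi> = fourier_series (test_coeff \<phi>)"
proof
  fix \<theta>
  note s = test_coeff_summable[OF assms]
  define d where "d = (\<lambda>x. \<phi> x - fourier_series (test_coeff \<phi>) x)"
  have "d \<theta> = 0"
  proof (rule null_coeffs_imp_zero)
    show "d (x + 2 * pi) = d x" for x
      by (simp add: d_def test_periodic[OF assms] fourier_series_periodic[OF s])
    show "continuous_on UNIV d" unfolding d_def
      by (intro continuous_intros test_continuous assms continuous_fourier_series s)
    fix m
    have "(LINT x|circle. d x * chr m x) =
      (LINT x|circle. \<phi> x * chr m x) - (LINT x|circle. fourier_series (test_coeff \<phi>) x * chr m x)"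
      unfolding d_def left_diff_distrib
      by (intro Bochner_Integration.integral_diff integrable_circle_continuous continuous_intros
         test_continuous assms continuous_fourier_series s)
    then show "(LINT x|circle. d x * chr m x) = 0"
      by (simp add: integral_fourier_series_chr[OF s] test_coeff_def)
  qed
  then show "\<phi> \<theta> = fourier_series (test_coeff \<phi>) \<theta>" by (simp add: d_def)
qed

lemma distribution_add:
  "u \<in> distributions \<Longrightarrow> \<phi> \<in> test_functions \<Longrightarrow> \<psi> \<in> test_functions \<Longrightarrow> u (\<lambda>\<theta>. \<phi> \<theta> + \<psi> \<theta>) = u \<phi> + u \<psi>"
  by (simp add: distributions_def)

lemma distribution_scale:
  "u \<in> distributions \<Longrightarrow> \<phi> \<in> test_functions \<Longrightarrow> u (\<lambda>\<theta>. c * \<phi> \<theta>) = c * u \<phi>"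
  by (simp add: distributions_def)

lemma distribution_sum_chr:
  assumes "u \<in> distributions" "finite F"
  shows "u (\<lambda>\<theta>. \<Sum>m\<in>F. c m * chr m \<theta>) = (\<Sum>m\<in>F. c m * u (chr m))"
  using assms(2)
proof (induction F rule: finite_induct)
  case empty
  then show ?case using distribution_scale[OF assms(1) test_zero, of 0] by simp
next
  case (insert x F)
  then show ?case
    by (simp add: distribution_add[OF assms(1) test_scale[OF test_chr] test_sum_chr]
       distribution_scale[OF assms(1) test_chr])
qed

text \<open>Trigonometric partial sums converge uniformly to the test function together with each
  derivative, because a derivative is again a test function whose series is the differentiated one.
  Only the finitely many seminorms in the continuity bound of u matter, so u passes to the
  limit.\<close>

lemma distribution_expansion:
  assumes u: "u \<in> distributions" and \<phi>: "\<phi> \<in> test_functions"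
  shows "((\<lambda>m. test_coeff \<phi> m * u (chr m)) has_sum u \<phi>) UNIV"
  unfolding has_sum_def
proof (rule tendstoI)
  fix e :: real assume "e > 0"
  obtain N K where NK: "\<And>\<phi>. \<phi> \<in> test_functions \<Longrightarrow> norm (u \<phi>) \<le> K * (\<Sum>k\<le>N. SUP \<theta>. norm (nth_deriv k \<phi> \<theta>))"
    using u unfolding distributions_def by blast
  \<comment> \<open>The uniform error allowed in each of the N + 1 seminorms, so that the total is
    at most e/2; |K| + 1 is positive whatever the sign of K.\<close>
  define \<epsilon> where "\<epsilon> = e / (2 * (\<bar>K\<bar> + 1) * real (Suc N))"
  have "\<epsilon> > 0" using \<open>e > 0\<close> unfolding \<epsilon>_def by (intro divide_pos_pos mult_pos_pos) auto
  have "\<forall>\<^sub>F F in finite_subsets_at_top UNIV. \<forall>k\<in>{..N}. \<forall>x.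
     dist (\<Sum>m\<in>F. test_coeff (nth_deriv k \<phi>) m * chr m x) (nth_deriv k \<phi> x) < \<epsilon>"
    unfolding eventually_ball_finite_distrib[OF finite_atMost]
  proof
    fix k
    note t = nth_deriv_test[OF \<phi>, of k]
    from uniform_limitD[OF fourier_series_uniform_limit[OF test_coeff_summable[OF t]] \<open>\<epsilon> > 0\<close>]
    show "\<forall>\<^sub>F F in finite_subsets_at_top UNIV. \<forall>x.
     dist (\<Sum>m\<in>F. test_coeff (nth_deriv k \<phi>) m * chr m x) (nth_deriv k \<phi> x) < \<epsilon>"
      unfolding test_fourier_series[OF t, symmetric] by simp
  qed
  moreover have "\<forall>\<^sub>F F in finite_subsets_at_top UNIV. finite (F :: int set)"
    by (rule eventually_finite_subsets_at_top_weakI)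
  ultimately show "\<forall>\<^sub>F F in finite_subsets_at_top UNIV. dist (\<Sum>m\<in>F. test_coeff \<phi> m * u (chr m)) (u \<phi>) < e"
  proof eventually_elim
    case (elim F)
    define s where "s = (\<lambda>\<theta>. \<Sum>m\<in>F. test_coeff \<phi> m * chr m \<theta>)"
    have s: "s \<in> test_functions" unfolding s_def using elim(2) by (rule test_sum_chr)
    define \<psi> where "\<psi> = (\<lambda>\<theta>. s \<theta> + (-1) * \<phi> \<theta>)"
    have \<psi>: "\<psi> \<in> test_functions" unfolding \<psi>_def by (rule test_add_scale[OF s \<phi>])
    have "nth_deriv k s = (\<lambda>\<theta>. \<Sum>m\<in>F. test_coeff (nth_deriv k \<phi>) m * chr m \<theta>)" for k
      unfolding s_def nth_deriv_sum_chr[OF elim(2)] test_coeff_nth_deriv[OF \<phi>] by (simp add: mult_ac)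
    then have d: "nth_deriv k \<psi> \<theta> = (\<Sum>m\<in>F. test_coeff (nth_deriv k \<phi>) m * chr m \<theta>) - nth_deriv k \<phi> \<theta>" for k \<theta>
      unfolding \<psi>_def nth_deriv_add_scale[OF s \<phi>] by simp
    have "(SUP \<theta>. norm (nth_deriv k \<psi> \<theta>)) \<le> \<epsilon>" if "k \<le> N" for k
      using elim(1) that unfolding d by (intro cSUP_least) (auto simp: dist_norm intro: less_imp_le)
    then have "(\<Sum>k\<le>N. SUP \<theta>. norm (nth_deriv k \<psi> \<theta>)) \<le> (\<Sum>k\<le>N. \<epsilon>)"
      by (intro sum_mono) auto
    also have "\<dots> = real (Suc N) * \<epsilon>" by simp
    finally have le: "(\<Sum>k\<le>N. SUP \<theta>. norm (nth_deriv k \<psi> \<theta>)) \<le> real (Suc N) * \<epsilon>" .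
    have nn: "0 \<le> (\<Sum>k\<le>N. SUP \<theta>. norm (nth_deriv k \<psi> \<theta>))"
      by (intro sum_nonneg) (use norm_le_SUP_nth_deriv[OF \<psi>] norm_ge_zero order_trans in blast)
    have "u \<psi> = u s + (-1) * u \<phi>"
      unfolding \<psi>_def using distribution_add[OF u s test_scale[OF \<phi>]] distribution_scale[OF u \<phi>] by metis
    then have "u \<psi> = (\<Sum>m\<in>F. test_coeff \<phi> m * u (chr m)) - u \<phi>"
      unfolding s_def distribution_sum_chr[OF u elim(2)] by simp
    then have "dist (\<Sum>m\<in>F. test_coeff \<phi> m * u (chr m)) (u \<phi>) = norm (u \<psi>)" by (simp add: dist_norm)
    also have "\<dots> \<le> K * (\<Sum>k\<le>N. SUP \<theta>. norm (nth_deriv k \<psi> \<theta>))" by (rule NK[OF \<psi>])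
    also have "\<dots> \<le> (\<bar>K\<bar> + 1) * (real (Suc N) * \<epsilon>)"
      by (intro mult_mono le nn) auto
    also have "\<dots> = e / 2"
    proof -
      have "a * (b * (e / (2 * a * b))) = e / 2" if "a > 0" "b > 0" for a b :: real
        using that by (simp add: field_simps)
      from this[of "\<bar>K\<bar> + 1" "real (Suc N)"] show ?thesis unfolding \<epsilon>_def by simp
    qed
    also have "\<dots> < e" using \<open>e > 0\<close> by simp
    finally show ?case .
  qed
qed

lemma distribution_has_sum:
  assumes "u \<in> distributions" "\<phi> \<in> test_functions"
  shows "((\<lambda>m. fourier_coeff u m * dist_of (chr m) \<phi>) has_sum u \<phi>) UNIV"
proof -
  have "((\<lambda>m. test_coeff \<phi> (- m) * u (chr (- m))) has_sum u \<phi>) UNIV"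
    using distribution_expansion[OF assms]
    by (subst has_sum_reindex_bij_betw[of uminus UNIV UNIV]) (auto simp: bij_uminus)
  then show ?thesis
    by (simp add: test_coeff_def fourier_coeff_chr dist_of_def mult_ac)
qed

text \<open>On each test function both functionals are sums of the same series. Identities between
  distributions are thereby reduced to coefficients.\<close>

lemma dist_eqI:
  assumes "u \<in> distributions" "v \<in> distributions" "\<And>m. fourier_coeff u m = fourier_coeff v m"
  shows "dist_eq u v"
  unfolding dist_eq_def
  using distribution_has_sum[OF assms(1)] distribution_has_sum[OF assms(2)]
  by (auto simp: assms(3) intro: has_sum_unique)

subsection \<open>Distributions and their Fourier coefficients\<close>

lemma distributionI:
  assumes "\<And>\<phi> \<psi>. \<phi> \<in> test_functions \<Longrightarrow> \<psi> \<in> test_functions \<Longrightarrow> u (\<lambda>\<theta>. \<phi> \<theta> + \<psi> \<theta>) = u \<phi> + u \<psi>"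
    and "\<And>c \<phi>. \<phi> \<in> test_functions \<Longrightarrow> u (\<lambda>\<theta>. c * \<phi> \<theta>) = c * u \<phi>"
    and "\<And>\<phi>. \<phi> \<in> test_functions \<Longrightarrow> norm (u \<phi>) \<le> K * (\<Sum>k\<le>N. SUP \<theta>. norm (nth_deriv k \<phi> \<theta>))"
  shows "u \<in> distributions"
  unfolding distributions_def using assms by blast

lemma SUP_nth_deriv_nonneg:
  "\<phi> \<in> test_functions \<Longrightarrow> 0 \<le> (SUP \<theta>. norm (nth_deriv k \<phi> \<theta>))"
  using norm_le_SUP_nth_deriv[of \<phi> k 0] norm_ge_zero order_trans by blast

lemma dist_of_distribution:
  assumes g: "integrable circle g"
  shows "dist_of g \<in> distributions"
proof (rule distributionI[where N = 0 and K = "LINT x|circle. norm (g x)"])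
  fix \<phi> \<psi> assume t: "\<phi> \<in> test_functions" "\<psi> \<in> test_functions"
  show "dist_of g (\<lambda>\<theta>. \<phi> \<theta> + \<psi> \<theta>) = dist_of g \<phi> + dist_of g \<psi>"
    unfolding dist_of_def distrib_left
    by (intro Bochner_Integration.integral_add integrable_mult_test g t)
next
  fix c \<phi>
  show "dist_of g (\<lambda>\<theta>. c * \<phi> \<theta>) = c * dist_of g \<phi>"
    unfolding dist_of_def by (subst integral_mult_right_zero[symmetric]) (simp add: mult_ac)
next
  fix \<phi> assume t: "\<phi> \<in> test_functions"
  let ?S = "SUP \<theta>. norm (nth_deriv 0 \<phi> \<theta>)"
  have "norm (dist_of g \<phi>) \<le> (LINT x|circle. norm (g x * \<phi> x))"
    unfolding dist_of_def by (rule integral_norm_bound)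
  also have "\<dots> \<le> (LINT x|circle. norm (g x) * ?S)"
  proof (rule integral_mono)
    fix x
    show "norm (g x * \<phi> x) \<le> norm (g x) * ?S"
      unfolding norm_mult using norm_le_SUP_nth_deriv[OF t, of 0 x] by (intro mult_left_mono) auto
  qed (use g integrable_mult_test[OF g t] in auto)
  also have "\<dots> = (LINT x|circle. norm (g x)) * ?S" by simp
  finally show "norm (dist_of g \<phi>) \<le> (LINT x|circle. norm (g x)) * (\<Sum>k\<le>0. SUP \<theta>. norm (nth_deriv k \<phi> \<theta>))"
    by simp
qed

lemma distribution_add_scale:
  assumes u: "u \<in> distributions" and v: "v \<in> distributions"
  shows "(\<lambda>\<phi>. u \<phi> + a * v \<phi>) \<in> distributions"
proof -
  obtain N K where 1: "\<And>\<phi>. \<phi> \<in> test_functions \<Longrightarrow> norm (u \<phi>) \<le> K * (\<Sum>k\<le>N. SUP \<theta>. norm (nth_deriv k \<phi> \<theta>))"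
    using u unfolding distributions_def by blast
  obtain N' K' where 2: "\<And>\<phi>. \<phi> \<in> test_functions \<Longrightarrow> norm (v \<phi>) \<le> K' * (\<Sum>k\<le>N'. SUP \<theta>. norm (nth_deriv k \<phi> \<theta>))"
    using v unfolding distributions_def by blast
  show ?thesis
  proof (rule distributionI[where N = "max N N'" and K = "\<bar>K\<bar> + norm a * \<bar>K'\<bar>"])
    fix \<phi> assume t: "\<phi> \<in> test_functions"
    define S where "S = (\<lambda>n. \<Sum>k\<le>n. SUP \<theta>. norm (nth_deriv k \<phi> \<theta>))"
    have S: "S n \<le> S (max N N')" if "n \<le> max N N'" for n
      unfolding S_def using that by (intro sum_mono2) (auto simp: SUP_nth_deriv_nonneg[OF t])
    have S0: "0 \<le> S n" for n
      unfolding S_def by (intro sum_nonneg) (simp add: SUP_nth_deriv_nonneg[OF t])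
    have b: "c * S n \<le> \<bar>c\<bar> * S (max N N')" if "n \<le> max N N'" for c n
      using that by (intro mult_mono S S0) auto
    have "norm (u \<phi> + a * v \<phi>) \<le> norm (u \<phi>) + norm a * norm (v \<phi>)"
      by (metis norm_mult norm_triangle_ineq)
    also have "\<dots> \<le> \<bar>K\<bar> * S (max N N') + norm a * (\<bar>K'\<bar> * S (max N N'))"
    proof (intro add_mono mult_left_mono)
      have "norm (u \<phi>) \<le> K * S N" "norm (v \<phi>) \<le> K' * S N'"
        unfolding S_def by (rule 1[OF t], rule 2[OF t])
      then show "norm (u \<phi>) \<le> \<bar>K\<bar> * S (max N N')" "norm (v \<phi>) \<le> \<bar>K'\<bar> * S (max N N')"
        using b[of N K] b[of N' K'] by auto
    qed simp
    finally show "norm (u \<phi> + a * v \<phi>) \<le>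
       (\<bar>K\<bar> + norm a * \<bar>K'\<bar>) * (\<Sum>k\<le>max N N'. SUP \<theta>. norm (nth_deriv k \<phi> \<theta>))"
      by (simp add: S_def algebra_simps)
  qed (simp_all add: distribution_add[OF u] distribution_add[OF v] distribution_scale[OF u] distribution_scale[OF v] algebra_simps)
qed

lemma distribution_diff:
  "u \<in> distributions \<Longrightarrow> v \<in> distributions \<Longrightarrow> (\<lambda>\<phi>. u \<phi> - v \<phi>) \<in> distributions"
  using distribution_add_scale[of u v "-1"] by simp

lemma distribution_cmult:
  assumes "u \<in> distributions" shows "(\<lambda>\<phi>. a * u \<phi>) \<in> distributions"
  using distribution_add_scale[OF assms assms, of "a - 1"] by (simp add: algebra_simps)

text \<open>Membership depends only on the values at test functions. This serves the multiplier
  operators, whose infinite sums are identified with integrable functions only there.\<close>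

lemma distribution_dist_eq:
  assumes "dist_eq u v" "v \<in> distributions" shows "u \<in> distributions"
proof -
  have "u (\<lambda>\<theta>. \<phi> \<theta> + \<psi> \<theta>) = v (\<lambda>\<theta>. \<phi> \<theta> + \<psi> \<theta>)" if "\<phi> \<in> test_functions" "\<psi> \<in> test_functions" for \<phi> \<psi>
    using assms that test_add by (auto simp: dist_eq_def)
  moreover have "u (\<lambda>\<theta>. c * \<phi> \<theta>) = v (\<lambda>\<theta>. c * \<phi> \<theta>)" if "\<phi> \<in> test_functions" for \<phi> c
    using assms that test_scale by (auto simp: dist_eq_def)
  moreover have "u \<phi> = v \<phi>" if "\<phi> \<in> test_functions" for \<phi>
    using assms that by (auto simp: dist_eq_def)
  ultimately show ?thesis using assms(2) unfolding distributions_def by auto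
qed

lemma fourier_coeff_cong: "dist_eq u v \<Longrightarrow> fourier_coeff u m = fourier_coeff v m"
  by (simp add: dist_eq_def fourier_coeff_chr test_chr del: of_int_minus)

lemma fourier_coeff_add: "fourier_coeff (\<lambda>\<phi>. u \<phi> + v \<phi>) m = fourier_coeff u m + fourier_coeff v m"
  by (simp add: fourier_coeff_def add_divide_distrib)

lemma fourier_coeff_diff: "fourier_coeff (\<lambda>\<phi>. u \<phi> - v \<phi>) m = fourier_coeff u m - fourier_coeff v m"
  by (simp add: fourier_coeff_def diff_divide_distrib)

lemma fourier_coeff_cmult: "fourier_coeff (\<lambda>\<phi>. a * u \<phi>) m = a * fourier_coeff u m"
  by (simp add: fourier_coeff_def)

lemma fourier_coeff_dist_of: "fourier_coeff (dist_of g) m = (LINT x|circle. g x * chr (- m) x) / (2 * pi)"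
  by (simp add: fourier_coeff_chr dist_of_def)

text \<open>Against a character, orthogonality leaves a single term of the series, so the sum is
  finite for every symbol \<open>\<mu>\<close>.\<close>

lemma fourier_coeff_multiplier: "fourier_coeff (fourier_multiplier \<mu> u) n = \<mu> n * fourier_coeff u n"
proof -
  have "fourier_multiplier \<mu> u (chr (- n)) = \<mu> n * fourier_coeff u n * (2 * pi)"
    unfolding fourier_multiplier_def dist_of_def integral_chr_mult
    by (rule infsumI, rule has_sum_finite_neutralI[of "{n}"]) auto
  then show ?thesis by (simp add: fourier_coeff_chr)
qed

lemma fourier_coeff_quarter_laplacian:
  "fourier_coeff (quarter_laplacian u) m = of_real (\<bar>of_int m\<bar> powr (1/2)) * fourier_coeff u m"
  unfolding quarter_laplacian_def by (rule fourier_coeff_multiplier)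

lemma fourier_coeff_riesz_transform:
  "fourier_coeff (riesz_transform u) m = \<i> * of_int (sgn m) * fourier_coeff u m"
  unfolding riesz_transform_def by (rule fourier_coeff_multiplier)

lemma norm_fourier_coeff_le:
  "integrable circle g \<Longrightarrow> norm (fourier_coeff (dist_of g) m) \<le> L1_norm circle g / (2 * pi)"
  unfolding fourier_coeff_dist_of norm_divide L1_norm_def
  using norm_integral_chr_le[of g "- m"] by (simp add: divide_right_mono)

lemma fourier_coeff_const: "fourier_coeff (dist_of (\<lambda>_. c)) m = (if m = 0 then c else 0)"
proof -
  have "(LINT x|circle. c * chr (- m) x) = c * (if m = 0 then 2 * pi else 0)"
    unfolding integral_mult_right_zero integral_chr by simp
  then show ?thesis unfolding fourier_coeff_dist_of by (cases "m = 0") simp_all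
qed

lemma fourier_coeff_dist_of_add_scale:
  assumes "integrable circle f" "integrable circle g"
  shows "fourier_coeff (dist_of (\<lambda>x. f x + a * g x)) m = fourier_coeff (dist_of f) m + a * fourier_coeff (dist_of g) m"
  using integrable_mult_chr[OF assms(1), of "- m"] integrable_mult_chr[OF assms(2), of "- m"]
  unfolding fourier_coeff_dist_of
  by (simp add: distrib_right mult.assoc add_divide_distrib del: of_int_minus)

lemma fourier_coeff_dist_of_cnj:
  "fourier_coeff (dist_of (\<lambda>x. cnj (g x))) m = cnj (fourier_coeff (dist_of g) (- m))"
proof -
  have "(LINT x|circle. cnj (g x) * chr (- m) x) = (LINT x|circle. cnj (g x * chr m x))"
    by (intro Bochner_Integration.integral_cong refl) (simp add: cis_cnj)
  also have "\<dots> = cnj (LINT x|circle. g x * chr m x)" by (rule Bochner_Integration.integral_cnj)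
  finally show ?thesis by (simp add: fourier_coeff_dist_of)
qed

subsection \<open>Square integrable functions\<close>

lemma has_sum_diff:
  fixes f g :: "'a \<Rightarrow> 'b::real_normed_algebra_1"
  assumes "(f has_sum a) A" "(g has_sum b) A"
  shows "((\<lambda>x. f x - g x) has_sum (a - b)) A"
  using has_sum_add[OF assms(1) has_sum_cmult_right[OF assms(2), of "- 1"]] by simp

lemma L2_iff:
  "f \<in> L2 circle \<longleftrightarrow> f \<in> borel_measurable circle \<and> integrable circle (\<lambda>x. (norm (f x))\<^sup>2)"
  by (simp add: L2_def)

lemma L2_integrable:
  assumes "f \<in> L2 circle" shows "integrable circle f"
proof (rule Bochner_Integration.integrable_bound)
  show "integrable circle (\<lambda>x. 1 + (norm (f x))\<^sup>2)"
    using assms by (auto simp: L2_iff)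
  show "AE x in circle. norm (f x) \<le> norm (1 + (norm (f x))\<^sup>2)"
  proof (rule AE_I2)
    fix x
    have "0 \<le> (norm (f x) - 1)\<^sup>2" by simp
    then have "2 * norm (f x) \<le> 1 + (norm (f x))\<^sup>2" by (simp add: power2_diff)
    then show "norm (f x) \<le> norm (1 + (norm (f x))\<^sup>2)"
      using norm_ge_zero[of "f x"] by (simp del: norm_ge_zero)
  qed
qed (use assms in \<open>simp add: L2_iff\<close>)

lemma continuous_L2:
  fixes f :: "real \<Rightarrow> complex"
  assumes "continuous_on UNIV f" shows "f \<in> L2 circle"
  unfolding L2_iff
  by (intro conjI measurable_continuous_circle integrable_circle_continuous continuous_intros assms)

lemma L2_add:
  assumes "f \<in> L2 circle" "g \<in> L2 circle" shows "(\<lambda>x. f x + g x) \<in> L2 circle"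
  unfolding L2_iff
proof
  show "integrable circle (\<lambda>x. (norm (f x + g x))\<^sup>2)"
  proof (rule Bochner_Integration.integrable_bound)
    show "integrable circle (\<lambda>x. 2 * (norm (f x))\<^sup>2 + 2 * (norm (g x))\<^sup>2)"
      using assms by (auto simp: L2_iff)
    show "AE x in circle. norm ((norm (f x + g x))\<^sup>2) \<le> norm (2 * (norm (f x))\<^sup>2 + 2 * (norm (g x))\<^sup>2)"
    proof (rule AE_I2)
      fix x
      have "(norm (f x + g x))\<^sup>2 \<le> (norm (f x) + norm (g x))\<^sup>2"
        by (intro power_mono norm_triangle_ineq) auto
      also have "\<dots> \<le> 2 * (norm (f x))\<^sup>2 + 2 * (norm (g x))\<^sup>2"
        using zero_le_power2[of "norm (f x) - norm (g x)"] by (simp add: power2_sum power2_diff)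
      finally show "norm ((norm (f x + g x))\<^sup>2) \<le> norm (2 * (norm (f x))\<^sup>2 + 2 * (norm (g x))\<^sup>2)"
        by simp
    qed
  qed (use assms in \<open>auto simp: L2_iff\<close>)
qed (use assms in \<open>auto simp: L2_iff\<close>)

text \<open>Cauchy-Schwarz against the constant 1, obtained from the nonnegative variance of |f|
  about its mean K.\<close>

lemma L1_le_L2:
  assumes "f \<in> L2 circle"
  shows "(LINT x|circle. norm (f x))\<^sup>2 \<le> 2 * pi * (LINT x|circle. (norm (f x))\<^sup>2)"
proof -
  note i = L2_integrable[OF assms]
  have i2: "integrable circle (\<lambda>x. (norm (f x))\<^sup>2)" using assms by (simp add: L2_iff)
  define K where "K = (LINT x|circle. norm (f x)) / (2 * pi)"
  have K: "(LINT x|circle. norm (f x)) = 2 * pi * K" by (simp add: K_def)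
  have m: "measure circle (space circle) = 2 * pi" using emeasure_circle by (simp add: measure_def)
  have "0 \<le> (LINT x|circle. (norm (f x) - K)\<^sup>2)" by simp
  also have "\<dots> = (LINT x|circle. (norm (f x))\<^sup>2 - (2 * K) * norm (f x) + K\<^sup>2)"
    by (intro Bochner_Integration.integral_cong refl) (simp add: power2_diff)
  also have "\<dots> = (LINT x|circle. (norm (f x))\<^sup>2) - 2 * K * (2 * pi * K) + K\<^sup>2 * (2 * pi)"
    using i i2 m by (simp add: K del: space_circle)
  also have "\<dots> = (LINT x|circle. (norm (f x))\<^sup>2) - 2 * pi * K\<^sup>2" by (simp add: power2_eq_square)
  finally have "2 * pi * (2 * pi * K\<^sup>2) \<le> 2 * pi * (LINT x|circle. (norm (f x))\<^sup>2)"
    by (intro mult_left_mono) auto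
  then show ?thesis unfolding K by (simp add: power2_eq_square mult_ac)
qed

text \<open>Expand the squared distance of g to its trigonometric partial sum s. The inner products
  of s with g and with itself both equal 2 pi Q, so what remains is the squared norm of g minus 2 pi
  Q.\<close>

lemma bessel:
  assumes g: "g \<in> L2 circle" and F: "finite F"
  shows "2 * pi * (\<Sum>m\<in>F. (norm (fourier_coeff (dist_of g) m))\<^sup>2) \<le> (LINT x|circle. (norm (g x))\<^sup>2)"
proof -
  let ?c = "fourier_coeff (dist_of g)"
  note i = L2_integrable[OF g]
  define s where "s = (\<lambda>x. \<Sum>m\<in>F. ?c m * chr m x)"
  define Q where "Q = (\<Sum>m\<in>F. (norm (?c m))\<^sup>2)"
  have sc: "continuous_on UNIV s" unfolding s_def by (intro continuous_intros)
  have cs: "cnj (s x) = (\<Sum>m\<in>F. cnj (?c m) * chr (- m) x)" for x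
    by (simp add: s_def cis_cnj)
  \<comment> \<open>Stated for an arbitrary integrable f because it is needed with f = g and with f
    = s.\<close>
  have gs: "(LINT x|circle. f x * cnj (s x)) = 2 * pi * (\<Sum>m\<in>F. cnj (?c m) * fourier_coeff (dist_of f) m)"
    if "integrable circle f" for f
  proof -
    have "(LINT x|circle. f x * cnj (s x)) = (LINT x|circle. (\<Sum>m\<in>F. cnj (?c m) * (f x * chr (- m) x)))"
      unfolding cs sum_distrib_left by (simp add: mult_ac)
    also have "\<dots> = (\<Sum>m\<in>F. cnj (?c m) * (LINT x|circle. f x * chr (- m) x))"
      using integrable_mult_chr[OF that]
      by (subst Bochner_Integration.integral_sum) (auto simp del: of_int_minus)
    also have "\<dots> = (\<Sum>m\<in>F. cnj (?c m) * (2 * pi * fourier_coeff (dist_of f) m))"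
      by (intro sum.cong refl) (simp add: fourier_coeff_dist_of[of f] del: of_int_minus)
    finally show ?thesis by (simp add: sum_distrib_left mult_ac)
  qed
  have sS: "s = fourier_series (\<lambda>m. if m \<in> F then ?c m else 0)"
  proof
    fix x
    show "s x = fourier_series (\<lambda>m. if m \<in> F then ?c m else 0) x"
      unfolding fourier_series_def s_def
      by (rule infsumI[symmetric], rule has_sum_finite_neutralI[OF F]) auto
  qed
  have "(\<lambda>m. norm (if m \<in> F then ?c m else 0)) summable_on UNIV"
    by (rule has_sum_imp_summable, rule has_sum_finite_neutralI[OF F]) auto
  then have cS: "fourier_coeff (dist_of s) m = (if m \<in> F then ?c m else 0)" for m
    unfolding sS by (rule fourier_coeff_fourier_series)
  have Q: "(\<Sum>m\<in>F. cnj (?c m) * ?c m) = of_real Q"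
    unfolding Q_def of_real_sum by (intro sum.cong refl) (simp only: complex_norm_square mult.commute)
  have 1: "(LINT x|circle. g x * cnj (s x)) = of_real (2 * pi * Q)" using gs[OF i] Q by simp
  have si: "integrable circle s" by (rule integrable_circle_continuous[OF sc])
  have "(\<Sum>m\<in>F. cnj (?c m) * fourier_coeff (dist_of s) m) = (\<Sum>m\<in>F. cnj (?c m) * ?c m)"
    by (intro sum.cong refl) (simp add: cS)
  then have 2: "(LINT x|circle. s x * cnj (s x)) = of_real (2 * pi * Q)" using gs[OF si] Q by simp
  have "integrable circle (\<lambda>x. g x * cnj (s x))" "integrable circle (\<lambda>x. s x * cnj (s x))"
    unfolding cs sum_distrib_left mult.left_commute[of _ "cnj _"]
    using integrable_mult_chr[OF i] integrable_mult_chr[OF si] by (auto simp del: of_int_minus)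
  then have ii: "integrable circle (\<lambda>x. Re (g x * cnj (s x)))" "integrable circle (\<lambda>x. Re (s x * cnj (s x)))"
    and "(LINT x|circle. Re (g x * cnj (s x))) = 2 * pi * Q"
        "(LINT x|circle. Re (s x * cnj (s x))) = 2 * pi * Q"
    using 1 2 by (simp_all only: integrable_Re integral_Re Re_complex_of_real)
  note ii = ii this
  have ig: "integrable circle (\<lambda>x. (norm (g x))\<^sup>2)" using g by (simp add: L2_iff)
  have "0 \<le> (LINT x|circle. (norm (g x - s x))\<^sup>2)" by simp
  also have "\<dots> = (LINT x|circle. (norm (g x))\<^sup>2 - 2 * Re (g x * cnj (s x)) + Re (s x * cnj (s x)))"
    by (intro Bochner_Integration.integral_cong refl) (simp add: cmod_power2, simp add: power2_eq_square algebra_simps)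
  also have "\<dots> = (LINT x|circle. (norm (g x))\<^sup>2) - 2 * (2 * pi * Q) + 2 * pi * Q"
    using ii ig by (simp del: times_complex.sel)
  finally show ?thesis by (simp add: Q_def)
qed

lemma bessel_summable:
  assumes "g \<in> L2 circle"
  shows "(\<lambda>m. (norm (fourier_coeff (dist_of g) m))\<^sup>2) summable_on UNIV"
proof (rule nonneg_bounded_partial_sums_imp_summable_on)
  show "\<forall>\<^sub>F F in finite_subsets_at_top UNIV.
     (\<Sum>m\<in>F. (norm (fourier_coeff (dist_of g) m))\<^sup>2) \<le> (LINT x|circle. (norm (g x))\<^sup>2) / (2 * pi)"
    by (rule eventually_finite_subsets_at_top_weakI) (use bessel[OF assms] in \<open>simp add: field_simps\<close>)
qed simp

text \<open>Integrate the series termwise against the conjugate of its own sum.\<close>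

lemma parseval_fourier_series:
  assumes "(\<lambda>m. norm (c m)) summable_on UNIV"
  shows "((\<lambda>m. (norm (c m))\<^sup>2) has_sum (LINT x|circle. (norm (fourier_series c x))\<^sup>2) / (2 * pi)) UNIV"
proof -
  let ?S = "fourier_series c"
  have "integrable circle (\<lambda>x. cnj (?S x))" using integrable_fourier_series[OF assms] by simp
  from has_sum_integral_fourier_series[OF assms this]
  have "((\<lambda>m. c m * (LINT x|circle. chr m x * cnj (?S x))) has_sum (LINT x|circle. ?S x * cnj (?S x))) UNIV" .
  moreover have "(LINT x|circle. chr m x * cnj (?S x)) = 2 * pi * cnj (c m)" for m
  proof -
    have "(LINT x|circle. chr m x * cnj (?S x)) = (LINT x|circle. cnj (?S x * chr (- m) x))"
      by (intro Bochner_Integration.integral_cong refl) (simp add: cis_cnj mult.commute)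
    also have "\<dots> = cnj (LINT x|circle. ?S x * chr (- m) x)" by (rule Bochner_Integration.integral_cnj)
    finally show ?thesis by (simp only: integral_fourier_series_chr[OF assms]) simp
  qed
  moreover have "c m * (2 * pi * cnj (c m)) = of_real (2 * pi * (norm (c m))\<^sup>2)" for m
    unfolding of_real_mult complex_norm_square by simp
  moreover have "(LINT x|circle. ?S x * cnj (?S x)) = of_real (LINT x|circle. (norm (?S x))\<^sup>2)"
    unfolding integral_complex_of_real[symmetric] complex_norm_square ..
  ultimately have "((\<lambda>m. 2 * pi * (norm (c m))\<^sup>2) has_sum (LINT x|circle. (norm (?S x))\<^sup>2)) UNIV"
    by (simp only: has_sum_of_real_iff)
  from has_sum_cmult_right[OF this, of "1 / (2 * pi)"] show ?thesis by simp
qed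

lemma fourier_series_diff:
  assumes "(\<lambda>m. norm (c m)) summable_on UNIV" "(\<lambda>m. norm (d m)) summable_on UNIV"
  shows "fourier_series (\<lambda>m. c m - d m) x = fourier_series c x - fourier_series d x"
proof -
  have "((\<lambda>m. c m * chr m x - d m * chr m x) has_sum fourier_series c x - fourier_series d x) UNIV"
    by (intro has_sum_diff fourier_series_has_sum assms)
  then show ?thesis unfolding fourier_series_def left_diff_distrib by (rule infsumI)
qed

text \<open>Symmetric partial sums are Cauchy in the mean square by Parseval, hence Cauchy in L^1; a
  subsequence converges almost everywhere, and Fatou's lemma transfers the quadratic bounds to the
  limit.\<close>

lemma riesz_fischer:
  assumes c: "(\<lambda>m::int. (norm (c m))\<^sup>2) summable_on UNIV"
  obtains w where "w \<in> L2 circle" "\<And>m. fourier_coeff (dist_of w) m = c m"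
    "(LINT x|circle. (norm (w x))\<^sup>2) \<le> 2 * pi * (\<Sum>\<^sub>\<infinity>m\<in>UNIV. (norm (c m))\<^sup>2)"
proof -
  define p where "p = (\<lambda>(n::nat) m. if \<bar>m\<bar> \<le> int n then c m else 0)"
  define q where "q = (\<lambda>(n::nat) m. if \<bar>m\<bar> \<le> int n then 0 else c m)"
  define s where "s = (\<lambda>n. fourier_series (p n))"
  define T where "T = (\<lambda>n. \<Sum>\<^sub>\<infinity>m\<in>UNIV. (norm (q n m))\<^sup>2)"
  have fin: "(\<lambda>m. norm (p n m)) summable_on UNIV" for n
    by (rule has_sum_imp_summable, rule has_sum_finite_neutralI[of "{-int n..int n}"])
       (auto simp: p_def)
  have q: "(\<lambda>m. (norm (q n m))\<^sup>2) summable_on UNIV" for n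
    by (rule summable_on_comparison_test[OF c]) (auto simp: q_def)
  have sc: "continuous_on UNIV (s n)" for n
    unfolding s_def by (rule continuous_fourier_series[OF fin])
  have sL2: "(\<lambda>x. s i x - s j x) \<in> L2 circle" for i j
    by (intro continuous_L2 continuous_intros sc)
  \<comment> \<open>T N is the part of the sum of |c m|^2 outside [-N, N]. A finite set with small
    remainder is enlarged to such a window.\<close>
  have tail: "\<exists>N. T N < e" if "e > 0" for e
  proof -
    have "((\<lambda>m. (norm (c m))\<^sup>2) has_sum infsum (\<lambda>m. (norm (c m))\<^sup>2) UNIV) UNIV"
      by (rule has_sum_infsum[OF c])
    then have "\<forall>\<^sub>F F in finite_subsets_at_top UNIV. dist (\<Sum>m\<in>F. (norm (c m))\<^sup>2) (infsum (\<lambda>m. (norm (c m))\<^sup>2) UNIV) < e"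
      unfolding has_sum_def using that by (rule tendstoD)
    then obtain F0 where F0: "finite F0" "\<And>F. finite F \<Longrightarrow> F0 \<subseteq> F \<Longrightarrow>
        dist (\<Sum>m\<in>F. (norm (c m))\<^sup>2) (infsum (\<lambda>m. (norm (c m))\<^sup>2) UNIV) < e"
      unfolding eventually_finite_subsets_at_top by auto
    define N where "N = nat (Max (insert 0 (abs ` F0)))"
    have "\<bar>m\<bar> \<le> int N" if "m \<in> F0" for m
    proof -
      have "\<bar>m\<bar> \<le> Max (insert 0 (abs ` F0))" using F0(1) that by (intro Max_ge) auto
      moreover have "0 \<le> Max (insert 0 (abs ` F0))" using F0(1) by (intro Max_ge) auto
      ultimately show ?thesis by (simp add: N_def)
    qed
    then have "F0 \<subseteq> {-int N..int N}" by force
    then have "dist (\<Sum>m\<in>{-int N..int N}. (norm (c m))\<^sup>2) (infsum (\<lambda>m. (norm (c m))\<^sup>2) UNIV) < e"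
      by (intro F0(2)) auto
    moreover have "T N = infsum (\<lambda>m. (norm (c m))\<^sup>2) UNIV - (\<Sum>m\<in>{-int N..int N}. (norm (c m))\<^sup>2)"
    proof -
      have "((\<lambda>m. (norm (c m))\<^sup>2 - (norm (p N m))\<^sup>2) has_sum
          (infsum (\<lambda>m. (norm (c m))\<^sup>2) UNIV - (\<Sum>m\<in>{-int N..int N}. (norm (c m))\<^sup>2))) UNIV"
        by (intro has_sum_diff has_sum_infsum[OF c], rule has_sum_finite_neutralI[of "{-int N..int N}"])
           (auto simp: p_def intro!: sum.cong)
      then show ?thesis unfolding T_def
        by (intro infsumI) (erule has_sum_cong[THEN iffD1, rotated], simp add: p_def q_def)
    qed
    ultimately show ?thesis by (intro exI[of _ N]) (auto simp: dist_real_def)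
  qed
  have bound: "(LINT x|circle. (norm (s i x - s j x))\<^sup>2) \<le> 2 * pi * T N" if "N \<le> i" "N \<le> j" for i j N
  proof -
    have sm: "(\<lambda>m. norm (p i m - p j m)) summable_on UNIV"
      by (rule has_sum_imp_summable, rule has_sum_finite_neutralI[of "{-int (max i j)..int (max i j)}"])
         (auto simp: p_def)
    have "(LINT x|circle. (norm (s i x - s j x))\<^sup>2) / (2 * pi) \<le> T N"
      unfolding s_def fourier_series_diff[OF fin fin, symmetric] T_def
      by (rule has_sum_mono[OF parseval_fourier_series[OF sm] has_sum_infsum[OF q]])
         (use that in \<open>auto simp: p_def q_def\<close>)
    then show ?thesis by (simp add: field_simps)
  qed
  have bound0: "(LINT x|circle. (norm (s i x))\<^sup>2) \<le> 2 * pi * (\<Sum>\<^sub>\<infinity>m\<in>UNIV. (norm (c m))\<^sup>2)" for i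
  proof -
    have "(LINT x|circle. (norm (s i x))\<^sup>2) / (2 * pi) \<le> (\<Sum>\<^sub>\<infinity>m\<in>UNIV. (norm (c m))\<^sup>2)"
      unfolding s_def
      by (rule has_sum_mono[OF parseval_fourier_series[OF fin] has_sum_infsum[OF c]]) (simp add: p_def)
    then show ?thesis by (simp add: field_simps)
  qed
  have "\<exists>N. \<forall>i\<ge>N. \<forall>j\<ge>N. (LINT x|circle. norm (s i x - s j x)) < e" if "e > 0" for e
  proof -
    \<comment> \<open>Chosen so that 2 pi * (2 pi * T N), the bound from \<open>L1_le_L2\<close> and
      Parseval, stays below e^2.\<close>
    obtain N where N: "T N < (e / (2 * pi))\<^sup>2" using tail[of "(e / (2 * pi))\<^sup>2"] \<open>e > 0\<close> by auto
    have "(LINT x|circle. norm (s i x - s j x)) < e" if "i \<ge> N" "j \<ge> N" for i j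
    proof -
      have "(LINT x|circle. norm (s i x - s j x))\<^sup>2 \<le> 2 * pi * (LINT x|circle. (norm (s i x - s j x))\<^sup>2)"
        by (rule L1_le_L2[OF sL2])
      also have "\<dots> \<le> 2 * pi * (2 * pi * T N)"
        by (intro mult_left_mono bound that) auto
      also have "\<dots> < 2 * pi * (2 * pi * (e / (2 * pi))\<^sup>2)"
        by (intro mult_strict_left_mono N) auto
      also have "\<dots> = e\<^sup>2" by (simp add: power2_eq_square)
      finally show ?thesis using \<open>e > 0\<close> by (intro power2_less_imp_less[of _ e]) auto
    qed
    then show ?thesis by blast
  qed
  then obtain r where r: "strict_mono r" "AE x in circle. Cauchy (\<lambda>i. s (r i) x)"
    using cauchy_L1_AE_cauchy_subseq[of circle s] integrable_circle_continuous[OF sc] by blast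
  define w where "w = (\<lambda>x. lim (\<lambda>i. s (r i) x))"
  have sm: "s n \<in> borel_measurable circle" for n by (rule measurable_continuous_circle[OF sc])
  have wm: "w \<in> borel_measurable circle" unfolding w_def by (rule borel_measurable_lim_metric[OF sm])
  have w: "AE x in circle. (\<lambda>i. s (r i) x) \<longlonglongrightarrow> w x"
    using r(2) by eventually_elim (simp add: w_def Cauchy_convergent_iff convergent_LIMSEQ_iff)
  \<comment> \<open>Used twice: v = 0 gives the norm bound for w, and v = \<open>s n\<close> shows
    that w is close to the partial sums.\<close>
  have fatou: "integrable circle (\<lambda>x. (norm (w x - v x))\<^sup>2) \<and> (LINT x|circle. (norm (w x - v x))\<^sup>2) \<le> B"
    if v: "v \<in> L2 circle" and "0 \<le> B" and B: "\<And>k. k \<ge> N \<Longrightarrow> (LINT x|circle. (norm (s k x - v x))\<^sup>2) \<le> B"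
    for v B N
  proof -
    have vm: "v \<in> borel_measurable circle" using v by (simp add: L2_iff)
    have "(\<integral>\<^sup>+x. ennreal ((norm (w x - v x))\<^sup>2) \<partial>circle) =
        (\<integral>\<^sup>+x. liminf (\<lambda>k. ennreal ((norm (s (r k) x - v x))\<^sup>2)) \<partial>circle)"
    proof (rule nn_integral_cong_AE)
      show "AE x in circle. ennreal ((norm (w x - v x))\<^sup>2) = liminf (\<lambda>k. ennreal ((norm (s (r k) x - v x))\<^sup>2))"
        using w by eventually_elim
          (intro lim_imp_Liminf[symmetric] tendsto_ennrealI tendsto_intros sequentially_bot, assumption)
    qed
    also have "\<dots> \<le> liminf (\<lambda>k. \<integral>\<^sup>+x. ennreal ((norm (s (r k) x - v x))\<^sup>2) \<partial>circle)"
      by (rule nn_integral_liminf) (use sm vm in measurable)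
    also have "\<dots> \<le> ennreal B"
    proof (rule Liminf_le)
      have "(\<integral>\<^sup>+x. ennreal ((norm (s (r k) x - v x))\<^sup>2) \<partial>circle) \<le> ennreal B" if "k \<ge> N" for k
      proof -
        have "(\<lambda>x. s (r k) x + (- v x)) \<in> L2 circle"
          using v by (intro L2_add continuous_L2[OF sc]) (simp add: L2_iff)
        then have "integrable circle (\<lambda>x. (norm (s (r k) x - v x))\<^sup>2)" by (simp add: L2_iff)
        then show ?thesis
          using B[of "r k"] that strict_mono_imp_increasing[OF r(1), of k] \<open>0 \<le> B\<close>
          by (simp add: nn_integral_eq_integral ennreal_leI)
      qed
      then show "\<forall>\<^sub>F k in sequentially. (\<integral>\<^sup>+x. ennreal ((norm (s (r k) x - v x))\<^sup>2) \<partial>circle) \<le> ennreal B"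
        unfolding eventually_sequentially by blast
    qed simp
    finally have *: "(\<integral>\<^sup>+x. ennreal ((norm (w x - v x))\<^sup>2) \<partial>circle) \<le> ennreal B" .
    have int: "integrable circle (\<lambda>x. (norm (w x - v x))\<^sup>2)"
      by (rule integrableI_bounded) (use wm vm * in \<open>auto simp: top.extremum_strict intro: le_less_trans\<close>)
    then have "ennreal (LINT x|circle. (norm (w x - v x))\<^sup>2) \<le> ennreal B"
      using * by (simp add: nn_integral_eq_integral)
    then show ?thesis using int \<open>0 \<le> B\<close> by (simp add: ennreal_le_iff)
  qed
  have T0: "0 \<le> T n" for n unfolding T_def by (intro infsum_nonneg) auto
  have c0: "0 \<le> (\<Sum>\<^sub>\<infinity>m\<in>UNIV. (norm (c m))\<^sup>2)" by (intro infsum_nonneg) auto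
  have zero: "(\<lambda>_. 0) \<in> L2 circle" by (intro continuous_L2 continuous_intros)
  have wL2: "w \<in> L2 circle"
    and wn: "(LINT x|circle. (norm (w x))\<^sup>2) \<le> 2 * pi * (\<Sum>\<^sub>\<infinity>m\<in>UNIV. (norm (c m))\<^sup>2)"
    using fatou[OF zero, of "2 * pi * (\<Sum>\<^sub>\<infinity>m\<in>UNIV. (norm (c m))\<^sup>2)" 0] bound0 c0 wm
    by (auto simp: L2_iff)
  have "fourier_coeff (dist_of w) m = c m" for m
  proof (rule ccontr)
    assume "fourier_coeff (dist_of w) m \<noteq> c m"
    then have "(norm (fourier_coeff (dist_of w) m - c m))\<^sup>2 > 0" by simp
    then obtain N where N: "T N < (norm (fourier_coeff (dist_of w) m - c m))\<^sup>2" using tail by blast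
    \<comment> \<open>From this index on the partial sum contains the frequency m, so its m-th
      coefficient is exactly c m, and only the distance of w to \<open>s n\<close> enters.\<close>
    define n where "n = max N (nat \<bar>m\<bar>)"
    have sn: "s n \<in> L2 circle" by (rule continuous_L2[OF sc])
    have f: "integrable circle (\<lambda>x. (norm (w x - s n x))\<^sup>2)"
        "(LINT x|circle. (norm (w x - s n x))\<^sup>2) \<le> 2 * pi * T N"
      using fatou[OF sn, of "2 * pi * T N" N] bound T0 by (auto simp: n_def)
    have L: "(\<lambda>x. w x - s n x) \<in> L2 circle" using f(1) wm sm by (simp add: L2_iff)
    have "fourier_coeff (dist_of (\<lambda>x. w x + (-1) * s n x)) m = fourier_coeff (dist_of w) m + (-1) * fourier_coeff (dist_of (s n)) m"
      by (intro fourier_coeff_dist_of_add_scale L2_integrable wL2 sn)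
    moreover have "fourier_coeff (dist_of (s n)) m = c m"
      unfolding s_def fourier_coeff_fourier_series[OF fin] by (simp add: p_def n_def)
    ultimately have "norm (fourier_coeff (dist_of w) m - c m) \<le> L1_norm circle (\<lambda>x. w x - s n x) / (2 * pi)"
      using norm_fourier_coeff_le[OF L2_integrable[OF L], of m] by simp
    then have "(norm (fourier_coeff (dist_of w) m - c m))\<^sup>2 \<le> (L1_norm circle (\<lambda>x. w x - s n x) / (2 * pi))\<^sup>2"
      by (intro power_mono) auto
    also have "\<dots> \<le> 2 * pi * (LINT x|circle. (norm (w x - s n x))\<^sup>2) / (2 * pi)\<^sup>2"
      unfolding power_divide L1_norm_def by (intro divide_right_mono L1_le_L2[OF L]) auto
    also have "\<dots> \<le> 2 * pi * (2 * pi * T N) / (2 * pi)\<^sup>2"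
      by (intro divide_right_mono mult_left_mono f) auto
    also have "\<dots> = T N" by (simp add: power2_eq_square)
    finally show False using N by simp
  qed
  then show ?thesis using that wL2 wn by blast
qed

subsection \<open>Poisson means\<close>

definition poisson_coeff :: "real \<Rightarrow> int \<Rightarrow> complex" where
  "poisson_coeff r m = of_real (r ^ nat \<bar>m\<bar>)"

lemma summable_on_power_int:
  fixes r :: real
  assumes "0 \<le> r" "r < 1" shows "(\<lambda>m::int. r ^ nat \<bar>m\<bar>) summable_on UNIV"
  using assms by (intro summable_on_int_abs[of "\<lambda>n. r ^ n"] summable_geometric) auto

lemma poisson_coeff_mult_summable:
  assumes "0 \<le> r" "r < 1" and B: "\<And>m. norm (c m) \<le> B"
  shows "(\<lambda>m. norm (poisson_coeff r m * c m)) summable_on UNIV"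
proof (rule summable_on_comparison_test)
  show "(\<lambda>m::int. r ^ nat \<bar>m\<bar> * B) summable_on UNIV"
    by (intro summable_on_cmult_left summable_on_power_int assms)
  show "norm (poisson_coeff r m * c m) \<le> r ^ nat \<bar>m\<bar> * B" for m
    unfolding norm_mult poisson_coeff_def using assms by (intro mult_mono B) (auto simp: norm_power)
qed auto

lemma has_sum_power:
  fixes z :: complex
  assumes "norm z < 1" shows "((\<lambda>n. z ^ n) has_sum 1 / (1 - z)) UNIV"
  by (rule norm_summable_imp_has_sum)
     (use assms in \<open>auto simp: norm_power intro: summable_geometric geometric_sums\<close>)

text \<open>The terms with m \<ge> 0 form a geometric series in z, those with m < 0 one in the
  conjugate of z. The closed form exhibits the positivity on which the L^1 bound rests.\<close>

lemma poisson_kernel: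
  assumes r: "0 \<le> r" "r < 1"
  shows "fourier_series (poisson_coeff r) s = of_real ((1 - r\<^sup>2) / (norm (1 - of_real r * cis s))\<^sup>2)"
proof -
  define z where "z = of_real r * cis s"
  have nz: "norm z = r" using r by (simp add: z_def norm_mult)
  have n1: "norm z < 1" "norm (cnj z) < 1" using r nz by auto
  let ?f = "\<lambda>m. poisson_coeff r m * chr m s"
  have "?f (int n) = z ^ n" for n
    by (simp add: poisson_coeff_def z_def power_mult_distrib Complex.DeMoivre)
  then have "(?f \<circ> int) = (\<lambda>n. z ^ n)" by (simp add: fun_eq_iff)
  then have 1: "(?f has_sum (1 / (1 - z))) (range int)"
    using has_sum_power[OF n1(1)] by (simp add: has_sum_reindex)
  \<comment> \<open>Negative indices start at -1, hence the shift by \<open>Suc\<close> and the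
    extra factor \<open>cnj z\<close>.\<close>
  have "?f (- int (Suc n)) = cnj z * cnj z ^ n" for n
  proof -
    have "?f (- int (Suc n)) = cnj z ^ Suc n"
      unfolding poisson_coeff_def z_def complex_cnj_mult power_mult_distrib cis_cnj Complex.DeMoivre
      by (simp add: algebra_simps nat_add_distrib)
    then show ?thesis by simp
  qed
  then have "(?f \<circ> (\<lambda>n. - int (Suc n))) = (\<lambda>n. cnj z * cnj z ^ n)" by (simp add: fun_eq_iff)
  then have 2: "(?f has_sum (cnj z * (1 / (1 - cnj z)))) (range (\<lambda>n. - int (Suc n)))"
    using has_sum_cmult_right[OF has_sum_power[OF n1(2)], of "cnj z"]
    by (subst has_sum_reindex) (auto simp: inj_on_def)
  have "x \<in> range int \<union> range (\<lambda>n. - int (Suc n))" for x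
    by (cases x rule: int_cases) blast+
  then have "range int \<union> range (\<lambda>n. - int (Suc n)) = UNIV" by blast
  moreover have "range int \<inter> range (\<lambda>n. - int (Suc n)) = {}" by auto
  ultimately have "(?f has_sum (1 / (1 - z) + cnj z * (1 / (1 - cnj z)))) UNIV"
    using has_sum_Un_disjoint[OF 1 2] by simp
  then have "fourier_series (poisson_coeff r) s = 1 / (1 - z) + cnj z * (1 / (1 - cnj z))"
    unfolding fourier_series_def by (rule infsumI)
  also have "\<dots> = (1 - z * cnj z) / ((1 - z) * cnj (1 - z))"
  proof -
    have "1 - z \<noteq> 0" "1 - cnj z \<noteq> 0" using n1 by auto
    then show ?thesis by (simp add: field_simps)
  qed
  also have "\<dots> = of_real ((1 - r\<^sup>2) / (norm (1 - z))\<^sup>2)"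
    unfolding complex_norm_square[symmetric] nz by simp
  finally show ?thesis unfolding z_def .
qed

text \<open>Given by coefficients, since the same multiplier \<open>poisson_coeff r\<close> also
  acts on the Sobolev part and on power series; the convolution formula is derived
  afterwards.\<close>

definition poisson_mean :: "real \<Rightarrow> (real \<Rightarrow> complex) \<Rightarrow> real \<Rightarrow> complex" where
  "poisson_mean r g = fourier_series (\<lambda>m. poisson_coeff r m * fourier_coeff (dist_of g) m)"

context
  fixes r :: real
  assumes r: "0 \<le> r" "r < 1"
begin

lemma poisson_mean_summable:
  "integrable circle g \<Longrightarrow> (\<lambda>m. norm (poisson_coeff r m * fourier_coeff (dist_of g) m)) summable_on UNIV"
  by (rule poisson_coeff_mult_summable[OF r norm_fourier_coeff_le])

lemma poisson_mean_integral:
  assumes g: "integrable circle g"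
  shows "2 * pi * poisson_mean r g \<theta> = (LINT t|circle. fourier_series (poisson_coeff r) (t - \<theta>) * g t)"
    and "integrable circle (\<lambda>t. fourier_series (poisson_coeff r) (t - \<theta>) * g t)"
proof -
  \<comment> \<open>These are the coefficients of the kernel translated to \<theta>. The reflection
    of m below uses that \<open>poisson_coeff r\<close> is even.\<close>
  define c where "c = (\<lambda>m. poisson_coeff r m * chr (- m) \<theta>)"
  have c: "(\<lambda>m. norm (c m)) summable_on UNIV"
    unfolding c_def by (rule poisson_coeff_mult_summable[OF r, of _ 1]) simp
  have fc: "fourier_series c t = fourier_series (poisson_coeff r) (t - \<theta>)" for t
    unfolding fourier_series_def c_def mult.assoc cis_mult by (simp add: algebra_simps)
  have "((\<lambda>m. c m * (LINT t|circle. chr m t * g t)) has_sum (LINT t|circle. fourier_series c t * g t)) UNIV"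
    by (rule has_sum_integral_fourier_series[OF c g])
  then have "((\<lambda>m. c (- m) * (LINT t|circle. chr (- m) t * g t)) has_sum (LINT t|circle. fourier_series c t * g t)) UNIV"
    by (subst has_sum_reindex_bij_betw[of uminus UNIV UNIV "\<lambda>m. c m * (LINT t|circle. chr m t * g t)"]) (auto simp: bij_uminus)
  moreover have "c (- m) * (LINT t|circle. chr (- m) t * g t) =
      2 * pi * (poisson_coeff r m * fourier_coeff (dist_of g) m * chr m \<theta>)" for m
    unfolding fourier_coeff_dist_of c_def poisson_coeff_def by (simp add: mult_ac)
  moreover have "((\<lambda>m. 2 * pi * (poisson_coeff r m * fourier_coeff (dist_of g) m * chr m \<theta>)) has_sum
      2 * pi * poisson_mean r g \<theta>) UNIV"
    unfolding poisson_mean_def by (intro has_sum_cmult_right fourier_series_has_sum poisson_mean_summable g)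
  ultimately show "2 * pi * poisson_mean r g \<theta> = (LINT t|circle. fourier_series (poisson_coeff r) (t - \<theta>) * g t)"
    unfolding fc[symmetric] using has_sum_unique by simp
  show "integrable circle (\<lambda>t. fourier_series (poisson_coeff r) (t - \<theta>) * g t)"
    unfolding fc[symmetric] by (rule integrable_mult_fourier_series[OF c g])
qed

text \<open>Positivity of the Poisson kernel reduces the bound to the Poisson mean of \<open>\<bar>g\<bar>\<close>, whose integral is its zeroth coefficient.\<close>

lemma poisson_mean_L1:
  assumes g: "integrable circle g"
  shows "L1_norm circle (poisson_mean r g) \<le> L1_norm circle g"
proof -
  define k where "k = (\<lambda>t. complex_of_real (norm (g t)))"
  have k: "integrable circle k" unfolding k_def using g by simp
  have le: "norm (poisson_mean r g \<theta>) \<le> Re (poisson_mean r k \<theta>)" for \<theta>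
  proof -
    let ?P = "\<lambda>t. fourier_series (poisson_coeff r) (t - \<theta>)"
    have P: "norm (?P t) = Re (?P t)" "Im (?P t) = 0" for t
    proof -
      have "0 \<le> (1 - r\<^sup>2) / (norm (1 - of_real r * cis (t - \<theta>)))\<^sup>2"
        using r by (intro divide_nonneg_nonneg) (auto simp: abs_square_le_1)
      then show "norm (?P t) = Re (?P t)" "Im (?P t) = 0"
        unfolding poisson_kernel[OF r] by (simp_all only: norm_of_real abs_of_nonneg Re_complex_of_real Im_complex_of_real)
    qed
    have "2 * pi * norm (poisson_mean r g \<theta>) = norm (LINT t|circle. ?P t * g t)"
      unfolding poisson_mean_integral(1)[OF g, symmetric] by (simp add: norm_mult)
    also have "\<dots> \<le> (LINT t|circle. norm (?P t * g t))" by (rule integral_norm_bound)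
    also have "\<dots> = (LINT t|circle. Re (?P t * k t))"
      by (intro Bochner_Integration.integral_cong refl) (simp add: norm_mult P k_def)
    also have "\<dots> = Re (LINT t|circle. ?P t * k t)"
      by (rule integral_Re[OF poisson_mean_integral(2)[OF k]])
    also have "\<dots> = 2 * pi * Re (poisson_mean r k \<theta>)"
      unfolding poisson_mean_integral(1)[OF k, symmetric] by simp
    finally show ?thesis by simp
  qed
  have i: "integrable circle (poisson_mean r f)" if "integrable circle f" for f
    unfolding poisson_mean_def by (intro integrable_fourier_series poisson_mean_summable that)
  have "L1_norm circle (poisson_mean r g) \<le> (LINT \<theta>|circle. Re (poisson_mean r k \<theta>))"
    unfolding L1_norm_def by (intro integral_mono le integrable_norm integrable_Re i g k)
  also have "\<dots> = Re (LINT \<theta>|circle. poisson_mean r k \<theta>)"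
    by (rule integral_Re[OF i[OF k]])
  also have "(LINT \<theta>|circle. poisson_mean r k \<theta>) = 2 * pi * fourier_coeff (dist_of k) 0"
    using integral_fourier_series_chr[OF poisson_mean_summable[OF k], of 0]
    by (simp add: poisson_mean_def poisson_coeff_def)
  also have "\<dots> = (LINT t|circle. k t)" by (simp add: fourier_coeff_dist_of)
  also have "\<dots> = of_real (L1_norm circle g)" unfolding k_def L1_norm_def by (rule integral_complex_of_real)
  finally show ?thesis by simp
qed

end

subsection \<open>Negative Sobolev spaces\<close>

lemma power2_powr_half: "m \<noteq> 0 \<Longrightarrow> (\<bar>real_of_int m\<bar> powr (1/2))\<^sup>2 = \<bar>of_int m\<bar>"
  by (simp add: powr_half_sqrt)

lemma Hdot_space_coeff:
  assumes "h \<in> Hdot_space"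
  shows "h \<in> distributions" "fourier_coeff h 0 = 0"
    and "(\<lambda>m::int. inverse \<bar>of_int m\<bar> * (norm (fourier_coeff h m))\<^sup>2) summable_on -{0}"
proof -
  obtain g where g: "g \<in> L2 circle" "dist_eq h (quarter_laplacian (dist_of g))" and d: "h \<in> distributions"
    using assms by (auto simp: Hdot_space_def)
  show "h \<in> distributions" by fact
  have c: "fourier_coeff h m = of_real (\<bar>of_int m\<bar> powr (1/2)) * fourier_coeff (dist_of g) m" for m
    unfolding fourier_coeff_cong[OF g(2)] by (rule fourier_coeff_quarter_laplacian)
  show "fourier_coeff h 0 = 0" using c[of 0] by simp
  have "inverse \<bar>real_of_int m\<bar> * (norm (fourier_coeff h m))\<^sup>2 = (norm (fourier_coeff (dist_of g) m))\<^sup>2" if "m \<in> -{0}" for m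
    unfolding c norm_mult power_mult_distrib using that power2_powr_half[of m] by (simp add: field_simps)
  then show "(\<lambda>m::int. inverse \<bar>of_int m\<bar> * (norm (fourier_coeff h m))\<^sup>2) summable_on -{0}"
    using summable_on_subset[OF bessel_summable[OF g(1)], of "-{0}"] by (subst summable_on_cong) auto
qed

text \<open>Dividing by |m|^(1/2) yields square summable coefficients, which Riesz-Fischer realizes
  by a function g. With the previous lemma this describes the space by coefficients alone.\<close>

lemma Hdot_spaceI:
  assumes h: "h \<in> distributions" "fourier_coeff h 0 = 0"
    and s: "(\<lambda>m::int. inverse \<bar>of_int m\<bar> * (norm (fourier_coeff h m))\<^sup>2) summable_on -{0}"
  shows "h \<in> Hdot_space"
proof -
  \<comment> \<open>At m = 0 the power is 0 and \<open>inverse 0 = 0\<close>, so c 0 = 0.\<close>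
  define c where "c = (\<lambda>m. of_real (inverse (\<bar>of_int m\<bar> powr (1/2))) * fourier_coeff h m)"
  have c2: "(norm (c m))\<^sup>2 = inverse \<bar>real_of_int m\<bar> * (norm (fourier_coeff h m))\<^sup>2" if "m \<in> -{0}" for m
    unfolding c_def norm_mult power_mult_distrib using that power2_powr_half[of m]
    by (simp add: power_inverse norm_inverse)
  have "(\<lambda>m. (norm (c m))\<^sup>2) summable_on -{0}" using s by (subst summable_on_cong[OF c2])
  then have "(\<lambda>m. (norm (c m))\<^sup>2) summable_on (-{0} \<union> {0})" by (intro summable_on_union) auto
  then have "(\<lambda>m. (norm (c m))\<^sup>2) summable_on UNIV" by (simp add: Un_commute)
  then obtain g where g: "g \<in> L2 circle" "\<And>m. fourier_coeff (dist_of g) m = c m"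
    using riesz_fischer by blast
  have "dist_eq h (quarter_laplacian (dist_of g))"
    unfolding dist_eq_def
  proof
    fix \<phi> assume t: "\<phi> \<in> test_functions"
    have "of_real (\<bar>of_int m\<bar> powr (1/2)) * c m = fourier_coeff h m" for m
      using h(2) by (cases "m = 0") (auto simp: c_def simp flip: of_real_mult mult.assoc)
    then have "quarter_laplacian (dist_of g) \<phi> = (\<Sum>\<^sub>\<infinity>m\<in>UNIV. fourier_coeff h m * dist_of (chr m) \<phi>)"
      unfolding quarter_laplacian_def fourier_multiplier_def g(2) by simp
    also have "\<dots> = h \<phi>" by (rule infsumI[OF distribution_has_sum[OF h(1) t]])
    finally show "h \<phi> = quarter_laplacian (dist_of g) \<phi>" ..
  qed
  then show ?thesis using g h by (auto simp: Hdot_space_def)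
qed

subsection \<open>The area integral of a power series\<close>

definition of_vec2 :: "real^2 \<Rightarrow> complex" where "of_vec2 v = Complex (v $ 1) (v $ 2)"

definition to_vec2 :: "complex \<Rightarrow> real^2" where "to_vec2 z = vector [Re z, Im z]"

lemma of_vec2_to_vec2 [simp]: "of_vec2 (to_vec2 z) = z"
  by (simp add: of_vec2_def to_vec2_def complex_eq_iff)

lemma to_vec2_of_vec2 [simp]: "to_vec2 (of_vec2 v) = v"
  by (simp add: of_vec2_def to_vec2_def vec_eq_iff forall_2)

lemma linear_of_vec2: "linear of_vec2"
  by (rule linearI) (auto simp: of_vec2_def complex_eq_iff)

lemma linear_to_vec2: "linear to_vec2"
  by (rule linearI) (auto simp: to_vec2_def vec_eq_iff forall_2)

lemma norm_to_vec2: "norm (to_vec2 z) = norm z"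
  by (simp add: norm_vec_def L2_set_def UNIV_2 to_vec2_def cmod_def)

lemma norm_of_vec2: "norm (of_vec2 v) = norm v"
  by (metis norm_to_vec2 to_vec2_of_vec2)

lemma borel_of_vec2 [measurable]: "of_vec2 \<in> borel_measurable borel"
  by (intro borel_measurable_continuous_onI linear_continuous_on)
     (simp add: linear_conv_bounded_linear[symmetric] linear_of_vec2)

lemma vimage_of_vec2_box: "of_vec2 -` box l u = box (to_vec2 l) (to_vec2 u)"
  by (auto simp: mem_box_cart forall_2 to_vec2_def of_vec2_def mem_box Basis_complex_def)

text \<open>Both measures give a box the product of its side lengths. The passage to
  \<open>real^2\<close> makes \<open>measure_orthogonal_image\<close> applicable to
  rotations.\<close>

lemma lborel_complex: "(lborel :: complex measure) = distr lborel borel of_vec2"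
proof (rule lborel_eqI)
  fix l u :: complex assume le: "\<And>b. b \<in> Basis \<Longrightarrow> l \<bullet> b \<le> u \<bullet> b"
  from this[of 1] this[of \<i>] have le': "Re l \<le> Re u" "Im l \<le> Im u" by (simp_all add: Basis_complex_def)
  have 1: "(\<Prod>b\<in>Basis. (u - l) \<bullet> b) = (Re u - Re l) * (Im u - Im l)"
    by (simp add: Basis_complex_def)
  have "cbox (to_vec2 l) (to_vec2 u) \<noteq> {}"
    using le' by (auto simp: interval_ne_empty_cart forall_2 to_vec2_def)
  then have "measure lborel (cbox (to_vec2 l) (to_vec2 u)) = (Re u - Re l) * (Im u - Im l)"
    by (subst content_cbox_cart) (auto simp: UNIV_2 to_vec2_def)
  then have "emeasure lborel (box (to_vec2 l) (to_vec2 u)) = ennreal ((Re u - Re l) * (Im u - Im l))"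
    by (metis emeasure_eq_ennreal_measure emeasure_lborel_box_eq emeasure_lborel_cbox_eq
         emeasure_lborel_cbox_finite infinity_ennreal_def less_irrefl)
  then show "emeasure (distr lborel borel of_vec2) (box l u) = (\<Prod>b\<in>Basis. (u - l) \<bullet> b)"
    unfolding 1 by (subst emeasure_distr) (auto simp: vimage_of_vec2_box)
qed simp

lemma lborel_distr_rotate:
  fixes c :: complex assumes c: "norm c = 1"
  shows "distr lborel borel (\<lambda>z. c * z) = lborel"
proof (rule lborel_eqI[symmetric])
  fix l u :: complex assume le: "\<And>b. b \<in> Basis \<Longrightarrow> l \<bullet> b \<le> u \<bullet> b"
  \<comment> \<open>The inverse rotation: as |c| = 1, the preimage of a box under multiplication by
    c is its image under multiplication by \<open>cnj c\<close>.\<close>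
  define R where "R = (\<lambda>v. to_vec2 (cnj c * of_vec2 v))"
  let ?B = "of_vec2 -` box l u"
  have "linear R"
    unfolding R_def using linear_compose[OF linear_compose[OF linear_of_vec2 linear_times] linear_to_vec2]
    by (simp add: o_def)
  then have R: "orthogonal_transformation R"
    by (simp add: orthogonal_transformation R_def norm_to_vec2 norm_mult norm_of_vec2 c)
  have B: "?B \<in> lmeasurable" unfolding vimage_of_vec2_box by simp
  have cc: "cnj c * c = 1" using c complex_norm_square[of c] by (simp add: mult.commute)
  have cc': "cnj c * (c * w) = w" "c * (cnj c * w) = w" for w
    using cc by (metis mult.assoc mult.commute mult_1)+
  have im: "(\<lambda>v. c * of_vec2 v) -` box l u = R ` ?B"
  proof (intro set_eqI iffI)
    fix v assume "v \<in> (\<lambda>v. c * of_vec2 v) -` box l u"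
    then have "to_vec2 (c * of_vec2 v) \<in> ?B" "v = R (to_vec2 (c * of_vec2 v))"
      by (auto simp: R_def cc')
    then show "v \<in> R ` ?B" by blast
  next
    fix v assume "v \<in> R ` ?B"
    then show "v \<in> (\<lambda>v. c * of_vec2 v) -` box l u"
      by (auto simp: R_def cc')
  qed
  have m: "(\<lambda>v. c * of_vec2 v) \<in> borel_measurable borel" by simp
  have "emeasure (distr lborel borel (\<lambda>z. c * z)) (box l u) = emeasure lborel ((\<lambda>v. c * of_vec2 v) -` box l u)"
    unfolding lborel_complex by (subst distr_distr) (auto simp: o_def emeasure_distr)
  also have "\<dots> = emeasure lebesgue (R ` ?B)"
    unfolding im[symmetric] using measurable_sets_borel[OF m, of "box l u"] by simp
  also have "\<dots> = ennreal (measure lebesgue (R ` ?B))"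
    by (rule emeasure_eq_measure2[OF measurable_orthogonal_image[OF R B]])
  also have "\<dots> = ennreal (measure lebesgue ?B)"
    by (simp only: measure_orthogonal_image[OF R B])
  also have "\<dots> = emeasure lebesgue ?B" by (rule emeasure_eq_measure2[OF B, symmetric])
  also have "\<dots> = emeasure lborel ?B"
    by (simp add: vimage_of_vec2_box)
  also have "\<dots> = emeasure (distr lborel borel of_vec2) (box l u)"
    by (subst emeasure_distr) auto
  also have "\<dots> = emeasure lborel (box l u)" by (simp only: lborel_complex)
  also have "\<dots> = (\<Prod>b\<in>Basis. (u - l) \<bullet> b)" using le by (simp add: emeasure_lborel_box_eq)
  finally show "emeasure (distr lborel borel (\<lambda>z. c * z)) (box l u) = (\<Prod>b\<in>Basis. (u - l) \<bullet> b)" .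
qed simp

lemma nn_integral_rotate:
  assumes "norm (c::complex) = 1" and [measurable]: "h \<in> borel_measurable borel"
  shows "(\<integral>\<^sup>+z. h (c * z) \<partial>lborel) = (\<integral>\<^sup>+z. h z \<partial>lborel)"
  by (subst (2) lborel_distr_rotate[OF assms(1), symmetric], subst nn_integral_distr) auto

section \<open>Area integrals of powers of the modulus\<close>

lemma emeasure_annulus:
  assumes "0 \<le> t" "t \<le> 1"
  shows "emeasure lborel {z::complex. t \<le> (norm z)\<^sup>2 \<and> norm z < 1} = ennreal (pi * (1 - t))"
proof -
  have s: "{z::complex. t \<le> (norm z)\<^sup>2 \<and> norm z < 1} = ball 0 1 - ball 0 (sqrt t)"
  proof -
    have "sqrt t \<le> norm z \<longleftrightarrow> t \<le> (norm z)\<^sup>2" for z :: complex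
      using sqrt_le_D[of t "norm z"] real_le_lsqrt[of "norm z" t] by auto
    then show ?thesis by (intro set_eqI) (simp only: mem_Collect_eq Diff_iff mem_ball_0 not_less conj_commute)
  qed
  have v: "emeasure lborel (ball 0 r :: complex set) = ennreal (pi * r\<^sup>2)" if "0 \<le> r" for r
    using emeasure_ball[OF that, of "0::complex"] by (simp add: unit_ball_vol_2)
  have "emeasure lborel (ball 0 1 - ball 0 (sqrt t) :: complex set) = ennreal (pi * 1\<^sup>2) - ennreal (pi * (sqrt t)\<^sup>2)"
    using assms by (subst emeasure_Diff[OF _ _ _ subset_ball]) (auto simp: v)
  also have "\<dots> = ennreal (pi * (1 - t))"
    using assms by (subst ennreal_minus) (auto simp: algebra_simps)
  finally show ?thesis unfolding s .
qed

lemma nn_integral_power_unit_interval: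
  assumes "0 \<le> a" "a \<le> (1::real)" "n > 0"
  shows "(\<integral>\<^sup>+t. ennreal (real n * t ^ (n - 1)) * indicator {0..a} t \<partial>lborel) = ennreal (a ^ n)"
proof -
  have "(\<integral>\<^sup>+t. ennreal (real n * t ^ (n - 1)) * indicator {0..a} t \<partial>lborel) = ennreal (a ^ n - 0 ^ n)"
  proof (rule nn_integral_FTC_Icc)
    show "((\<lambda>t. t ^ n) has_real_derivative real n * x ^ (n - 1)) (at x)" for x :: real
      by (auto intro!: derivative_eq_intros)
  qed (use assms in auto)
  then show ?thesis using assms by simp
qed

text \<open>Layer cake: |z|^(2n) is the integral of n t^(n-1) over 0 \<le> t \<le> |z|^2. After
  exchanging integrals the annulus t \<le> |z|^2 < 1 contributes pi (1 - t), and integrating against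
  n t^(n-1) gives pi (1 - n/(n+1)). The case n = 0 is separate because the density n t^(n-1)
  vanishes there.\<close>

lemma nn_integral_disc_power:
  "(\<integral>\<^sup>+z. indicator (ball 0 1) z * ennreal (norm (z::complex) ^ (2 * n)) \<partial>lborel) = ennreal (pi / real (Suc n))"
proof (cases "n = 0")
  case True
  then show ?thesis using emeasure_ball[of 1 "0::complex"] by (simp add: unit_ball_vol_2)
next
  case False
  let ?g = "\<lambda>t. real n * t ^ (n - 1)"
  let ?A = "\<lambda>(z::complex) t. indicator {0..1} t * indicator {x. snd x \<le> (norm (fst x))\<^sup>2 \<and> norm (fst x) < 1} (z, t) :: ennreal"
  have [measurable]: "{x::complex\<times>real. snd x \<le> (norm (fst x))\<^sup>2 \<and> norm (fst x) < 1} \<in> sets (borel \<Otimes>\<^sub>M borel)"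
  proof -
    have "{x \<in> space (borel \<Otimes>\<^sub>M borel). snd x \<le> (norm (fst x :: complex))\<^sup>2 \<and> norm (fst x) < 1} \<in> sets (borel \<Otimes>\<^sub>M borel)"
      by measurable
    then show ?thesis by (simp add: space_pair_measure)
  qed
  have 1: "indicator (ball 0 1) z * ennreal (norm z ^ (2 * n)) = (\<integral>\<^sup>+t. ennreal (?g t) * ?A z t \<partial>lborel)" for z
  proof (cases "norm z < 1")
    case True
    have z: "(norm z)\<^sup>2 \<le> 1" using True by (simp add: abs_square_le_1)
    have "(\<integral>\<^sup>+t. ennreal (?g t) * ?A z t \<partial>lborel) = (\<integral>\<^sup>+t. ennreal (?g t) * indicator {0..(norm z)\<^sup>2} t \<partial>lborel)"
      using True z by (intro nn_integral_cong) (auto simp: indicator_def)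
    also have "\<dots> = ennreal (norm z ^ (2 * n))"
      using False z by (subst nn_integral_power_unit_interval) (auto simp: power_mult)
    finally show ?thesis using True by simp
  qed (auto simp: indicator_def)
  have "(\<integral>\<^sup>+z. indicator (ball 0 1) z * ennreal (norm (z::complex) ^ (2 * n)) \<partial>lborel) =
      (\<integral>\<^sup>+z. \<integral>\<^sup>+t. ennreal (?g t) * ?A z t \<partial>lborel \<partial>lborel)" unfolding 1 ..
  also have "\<dots> = (\<integral>\<^sup>+t. \<integral>\<^sup>+z. ennreal (?g t) * ?A z t \<partial>lborel \<partial>lborel)"
    by (rule lborel_pair.Fubini'[symmetric]) measurable
  also have "\<dots> = (\<integral>\<^sup>+t. ennreal (pi * (real n * t ^ (n - 1) - real n * t ^ n)) * indicator {0..1} t \<partial>lborel)"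
  proof (rule nn_integral_cong)
    fix t :: real
    show "(\<integral>\<^sup>+z. ennreal (?g t) * ?A z t \<partial>lborel) = ennreal (pi * (real n * t ^ (n - 1) - real n * t ^ n)) * indicator {0..1} t"
    proof (cases "t \<in> {0..1}")
      case True
      have "(\<integral>\<^sup>+z. ennreal (?g t) * ?A z t \<partial>lborel) =
          (\<integral>\<^sup>+z. ennreal (?g t) * indicator {z. t \<le> (norm z)\<^sup>2 \<and> norm z < 1} (z::complex) \<partial>lborel)"
        using True by (intro nn_integral_cong) (auto simp: indicator_def)
      also have "\<dots> = ennreal (?g t) * ennreal (pi * (1 - t))"
        using True emeasure_annulus[of t] by (subst nn_integral_cmult_indicator) auto
      also have "\<dots> = ennreal (?g t * (pi * (1 - t)))"
        using True by (intro ennreal_mult[symmetric]) auto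
      also have "?g t * (pi * (1 - t)) = pi * (real n * t ^ (n - 1) - real n * t ^ n)"
        using False by (cases n) (auto simp: algebra_simps)
      finally show ?thesis using True by simp
    qed simp
  qed
  also have "\<dots> = ennreal (pi * (1 ^ n - real n / real (Suc n) * 1 ^ Suc n) - pi * (0 ^ n - real n / real (Suc n) * 0 ^ Suc n))"
  proof (rule nn_integral_FTC_Icc)
    fix x :: real assume "x \<in> {0..1}"
    then have x: "0 \<le> x" "x \<le> 1" by auto
    have "real n / real (Suc n) * (real (Suc n) * x ^ n) = real n * x ^ n" by simp
    then show "((\<lambda>t. pi * (t ^ n - real n / real (Suc n) * t ^ Suc n)) has_real_derivative
       pi * (real n * x ^ (n - 1) - real n * x ^ n)) (at x)"
      by (auto intro!: derivative_eq_intros simp del: power_Suc of_nat_Suc)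
    have "x ^ n \<le> x ^ (n - 1)" using x by (intro power_decreasing) auto
    then show "0 \<le> pi * (real n * x ^ (n - 1) - real n * x ^ n)"
      by (simp add: mult_left_mono)
  qed auto
  also have "\<dots> = ennreal (pi / real (Suc n))"
    using False by (intro arg_cong[of _ _ ennreal]) (simp add: field_simps power_0_left)
  finally show ?thesis .
qed

section \<open>Power series as Fourier series on the nonnegative half line\<close>

definition half_line_coeff :: "(nat \<Rightarrow> complex) \<Rightarrow> int \<Rightarrow> complex" where
  "half_line_coeff a m = (if m \<ge> 0 then a (nat m) else 0)"

lemma has_sum_half_line:
  fixes f :: "int \<Rightarrow> 'a::topological_comm_monoid_add"
  assumes "\<And>m. m < 0 \<Longrightarrow> f m = 0"
  shows "(f has_sum s) UNIV \<longleftrightarrow> ((\<lambda>n. f (int n)) has_sum s) UNIV"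
proof -
  have "(f has_sum s) UNIV \<longleftrightarrow> (f has_sum s) (range int)"
    by (rule has_sum_cong_neutral) (use assms in \<open>auto simp: image_iff\<close>, metis nat_0_le not_le)
  also have "\<dots> \<longleftrightarrow> ((\<lambda>n. f (int n)) has_sum s) UNIV"
    by (subst has_sum_reindex) (auto simp: o_def)
  finally show ?thesis .
qed

lemma half_line_summable:
  assumes "summable (\<lambda>n. norm (a n))"
  shows "(\<lambda>m. norm (half_line_coeff a m)) summable_on UNIV"
proof -
  have "((\<lambda>n. norm (a n)) has_sum (\<Sum>n. norm (a n))) UNIV"
    using assms by (intro norm_summable_imp_has_sum summable_sums) auto
  then have "((\<lambda>m. norm (half_line_coeff a m)) has_sum (\<Sum>n. norm (a n))) UNIV"
    by (subst has_sum_half_line) (auto simp: half_line_coeff_def)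
  then show ?thesis by (rule has_sum_imp_summable)
qed

lemma half_line_fourier_series:
  assumes "summable (\<lambda>n. norm (a n))"
  shows "(\<lambda>n. a n * cis (real n * \<theta>)) sums fourier_series (half_line_coeff a) \<theta>"
proof -
  have "((\<lambda>m. half_line_coeff a m * chr m \<theta>) has_sum fourier_series (half_line_coeff a) \<theta>) UNIV"
    by (rule fourier_series_has_sum[OF half_line_summable[OF assms]])
  then have "((\<lambda>n. a n * cis (real n * \<theta>)) has_sum fourier_series (half_line_coeff a) \<theta>) UNIV"
    by (subst (asm) has_sum_half_line) (auto simp: half_line_coeff_def)
  then show ?thesis by (rule has_sum_imp_sums)
qed

lemma power_series_circle:
  fixes f :: "complex \<Rightarrow> complex"
  assumes f: "\<forall>z. norm z < 1 \<longrightarrow> (\<lambda>n. a n * z ^ n) sums f z" and z: "norm z < 1"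
  shows "summable (\<lambda>n. norm (a n * z ^ n))"
    and "f (cis \<theta> * z) = fourier_series (half_line_coeff (\<lambda>n. a n * z ^ n)) \<theta>"
proof -
  \<comment> \<open>A point of the disc of larger modulus than z: convergence there makes the series
    absolutely convergent at z.\<close>
  define w where "w = complex_of_real ((1 + norm z) / 2)"
  have w: "norm w < 1" "norm z < norm w" using z by (auto simp: w_def simp del: of_real_add of_real_divide)
  have "summable (\<lambda>n. a n * w ^ n)" using f w(1) by (auto intro: sums_summable)
  then show s: "summable (\<lambda>n. norm (a n * z ^ n))" by (rule powser_insidea[OF _ w(2)])
  have "(\<lambda>n. a n * (cis \<theta> * z) ^ n) sums f (cis \<theta> * z)" using f z by (simp add: norm_mult)
  moreover have "(\<lambda>n. a n * z ^ n * cis (real n * \<theta>)) sums fourier_series (half_line_coeff (\<lambda>n. a n * z ^ n)) \<theta>"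
    by (rule half_line_fourier_series[OF s])
  ultimately show "f (cis \<theta> * z) = fourier_series (half_line_coeff (\<lambda>n. a n * z ^ n)) \<theta>"
    by (auto simp: power_mult_distrib Complex.DeMoivre mult_ac intro: sums_unique2)
qed

text \<open>Parseval on the circle of radius |z|, with values in the extended nonnegative reals so
  that the sum can later be exchanged with the area integral.\<close>

lemma circle_mean_power_series:
  fixes f :: "complex \<Rightarrow> complex"
  assumes f: "\<forall>z. norm z < 1 \<longrightarrow> (\<lambda>n. a n * z ^ n) sums f z" and z: "norm z < 1"
  shows "(\<integral>\<^sup>+\<theta>. ennreal ((norm (f (cis \<theta> * z)))\<^sup>2) \<partial>circle) =
     (\<Sum>n. ennreal (2 * pi * (norm (a n))\<^sup>2) * ennreal (norm z ^ (2 * n)))"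
proof -
  let ?b = "\<lambda>n. a n * z ^ n"
  let ?S = "fourier_series (half_line_coeff ?b)"
  note s = power_series_circle(1)[OF f z]
  note hs = half_line_summable[OF s]
  have S: "?S \<in> L2 circle" by (rule continuous_L2[OF continuous_fourier_series[OF hs]])
  have "(\<integral>\<^sup>+\<theta>. ennreal ((norm (f (cis \<theta> * z)))\<^sup>2) \<partial>circle) = ennreal (LINT \<theta>|circle. (norm (?S \<theta>))\<^sup>2)"
    unfolding power_series_circle(2)[OF f z] using S by (intro nn_integral_eq_integral) (auto simp: L2_iff)
  also have "\<dots> = (\<Sum>n. ennreal (2 * pi * (norm (?b n))\<^sup>2))"
  proof -
    have "((\<lambda>m. (norm (half_line_coeff ?b m))\<^sup>2) has_sum (LINT x|circle. (norm (?S x))\<^sup>2) / (2 * pi)) UNIV"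
      by (rule parseval_fourier_series[OF hs])
    then have "((\<lambda>n. (norm (?b n))\<^sup>2) has_sum (LINT x|circle. (norm (?S x))\<^sup>2) / (2 * pi)) UNIV"
      by (subst (asm) has_sum_half_line) (auto simp: half_line_coeff_def)
    then have "(\<lambda>n. (norm (?b n))\<^sup>2) sums ((LINT x|circle. (norm (?S x))\<^sup>2) / (2 * pi))"
      by (rule has_sum_imp_sums)
    from sums_mult[OF this, of "2 * pi"]
    have "(\<lambda>n. 2 * pi * (norm (?b n))\<^sup>2) sums (LINT x|circle. (norm (?S x))\<^sup>2)" by simp
    then show ?thesis by (intro suminf_ennreal_eq[symmetric]) auto
  qed
  also have "\<dots> = (\<Sum>n. ennreal (2 * pi * (norm (a n))\<^sup>2) * ennreal (norm z ^ (2 * n)))"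
    by (intro suminf_cong, subst ennreal_mult[symmetric])
       (auto simp: norm_mult norm_power power_mult_distrib power_mult[symmetric] mult_ac)
  finally show ?thesis .
qed

text \<open>Averaging over rotations replaces polar coordinates.\<close>

lemma disc_integral_power_series:
  fixes f :: "complex \<Rightarrow> complex"
  assumes f: "\<forall>z. norm z < 1 \<longrightarrow> (\<lambda>n. a n * z ^ n) sums f z" and hol: "f holomorphic_on ball 0 1"
  shows "(\<integral>\<^sup>+z. ennreal ((norm (f z))\<^sup>2) \<partial>disc) = (\<Sum>n. ennreal (pi * (norm (a n))\<^sup>2 / real (Suc n)))"
proof -
  define h where "h = (\<lambda>z. indicator (ball 0 1) z * ennreal ((norm (f z))\<^sup>2))"
  have "(\<lambda>z. indicator (ball 0 1) z *\<^sub>R f z) \<in> borel_measurable borel"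
    by (intro borel_measurable_continuous_on_indicator holomorphic_on_imp_continuous_on[OF hol]) simp
  then have "(\<lambda>z. ennreal ((norm (indicator (ball 0 1) z *\<^sub>R f z))\<^sup>2)) \<in> borel_measurable borel" by measurable
  also have "(\<lambda>z. ennreal ((norm (indicator (ball 0 1) z *\<^sub>R f z))\<^sup>2)) = h"
    by (auto simp: h_def indicator_def fun_eq_iff)
  finally have hm [measurable]: "h \<in> borel_measurable borel" .
  define I where "I = (\<integral>\<^sup>+z. h z \<partial>lborel)"
  interpret pair_sigma_finite circle "lborel :: complex measure"
    by (intro pair_sigma_finite.intro circle.sigma_finite_measure_axioms sigma_finite_lborel)
  have cism [measurable]: "cis \<in> circle \<rightarrow>\<^sub>M borel"
    by (intro measurable_continuous_circle continuous_intros)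
  \<comment> \<open>Rotations leave the area integral I unchanged, so integrating over the angle
    only multiplies it by 2 pi. After exchanging the integrals, the inner one is a circle
    mean.\<close>
  have "(\<integral>\<^sup>+\<theta>. \<integral>\<^sup>+z. h (cis \<theta> * z) \<partial>lborel \<partial>circle) = (\<integral>\<^sup>+\<theta>. I \<partial>circle)"
    unfolding I_def by (intro nn_integral_cong nn_integral_rotate hm) simp
  also have "\<dots> = I * ennreal (2 * pi)" by (simp add: emeasure_circle del: space_circle)
  finally have "ennreal (2 * pi) * I = (\<integral>\<^sup>+\<theta>. \<integral>\<^sup>+z. h (cis \<theta> * z) \<partial>lborel \<partial>circle)" by (simp add: mult.commute)
  also have "\<dots> = (\<integral>\<^sup>+z. \<integral>\<^sup>+\<theta>. h (cis \<theta> * z) \<partial>circle \<partial>lborel)"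
    by (rule Fubini'[symmetric]) measurable
  also have "\<dots> = (\<integral>\<^sup>+z. (\<Sum>n. ennreal (2 * pi * (norm (a n))\<^sup>2) * (indicator (ball 0 1) z * ennreal (norm (z::complex) ^ (2 * n)))) \<partial>lborel)"
  proof (rule nn_integral_cong)
    fix z :: complex
    show "(\<integral>\<^sup>+\<theta>. h (cis \<theta> * z) \<partial>circle) = (\<Sum>n. ennreal (2 * pi * (norm (a n))\<^sup>2) * (indicator (ball 0 1) z * ennreal (norm z ^ (2 * n))))"
    proof (cases "norm z < 1")
      case True
      then show ?thesis unfolding h_def using circle_mean_power_series[OF f True]
        by (simp add: indicator_def norm_mult)
    qed (simp add: h_def indicator_def norm_mult)
  qed
  also have "\<dots> = (\<Sum>n. ennreal (2 * pi * (norm (a n))\<^sup>2) * ennreal (pi / real (Suc n)))"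
  proof (subst nn_integral_suminf)
    have m: "(\<lambda>z. indicator (ball 0 1) z * ennreal (norm (z::complex) ^ (2 * n))) \<in> borel_measurable lborel" for n
    proof (rule borel_measurable_times_ennreal)
      have "(\<lambda>z::complex. norm z ^ (2 * n)) \<in> borel_measurable borel"
        by (intro borel_measurable_continuous_onI continuous_intros)
      then show "(\<lambda>z::complex. ennreal (norm z ^ (2 * n))) \<in> borel_measurable lborel" by simp
    qed (intro borel_measurable_indicator, simp)
    show "(\<lambda>z. ennreal (2 * pi * (norm (a n))\<^sup>2) * (indicator (ball 0 1) z * ennreal (norm (z::complex) ^ (2 * n))))
        \<in> borel_measurable lborel" for n by (rule borel_measurable_times_ennreal[OF borel_measurable_const m])
    from m show "(\<Sum>n. \<integral>\<^sup>+z. ennreal (2 * pi * (norm (a n))\<^sup>2) * (indicator (ball 0 1) z * ennreal (norm (z::complex) ^ (2 * n))) \<partial>lborel)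
       = (\<Sum>n. ennreal (2 * pi * (norm (a n))\<^sup>2) * ennreal (pi / real (Suc n)))"
      by (simp only: nn_integral_cmult nn_integral_disc_power)
  qed
  also have "\<dots> = (\<Sum>n. ennreal (2 * pi) * ennreal (pi * (norm (a n))\<^sup>2 / real (Suc n)))"
    by (intro suminf_cong) (simp add: ennreal_mult[symmetric] mult_ac del: of_nat_Suc)
  also have "\<dots> = ennreal (2 * pi) * (\<Sum>n. ennreal (pi * (norm (a n))\<^sup>2 / real (Suc n)))"
    by (rule ennreal_suminf_cmult)
  finally have "I = (\<Sum>n. ennreal (pi * (norm (a n))\<^sup>2 / real (Suc n)))"
    by (subst (asm) ennreal_mult_cancel_left) auto
  moreover have "(\<integral>\<^sup>+z. ennreal ((norm (f z))\<^sup>2) \<partial>disc) = I"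
    unfolding disc_def I_def h_def by (subst nn_integral_restrict_space) (auto simp: mult.commute)
  ultimately show ?thesis by simp
qed

subsection \<open>Norms of power series\<close>

lemma L1_norm_nonneg: "0 \<le> L1_norm M g"
  by (simp add: L1_norm_def)

lemma Hdot_norm_nonneg: "0 \<le> Hdot_norm h"
  unfolding Hdot_norm_def by (intro real_sqrt_ge_zero infsum_nonneg) auto

lemma L2_norm_leI:
  assumes f: "f \<in> borel_measurable M" and "0 \<le> B"
    and le: "(\<integral>\<^sup>+x. ennreal ((norm (f x))\<^sup>2) \<partial>M) \<le> ennreal (B\<^sup>2)"
  shows "L2_norm M f \<le> ennreal B"
proof -
  have i: "integrable M (\<lambda>x. (norm (f x))\<^sup>2)"
    by (rule integrableI_bounded) (use f le in \<open>auto simp: top.extremum_strict intro: le_less_trans\<close>)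
  then have "ennreal (LINT x|M. (norm (f x))\<^sup>2) \<le> ennreal (B\<^sup>2)"
    using le by (simp add: nn_integral_eq_integral)
  then have "(LINT x|M. (norm (f x))\<^sup>2) \<le> B\<^sup>2" by (simp add: ennreal_le_iff)
  then have "sqrt (LINT x|M. (norm (f x))\<^sup>2) \<le> B" using \<open>0 \<le> B\<close> by (intro real_le_lsqrt) auto
  then show ?thesis using i f by (simp add: L2_norm_def L2_def ennreal_leI)
qed

lemma L2_norm_leD:
  assumes "L2_norm M f \<le> ennreal B" "0 \<le> B"
  shows "(\<integral>\<^sup>+x. ennreal ((norm (f x))\<^sup>2) \<partial>M) \<le> ennreal (B\<^sup>2)"
proof -
  have f: "f \<in> L2 M" using assms by (auto simp: L2_norm_def top_unique split: if_splits)
  then have i: "integrable M (\<lambda>x. (norm (f x))\<^sup>2)" by (simp add: L2_def)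
  have "sqrt (LINT x|M. (norm (f x))\<^sup>2) \<le> B" using assms f by (simp add: L2_norm_def ennreal_le_iff)
  then have "(LINT x|M. (norm (f x))\<^sup>2) \<le> B\<^sup>2" by (rule sqrt_le_D)
  then show ?thesis using i by (simp add: nn_integral_eq_integral ennreal_leI)
qed

lemma measurable_disc_holomorphic:
  assumes "f holomorphic_on ball 0 1" shows "f \<in> borel_measurable disc"
proof -
  have "f \<in> borel_measurable (restrict_space borel (ball 0 1))"
    by (intro borel_measurable_continuous_on_restrict holomorphic_on_imp_continuous_on assms)
  moreover have "sets disc = sets (restrict_space borel (ball 0 1))"
    unfolding disc_def by (intro sets_restrict_space_cong) simp
  ultimately show ?thesis by (simp cong: measurable_cong_sets)
qed

context
  fixes f :: "complex \<Rightarrow> complex" and a :: "nat \<Rightarrow> complex"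
  assumes hol: "f holomorphic_on ball 0 1"
    and f: "\<forall>z. norm z < 1 \<longrightarrow> (\<lambda>n. a n * z ^ n) sums f z"
begin

text \<open>This lemma and its converse below speak of partial sums: these are real numbers whatever
  the convergence, and limits in them can be taken term by term.\<close>

lemma bergman_coeff_leD:
  assumes "L2_norm disc f \<le> ennreal B" "0 \<le> B"
  shows "(\<Sum>n<N. pi * (norm (a n))\<^sup>2 / real (Suc n)) \<le> B\<^sup>2"
proof -
  have "ennreal (\<Sum>n<N. pi * (norm (a n))\<^sup>2 / real (Suc n)) = (\<Sum>n<N. ennreal (pi * (norm (a n))\<^sup>2 / real (Suc n)))"
    by (intro sum_ennreal[symmetric]) simp
  also have "\<dots> \<le> (\<Sum>n. ennreal (pi * (norm (a n))\<^sup>2 / real (Suc n)))"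
    by (intro sum_le_suminf) auto
  also have "\<dots> \<le> ennreal (B\<^sup>2)"
    unfolding disc_integral_power_series[OF f hol, symmetric] by (rule L2_norm_leD[OF assms])
  finally show ?thesis by (simp add: ennreal_le_iff del: of_nat_Suc)
qed

lemma bergman_coeff_leI:
  assumes le: "\<And>N. (\<Sum>n<N. pi * (norm (a n))\<^sup>2 / real (Suc n)) \<le> B\<^sup>2" and "0 \<le> B"
  shows "L2_norm disc f \<le> ennreal B"
proof (rule L2_norm_leI[OF measurable_disc_holomorphic[OF hol] \<open>0 \<le> B\<close>])
  have s: "summable (\<lambda>n. pi * (norm (a n))\<^sup>2 / real (Suc n))"
    by (rule summableI_nonneg_bounded[OF _ le]) simp
  have "(\<integral>\<^sup>+z. ennreal ((norm (f z))\<^sup>2) \<partial>disc) = ennreal (\<Sum>n. pi * (norm (a n))\<^sup>2 / real (Suc n))"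
    unfolding disc_integral_power_series[OF f hol] using s by (intro suminf_ennreal2) auto
  also have "\<dots> \<le> ennreal (B\<^sup>2)"
    by (intro ennreal_leI suminf_le_const s le)
  finally show "(\<integral>\<^sup>+z. ennreal ((norm (f z))\<^sup>2) \<partial>disc) \<le> ennreal (B\<^sup>2)" .
qed

end

lemma holomorphic_power_series_at_0:
  assumes "f holomorphic_on ball 0 1"
  obtains a where "\<forall>z. norm z < 1 \<longrightarrow> (\<lambda>n. a n * z ^ n) sums f z"
  using holomorphic_power_series[OF assms] that[of "\<lambda>n. (deriv ^^ n) f 0 / fact n"] by auto

lemma half_line_coeff_power:
  "half_line_coeff (\<lambda>n. a n * of_real r ^ n) m = poisson_coeff r m * half_line_coeff a m"
  by (simp add: half_line_coeff_def poisson_coeff_def)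

text \<open>On the circle of radius r the power series is the Poisson mean of its formal boundary
  value, the half-line series with coefficients a.\<close>

lemma circle_restriction:
  assumes f: "\<forall>z. norm z < 1 \<longrightarrow> (\<lambda>n. a n * z ^ n) sums f z" and r: "0 \<le> r" "r < 1"
  shows "(\<lambda>m. norm (poisson_coeff r m * half_line_coeff a m)) summable_on UNIV"
    and "(\<lambda>\<theta>. f (of_real r * cis \<theta>)) = fourier_series (\<lambda>m. poisson_coeff r m * half_line_coeff a m)"
proof -
  have z: "norm (of_real r :: complex) < 1" using r by simp
  show "(\<lambda>m. norm (poisson_coeff r m * half_line_coeff a m)) summable_on UNIV"
    using half_line_summable[OF power_series_circle(1)[OF f z]] by (simp only: half_line_coeff_power)
  show "(\<lambda>\<theta>. f (of_real r * cis \<theta>)) = fourier_series (\<lambda>m. poisson_coeff r m * half_line_coeff a m)"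
    using power_series_circle(2)[OF f z]
    by (simp add: half_line_coeff_power mult.commute[of "of_real r" "cis _"] flip: half_line_coeff_power[abs_def])
qed

lemma H_spaceI:
  assumes "(\<lambda>m. norm (c m)) summable_on UNIV"
    and "(\<lambda>k::int. (1 + \<bar>of_int k\<bar>\<^sup>2) powr (-1/2) * (norm (c k))\<^sup>2) summable_on UNIV"
  shows "dist_of (fourier_series c) \<in> H_space"
  using assms dist_of_distribution[OF integrable_fourier_series[OF assms(1)]]
  by (simp add: H_space_def fourier_coeff_fourier_series[OF assms(1)])

lemma H_norm_fourier_series:
  assumes "(\<lambda>m. norm (c m)) summable_on UNIV"
  shows "H_norm (dist_of (fourier_series c)) = sqrt (\<Sum>\<^sub>\<infinity>k\<in>UNIV. (1 + \<bar>of_int k\<bar>\<^sup>2) powr (-1/2) * (norm (c k))\<^sup>2)"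
  by (simp add: H_norm_def fourier_coeff_fourier_series[OF assms])

text \<open>From |m| \<le> sqrt(1 + m^2), and in the next lemma sqrt(1 + m^2) \<le> 2|m|: away from
  0 the homogeneous and inhomogeneous weights agree up to a factor 2.\<close>

lemma H_weight_le: "m \<noteq> 0 \<Longrightarrow> (1 + \<bar>real_of_int m\<bar>\<^sup>2) powr (-1/2) \<le> inverse \<bar>of_int m\<bar>"
proof -
  assume "m \<noteq> 0"
  have "\<bar>real_of_int m\<bar> \<le> sqrt (1 + \<bar>real_of_int m\<bar>\<^sup>2)" by (rule real_le_rsqrt) simp
  then have "inverse (sqrt (1 + \<bar>real_of_int m\<bar>\<^sup>2)) \<le> inverse \<bar>real_of_int m\<bar>"
    using \<open>m \<noteq> 0\<close> by (intro le_imp_inverse_le) auto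
  then show ?thesis by (simp add: powr_minus powr_half_sqrt add_nonneg_nonneg)
qed

lemma H_weight_ge: "m \<noteq> 0 \<Longrightarrow> inverse \<bar>of_int m\<bar> \<le> 2 * (1 + \<bar>real_of_int m\<bar>\<^sup>2) powr (-1/2)"
proof -
  assume "m \<noteq> 0"
  then have "1 \<le> \<bar>real_of_int m\<bar>" by linarith
  then have "1\<^sup>2 \<le> \<bar>real_of_int m\<bar>\<^sup>2" by (intro power_mono) auto
  then have "sqrt (1 + \<bar>real_of_int m\<bar>\<^sup>2) \<le> 2 * \<bar>real_of_int m\<bar>"
    by (intro real_le_lsqrt) (auto simp: power_mult_distrib)
  then have "inverse (2 * \<bar>real_of_int m\<bar>) \<le> inverse (sqrt (1 + \<bar>real_of_int m\<bar>\<^sup>2))"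
    by (intro le_imp_inverse_le) (auto intro: add_pos_nonneg)
  then show ?thesis by (simp add: powr_minus powr_half_sqrt add_nonneg_nonneg)
qed

subsection \<open>From the Bergman space to the circle\<close>

context
  fixes C :: real
  assumes C: "C > 0"
    and A: "\<And>f. f holomorphic_on ball 0 1 \<Longrightarrow> L2_norm disc f \<le> ennreal C * boundary_norm f"
begin

text \<open>Here g is the L^1 part of an object with frequencies in the half line, and b lists the
  coefficients of its homogeneous Sobolev part. Poisson means of both parts decompose every circle
  restriction of the power series with total norm at most \<open>L1_norm circle g + B\<close>, and A
  converts this into a bound on c.\<close>

lemma bergman_bound:
  assumes g: "integrable circle g"
    and b: "(\<lambda>m::int. inverse \<bar>of_int m\<bar> * (norm (b m))\<^sup>2) summable_on -{0}" and b0: "b 0 = 0"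
    and eq: "\<And>m. fourier_coeff (dist_of g) m + b m = half_line_coeff c m"
    and B: "0 \<le> B" "(\<Sum>\<^sub>\<infinity>m\<in>-{0}. inverse \<bar>of_int m\<bar> * (norm (b m))\<^sup>2) \<le> B\<^sup>2"
  shows "(\<Sum>n<N. pi * (norm (c n))\<^sup>2 / real (Suc n)) \<le> (C * (L1_norm circle g + B))\<^sup>2"
proof -
  define L where "L = L1_norm circle g"
  have L: "0 \<le> L" by (simp add: L_def L1_norm_def)
  \<comment> \<open>Linear growth makes the power series converge in the disc. The coefficients of g
    are at most L, and a single term of the sum for b gives |b n|^2 \<le> B^2 n.\<close>
  have "norm (c n) \<le> (L + B) * real (Suc n)" for n
  proof -
    have "norm (fourier_coeff (dist_of g) (int n)) \<le> L / (2 * pi)"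
      unfolding L_def by (rule norm_fourier_coeff_le[OF g])
    also have "\<dots> \<le> L / 1" using L pi_gt3 by (intro divide_left_mono) auto
    finally have 1: "norm (fourier_coeff (dist_of g) (int n)) \<le> L" by simp
    have 2: "norm (b (int n)) \<le> B * real (Suc n)"
    proof (cases "n = 0")
      case False
      have "(\<Sum>m\<in>{int n}. inverse \<bar>of_int m\<bar> * (norm (b m))\<^sup>2) \<le> (\<Sum>\<^sub>\<infinity>m\<in>-{0}. inverse \<bar>of_int m\<bar> * (norm (b m))\<^sup>2)"
        using False by (intro finite_sum_le_infsum b) auto
      then have "inverse (real n) * (norm (b (int n)))\<^sup>2 \<le> B\<^sup>2" using B by simp
      then have "(norm (b (int n)))\<^sup>2 \<le> B\<^sup>2 * real n" using False by (simp add: field_simps)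
      also have "\<dots> \<le> B\<^sup>2 * (real (Suc n))\<^sup>2"
        by (intro mult_left_mono) (auto simp: power2_eq_square algebra_simps)
      finally have "(norm (b (int n)))\<^sup>2 \<le> (B * real (Suc n))\<^sup>2" by (simp add: power_mult_distrib)
      then show ?thesis by (rule power2_le_imp_le) (use B in auto)
    qed (use b0 B in simp)
    have "c n = fourier_coeff (dist_of g) (int n) + b (int n)" by (simp add: eq half_line_coeff_def)
    then have "norm (c n) \<le> norm (fourier_coeff (dist_of g) (int n)) + norm (b (int n))" by (metis norm_triangle_ineq)
    also have "\<dots> \<le> L * real (Suc n) + B * real (Suc n)"
      using 1 2 L mult_left_mono[of 1 "real (Suc n)" L] by linarith
    finally show ?thesis by (simp add: algebra_simps)
  qed
  note growth = this
  define f where "f = (\<lambda>z. \<Sum>n. c n * z ^ n)"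
  have f: "\<forall>z. norm z < 1 \<longrightarrow> (\<lambda>n. c n * z ^ n) sums f z"
  proof (intro allI impI)
    fix z :: complex assume z: "norm z < 1"
    have "summable (\<lambda>n. (L + B) * (of_nat (Suc n) * norm z ^ n))"
      using geometric_deriv_sums[of "norm z"] z by (intro summable_mult) (auto dest: sums_summable)
    then have "summable (\<lambda>n. c n * z ^ n)"
    proof (rule summable_comparison_test'[where N = 0])
      show "norm (c n * z ^ n) \<le> (L + B) * (of_nat (Suc n) * norm z ^ n)" for n
        using mult_right_mono[OF growth[of n], of "norm z ^ n"] by (simp add: norm_mult norm_power mult_ac)
    qed
    then show "(\<lambda>n. c n * z ^ n) sums f z" unfolding f_def by (rule summable_sums)
  qed
  have hol: "f holomorphic_on ball 0 1"
    by (rule power_series_holomorphic[of 0 1 c]) (use f in simp)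
  have "L1_plus_norm H_space H_norm (dist_of (\<lambda>\<theta>. f (of_real r * cis \<theta>))) \<le> ennreal (L + B)"
    if r: "0 < r" "r < 1" for r
  proof -
    have r0: "0 \<le> r" using r by simp
    note F = circle_restriction[OF f r0 r(2)]
    note G = poisson_mean_summable[OF r0 r(2) g]
    \<comment> \<open>The Sobolev part is what remains of the restriction after the Poisson mean of
      g is removed. Its coefficients shrink by r^|m| \<le> 1 and the inhomogeneous weight is the
      smaller one, so no constant is lost.\<close>
    define h where "h = (\<lambda>m. poisson_coeff r m * b m)"
    have hd: "h = (\<lambda>m. poisson_coeff r m * half_line_coeff c m - poisson_coeff r m * fourier_coeff (dist_of g) m)"
      by (auto simp: h_def eq[symmetric] algebra_simps)
    have hs: "(\<lambda>m. norm (h m)) summable_on UNIV"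
      by (rule summable_on_comparison_test[OF summable_on_add[OF F(1) G]]) (auto simp: hd norm_triangle_ineq4)
    have Fd: "(\<lambda>\<theta>. f (of_real r * cis \<theta>)) = (\<lambda>\<theta>. poisson_mean r g \<theta> + fourier_series h \<theta>)"
      unfolding F(2) hd poisson_mean_def using fourier_series_diff[OF F(1) G] by (simp add: fun_eq_iff)
    have Gi: "integrable circle (poisson_mean r g)"
      unfolding poisson_mean_def by (rule integrable_fourier_series[OF G])
    have w: "(1 + \<bar>real_of_int k\<bar>\<^sup>2) powr (-1/2) * (norm (h k))\<^sup>2 \<le> inverse \<bar>of_int k\<bar> * (norm (b k))\<^sup>2"
      if "k \<in> -{0}" for k
    proof (rule mult_mono)
      have "norm (h k) \<le> 1 * norm (b k)"
        unfolding h_def norm_mult poisson_coeff_def using r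
        by (intro mult_right_mono) (auto simp: norm_power power_le_one)
      then show "(norm (h k))\<^sup>2 \<le> (norm (b k))\<^sup>2" by (intro power_mono) auto
    qed (use that H_weight_le[of k] in auto)
    have "(\<lambda>k::int. (1 + \<bar>of_int k\<bar>\<^sup>2) powr (-1/2) * (norm (h k))\<^sup>2) summable_on -{0}"
      by (rule summable_on_comparison_test[OF b w]) auto
    then have "(\<lambda>k::int. (1 + \<bar>of_int k\<bar>\<^sup>2) powr (-1/2) * (norm (h k))\<^sup>2) summable_on (-{0} \<union> {0})"
      by (intro summable_on_union) auto
    then have ws: "(\<lambda>k::int. (1 + \<bar>of_int k\<bar>\<^sup>2) powr (-1/2) * (norm (h k))\<^sup>2) summable_on UNIV"
      by (simp add: Un_commute)
    have hH: "dist_of (fourier_series h) \<in> H_space" by (rule H_spaceI[OF hs ws])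
    have "(\<Sum>\<^sub>\<infinity>k\<in>UNIV. (1 + \<bar>of_int k\<bar>\<^sup>2) powr (-1/2) * (norm (h k))\<^sup>2) \<le> (\<Sum>\<^sub>\<infinity>m\<in>-{0}. inverse \<bar>of_int m\<bar> * (norm (b m))\<^sup>2)"
      by (rule infsum_mono_neutral[OF ws b]) (use w in \<open>auto simp: h_def b0\<close>)
    also note B(2)
    finally have "H_norm (dist_of (fourier_series h)) \<le> B"
      unfolding H_norm_fourier_series[OF hs] using B(1) by (intro real_le_lsqrt) auto
    moreover have "L1_norm circle (poisson_mean r g) \<le> L"
      unfolding L_def by (rule poisson_mean_L1[OF r0 r(2) g])
    ultimately have le: "ennreal (L1_norm circle (poisson_mean r g) + H_norm (dist_of (fourier_series h))) \<le> ennreal (L + B)"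
      by (intro ennreal_leI) auto
    have "dist_eq (dist_of (\<lambda>\<theta>. f (of_real r * cis \<theta>))) (\<lambda>\<phi>. dist_of (poisson_mean r g) \<phi> + dist_of (fourier_series h) \<phi>)"
      unfolding dist_eq_def Fd dist_of_def distrib_right
      by (intro ballI Bochner_Integration.integral_add integrable_mult_test Gi integrable_fourier_series[OF hs])
    then have "(poisson_mean r g, dist_of (fourier_series h)) \<in> decompositions H_space (dist_of (\<lambda>\<theta>. f (of_real r * cis \<theta>)))"
      using Gi hH by (simp add: decompositions_def L1_def)
    then have "L1_plus_norm H_space H_norm (dist_of (\<lambda>\<theta>. f (of_real r * cis \<theta>)))
      \<le> (case (poisson_mean r g, dist_of (fourier_series h)) of (g, h) \<Rightarrow> ennreal (L1_norm circle g + H_norm h))"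
      unfolding L1_plus_norm_def by (rule INF_lower)
    with le show ?thesis by simp
  qed
  then have "boundary_norm f \<le> ennreal (L + B)"
    unfolding boundary_norm_def
    by (intro Limsup_bounded eventually_at_leftI[of 0]) auto
  then have "L2_norm disc f \<le> ennreal C * ennreal (L + B)"
    using A[OF hol] by (meson mult_left_mono order_trans zero_le)
  also have "\<dots> = ennreal (C * (L + B))" using C L B by (simp add: ennreal_mult)
  finally have "L2_norm disc f \<le> ennreal (C * (L + B))" .
  from bergman_coeff_leD[OF hol f this, of N] show ?thesis using C L B by (simp add: L_def)
qed

text \<open>For \<open>\<kappa> = -\<i>\<close> the combination of the two data is a multiplier supported on one half line.\<close>

lemma bergman_bound_pair:
  assumes g: "integrable circle g1" "integrable circle g2"
    and b1: "(\<lambda>m::int. inverse \<bar>of_int m\<bar> * (norm (b1 m))\<^sup>2) summable_on -{0}" "b1 0 = 0"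
    and b2: "(\<lambda>m::int. inverse \<bar>of_int m\<bar> * (norm (b2 m))\<^sup>2) summable_on -{0}" "b2 0 = 0"
    and \<kappa>: "norm \<kappa> = 1"
    and eq: "\<And>m. (fourier_coeff (dist_of g1) m + b1 m + \<kappa> * (fourier_coeff (dist_of g2) m + b2 m)) / 2 = half_line_coeff c m"
  shows "(\<Sum>n<N. pi * (norm (c n))\<^sup>2 / real (Suc n)) \<le>
    (C * (L1_norm circle g1 + sqrt (\<Sum>\<^sub>\<infinity>m\<in>-{0}. inverse \<bar>of_int m\<bar> * (norm (b1 m))\<^sup>2) +
       (L1_norm circle g2 + sqrt (\<Sum>\<^sub>\<infinity>m\<in>-{0}. inverse \<bar>of_int m\<bar> * (norm (b2 m))\<^sup>2))))\<^sup>2"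
proof -
  define Q1 where "Q1 = (\<Sum>\<^sub>\<infinity>m\<in>-{0}. inverse \<bar>of_int m\<bar> * (norm (b1 m))\<^sup>2)"
  define Q2 where "Q2 = (\<Sum>\<^sub>\<infinity>m\<in>-{0}. inverse \<bar>of_int m\<bar> * (norm (b2 m))\<^sup>2)"
  have Q: "0 \<le> Q1" "0 \<le> Q2" unfolding Q1_def Q2_def by (auto intro!: infsum_nonneg)
  define g where "g = (\<lambda>x. (1/2) * g1 x + (\<kappa>/2) * g2 x)"
  define b where "b = (\<lambda>m. (b1 m + \<kappa> * b2 m) / 2)"
  have gi: "integrable circle g" unfolding g_def using g by simp
  have gc: "fourier_coeff (dist_of g) m = (fourier_coeff (dist_of g1) m + \<kappa> * fourier_coeff (dist_of g2) m) / 2" for m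
  proof -
    have "fourier_coeff (dist_of (\<lambda>x. (1/2) * g1 x)) m = (1/2) * fourier_coeff (dist_of g1) m"
      unfolding fourier_coeff_dist_of mult.assoc integral_mult_right_zero by simp
    then show ?thesis unfolding g_def
      using fourier_coeff_dist_of_add_scale[of "\<lambda>x. (1/2) * g1 x" g2 "\<kappa>/2" m] g by (simp add: field_simps)
  qed
  \<comment> \<open>The factor 1/2 in b leaves room for this crude estimate, which together with Q1
    + Q2 \<le> (sqrt Q1 + sqrt Q2)^2 replaces the triangle inequality in the Sobolev norm.\<close>
  have bb: "(norm (b m))\<^sup>2 \<le> (norm (b1 m))\<^sup>2 + (norm (b2 m))\<^sup>2" for m
  proof -
    have "norm (b m) \<le> (norm (b1 m) + norm (b2 m)) / 2"
      unfolding b_def norm_divide using norm_triangle_ineq[of "b1 m" "\<kappa> * b2 m"] \<kappa> by (simp add: norm_mult)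
    then have "(norm (b m))\<^sup>2 \<le> ((norm (b1 m) + norm (b2 m)) / 2)\<^sup>2" by (intro power_mono) auto
    also have "\<dots> \<le> (norm (b1 m))\<^sup>2 + (norm (b2 m))\<^sup>2"
    proof -
      have "(x + y)\<^sup>2 \<le> 4 * (x\<^sup>2 + y\<^sup>2)" for x y :: real
        using sum_squares_bound[of x y] zero_le_power2[of x] zero_le_power2[of y]
        unfolding power2_sum distrib_left by linarith
      from this[of "norm (b1 m)" "norm (b2 m)"] show ?thesis
        by (simp add: power_divide mult.commute)
    qed
    finally show ?thesis .
  qed
  have bs: "(\<lambda>m::int. inverse \<bar>of_int m\<bar> * (norm (b1 m))\<^sup>2 + inverse \<bar>of_int m\<bar> * (norm (b2 m))\<^sup>2) summable_on -{0}"
    by (rule summable_on_add[OF b1(1) b2(1)])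
  have le: "inverse \<bar>real_of_int m\<bar> * (norm (b m))\<^sup>2 \<le> inverse \<bar>of_int m\<bar> * (norm (b1 m))\<^sup>2 + inverse \<bar>of_int m\<bar> * (norm (b2 m))\<^sup>2" for m
    unfolding distrib_left[symmetric] by (intro mult_left_mono bb) auto
  have bsum: "(\<lambda>m::int. inverse \<bar>of_int m\<bar> * (norm (b m))\<^sup>2) summable_on -{0}"
    by (rule summable_on_comparison_test[OF bs le]) auto
  have "(\<Sum>\<^sub>\<infinity>m\<in>-{0}. inverse \<bar>of_int m\<bar> * (norm (b m))\<^sup>2) \<le> Q1 + Q2"
    unfolding Q1_def Q2_def infsum_add[OF b1(1) b2(1), symmetric] by (rule infsum_mono[OF bsum bs le])
  also have "\<dots> = (sqrt Q1)\<^sup>2 + (sqrt Q2)\<^sup>2" using Q by simp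
  also have "\<dots> \<le> (sqrt Q1 + sqrt Q2)\<^sup>2" using Q by (simp add: power2_sum del: real_sqrt_pow2)
  finally have bQ: "(\<Sum>\<^sub>\<infinity>m\<in>-{0}. inverse \<bar>of_int m\<bar> * (norm (b m))\<^sup>2) \<le> (sqrt Q1 + sqrt Q2)\<^sup>2" .
  have "(\<Sum>n<N. pi * (norm (c n))\<^sup>2 / real (Suc n)) \<le> (C * (L1_norm circle g + (sqrt Q1 + sqrt Q2)))\<^sup>2"
  proof (rule bergman_bound[OF gi bsum])
    show "b 0 = 0" using b1 b2 by (simp add: b_def)
    show "fourier_coeff (dist_of g) m + b m = half_line_coeff c m" for m
      unfolding eq[symmetric] gc b_def by (simp add: field_simps)
  qed (use Q bQ in auto)
  also have "\<dots> \<le> (C * (L1_norm circle g1 + sqrt Q1 + (L1_norm circle g2 + sqrt Q2)))\<^sup>2"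
  proof (intro power_mono mult_left_mono)
    have "L1_norm circle g \<le> (LINT x|circle. (1/2) * norm (g1 x) + (1/2) * norm (g2 x))"
      unfolding L1_norm_def
    proof (rule integral_mono)
      show "norm (g x) \<le> (1/2) * norm (g1 x) + (1/2) * norm (g2 x)" for x
        unfolding g_def by (rule order_trans[OF norm_triangle_ineq]) (simp add: norm_mult \<kappa>)
    qed (use gi g in auto)
    also have "\<dots> = (1/2) * L1_norm circle g1 + (1/2) * L1_norm circle g2"
      using g by (simp add: L1_norm_def)
    also have "\<dots> \<le> L1_norm circle g1 + L1_norm circle g2"
      using L1_norm_nonneg[of circle g1] L1_norm_nonneg[of circle g2] by linarith
    finally show "L1_norm circle g + (sqrt Q1 + sqrt Q2) \<le> L1_norm circle g1 + sqrt Q1 + (L1_norm circle g2 + sqrt Q2)" by simp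
    show "0 \<le> C * (L1_norm circle g + (sqrt Q1 + sqrt Q2))"
      using C Q by (auto intro!: mult_nonneg_nonneg add_nonneg_nonneg simp: L1_norm_def)
  qed (use C in auto)
  finally show ?thesis by (simp add: Q1_def Q2_def)
qed

end

text \<open>Complex conjugation sends the coefficient at m to the conjugate of the one at -m, and
  the weight is even. Needed for the negative half line.\<close>

lemma Hdot_norm_reflect:
  "(\<Sum>\<^sub>\<infinity>m::int\<in>-{0}. inverse \<bar>of_int m\<bar> * (norm (cnj (fourier_coeff h (- m))))\<^sup>2) =
   (\<Sum>\<^sub>\<infinity>m::int\<in>-{0}. inverse \<bar>of_int m\<bar> * (norm (fourier_coeff h m))\<^sup>2)"
  by (rule infsum_reindex_bij_witness[of _ uminus uminus]) auto

lemma Hdot_summable_reflect: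
  assumes "(\<lambda>m::int. inverse \<bar>of_int m\<bar> * (norm (fourier_coeff h m))\<^sup>2) summable_on -{0}"
  shows "(\<lambda>m::int. inverse \<bar>of_int m\<bar> * (norm (cnj (fourier_coeff h (- m))))\<^sup>2) summable_on -{0}"
  by (rule summable_on_reindex_bij_witness[of _ uminus uminus, THEN iffD2, OF _ _ _ _ _ assms]) auto

lemma decomposition_coeff:
  assumes "(g, h) \<in> decompositions X v"
  shows "fourier_coeff v m = fourier_coeff (dist_of g) m + fourier_coeff h m"
  using assms fourier_coeff_cong[of v "\<lambda>\<phi>. dist_of g \<phi> + h \<phi>"] by (simp add: decompositions_def fourier_coeff_add)

text \<open>On each half line \<open>bergman_bound_pair\<close> bounds the coefficients of the
  quarter Laplacian of u; the Bergman weight 1/(n+1) cancels their factor |m| up to 2, leaving a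
  plain sum of squares.\<close>

lemma bergman_imp_coeff_bound:
  assumes C: "C > 0"
    and A: "\<And>f. f holomorphic_on ball 0 1 \<Longrightarrow> L2_norm disc f \<le> ennreal C * boundary_norm f"
    and d1: "(g1, h1) \<in> decompositions Hdot_space (quarter_laplacian u)"
    and d2: "(g2, h2) \<in> decompositions Hdot_space (riesz_transform (quarter_laplacian u))"
  shows "(\<lambda>m. (norm (if m = 0 then 0 else fourier_coeff u m))\<^sup>2) summable_on UNIV"
    and "2 * pi * (\<Sum>\<^sub>\<infinity>m\<in>UNIV. (norm (if m = 0 then 0 else fourier_coeff u m))\<^sup>2) \<le>
      (3 * C * (L1_norm circle g1 + Hdot_norm h1 + (L1_norm circle g2 + Hdot_norm h2)))\<^sup>2"
proof -
  define S where "S = L1_norm circle g1 + Hdot_norm h1 + (L1_norm circle g2 + Hdot_norm h2)"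
  have g: "integrable circle g1" "integrable circle g2" and h: "h1 \<in> Hdot_space" "h2 \<in> Hdot_space"
    using d1 d2 by (auto simp: decompositions_def L1_def)
  define v where "v = (\<lambda>m::int. of_real (\<bar>of_int m\<bar> powr (1/2)) * fourier_coeff u m)"
  have v1: "fourier_coeff (dist_of g1) m + fourier_coeff h1 m = v m" for m
    using decomposition_coeff[OF d1, of m] by (simp add: fourier_coeff_quarter_laplacian v_def)
  have v2: "fourier_coeff (dist_of g2) m + fourier_coeff h2 m = \<i> * of_int (sgn m) * v m" for m
    using decomposition_coeff[OF d2, of m]
    by (simp add: fourier_coeff_riesz_transform fourier_coeff_quarter_laplacian v_def)
  note H1 = Hdot_space_coeff[OF h(1)] and H2 = Hdot_space_coeff[OF h(2)]
  have half: "(\<Sum>n=1..<N. (norm (fourier_coeff u (s * int n)))\<^sup>2) \<le> 2 / pi * (C * S)\<^sup>2"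
    if s: "s = 1 \<or> s = -1" for s N
  proof -
    have *: "\<exists>c::nat \<Rightarrow> complex. (\<Sum>n<N. pi * (norm (c n))\<^sup>2 / real (Suc n)) \<le> (C * S)\<^sup>2 \<and> (\<forall>n. norm (c n) = norm (v (s * int n)))"
      using s
    proof
      assume s: "s = 1"
      have "(\<Sum>n<N. pi * (norm (v (int n)))\<^sup>2 / real (Suc n)) \<le> (C * S)\<^sup>2"
        unfolding S_def Hdot_norm_def
      \<comment> \<open>The combination is (1 + sgn m) v(m) / 2: it equals v(m) for m > 0 and 0 for
        m < 0, and at m = 0 both sides vanish since v(0) = 0.\<close>
      proof (rule bergman_bound_pair[OF C A g, where \<kappa> = "- \<i>" and ?b1.0 = "fourier_coeff h1" and ?b2.0 = "fourier_coeff h2" and c = "\<lambda>n. v (int n)"])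
        show "(fourier_coeff (dist_of g1) m + fourier_coeff h1 m + - \<i> * (fourier_coeff (dist_of g2) m + fourier_coeff h2 m)) / 2
          = half_line_coeff (\<lambda>n. v (int n)) m" for m
          unfolding v1 v2 by (auto simp: half_line_coeff_def sgn_if v_def)
      qed (use H1 H2 in auto)
      then show ?thesis using s by (intro exI[of _ "\<lambda>n. v (int n)"]) simp
    next
      assume s: "s = -1"
      have L: "L1_norm circle (\<lambda>x. cnj (g x)) = L1_norm circle g" for g by (simp add: L1_norm_def)
      have "(\<Sum>n<N. pi * (norm (cnj (v (- int n))))\<^sup>2 / real (Suc n)) \<le>
       (C * (L1_norm circle (\<lambda>x. cnj (g1 x)) + sqrt (\<Sum>\<^sub>\<infinity>m\<in>-{0}. inverse \<bar>of_int m\<bar> * (norm (cnj (fourier_coeff h1 (- m))))\<^sup>2) +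
       (L1_norm circle (\<lambda>x. cnj (g2 x)) + sqrt (\<Sum>\<^sub>\<infinity>m\<in>-{0}. inverse \<bar>of_int m\<bar> * (norm (cnj (fourier_coeff h2 (- m))))\<^sup>2))))\<^sup>2"
      \<comment> \<open>The conjugated data are again related by the Riesz transform, since the
        conjugate of \<i> sgn(-m) is \<i> sgn m; hence the same \<kappa> works.\<close>
      proof (rule bergman_bound_pair[OF C A, where \<kappa> = "- \<i>" and ?b1.0 = "\<lambda>m. cnj (fourier_coeff h1 (- m))" and ?b2.0 = "\<lambda>m. cnj (fourier_coeff h2 (- m))" and c = "\<lambda>n. cnj (v (- int n))"])
        fix m
        have "(fourier_coeff (dist_of (\<lambda>x. cnj (g1 x))) m + cnj (fourier_coeff h1 (- m)) + - \<i> * (fourier_coeff (dist_of (\<lambda>x. cnj (g2 x))) m + cnj (fourier_coeff h2 (- m)))) / 2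
          = (cnj (v (- m)) + - \<i> * cnj (\<i> * of_int (sgn (- m)) * v (- m))) / 2"
          unfolding fourier_coeff_dist_of_cnj complex_cnj_add[symmetric] v1 v2 ..
        also have "\<dots> = half_line_coeff (\<lambda>n. cnj (v (- int n))) m"
          by (auto simp: half_line_coeff_def sgn_if v_def)
        finally show "(fourier_coeff (dist_of (\<lambda>x. cnj (g1 x))) m + cnj (fourier_coeff h1 (- m)) + - \<i> * (fourier_coeff (dist_of (\<lambda>x. cnj (g2 x))) m + cnj (fourier_coeff h2 (- m)))) / 2
          = half_line_coeff (\<lambda>n. cnj (v (- int n))) m" .
      qed (use g H1 H2 Hdot_summable_reflect in auto)
      then have "(\<Sum>n<N. pi * (norm (cnj (v (- int n))))\<^sup>2 / real (Suc n)) \<le> (C * S)\<^sup>2"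
        unfolding L Hdot_norm_reflect S_def Hdot_norm_def .
      then show ?thesis using s by (intro exI[of _ "\<lambda>n. cnj (v (- int n))"]) simp
    qed
    then obtain c :: "nat \<Rightarrow> complex" where "(\<Sum>n<N. pi * (norm (c n))\<^sup>2 / real (Suc n)) \<le> (C * S)\<^sup>2"
      and c: "\<forall>n. norm (c n) = norm (v (s * int n))" by blast
    then have le: "(\<Sum>n<N. pi * (norm (v (s * int n)))\<^sup>2 / real (Suc n)) \<le> (C * S)\<^sup>2"
      by (simp only: c[rule_format])
    have "(\<Sum>n=1..<N. pi / 2 * (norm (fourier_coeff u (s * int n)))\<^sup>2) \<le> (\<Sum>n=1..<N. pi * (norm (v (s * int n)))\<^sup>2 / real (Suc n))"
    proof (rule sum_mono)
      fix n assume n: "n \<in> {1..<N}"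
      have "\<bar>s * int n\<bar> = int n" using s by auto
      then have "(norm (v (s * int n)))\<^sup>2 = real n * (norm (fourier_coeff u (s * int n)))\<^sup>2"
        using power2_powr_half[of "s * int n"] n s by (auto simp: v_def norm_mult power_mult_distrib)
      \<comment> \<open>The index 0 was dropped for this: n/(n+1) \<ge> 1/2 requires n \<ge> 1. The
        loss is the factor 2 in 2/pi.\<close>
      moreover have "1 / 2 \<le> real n / real (Suc n)" using n by (simp add: field_simps)
      ultimately show "pi / 2 * (norm (fourier_coeff u (s * int n)))\<^sup>2 \<le> pi * (norm (v (s * int n)))\<^sup>2 / real (Suc n)"
        using mult_right_mono[of "1/2" "real n / real (Suc n)" "pi * (norm (fourier_coeff u (s * int n)))\<^sup>2"]
        by (simp add: mult_ac)
    qed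
    also have "\<dots> \<le> (\<Sum>n<N. pi * (norm (v (s * int n)))\<^sup>2 / real (Suc n))"
      by (intro sum_mono2) auto
    also note le
    finally show ?thesis unfolding sum_distrib_left[symmetric] by (simp add: field_simps)
  qed
  define c where "c = (\<lambda>m. if m = 0 then 0 else fourier_coeff u m)"
  have fin: "(\<Sum>m\<in>F. (norm (c m))\<^sup>2) \<le> 4 / pi * (C * S)\<^sup>2" if F: "finite F" for F
  proof -
    \<comment> \<open>The ranges {1..<N} are half-open, so N must exceed every |m| with m in
      F.\<close>
    define N where "N = nat (Max (insert 0 (abs ` F))) + 1"
    have "F \<subseteq> insert 0 ((\<lambda>n. 1 * int n) ` {1..<N} \<union> (\<lambda>n. -1 * int n) ` {1..<N})"
    proof
      fix m assume "m \<in> F"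
      then have "\<bar>m\<bar> \<le> Max (insert 0 (abs ` F))" "0 \<le> Max (insert 0 (abs ` F))" using F by (auto intro!: Max_ge)
      then have "nat \<bar>m\<bar> < N" by (auto simp: N_def)
      then show "m \<in> insert 0 ((\<lambda>n. 1 * int n) ` {1..<N} \<union> (\<lambda>n. -1 * int n) ` {1..<N})"
        by (cases "m \<ge> 0") (auto intro!: image_eqI[of _ _ "nat \<bar>m\<bar>"])
    qed
    then have "(\<Sum>m\<in>F. (norm (c m))\<^sup>2) \<le> (\<Sum>m\<in>insert 0 ((\<lambda>n. 1 * int n) ` {1..<N} \<union> (\<lambda>n. -1 * int n) ` {1..<N}). (norm (c m))\<^sup>2)"
      by (intro sum_mono2) auto
    also have "\<dots> = (\<Sum>m\<in>(\<lambda>n. 1 * int n) ` {1..<N}. (norm (c m))\<^sup>2) + (\<Sum>m\<in>(\<lambda>n. -1 * int n) ` {1..<N}. (norm (c m))\<^sup>2)"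
      by (subst sum.insert, simp, force, subst sum.union_disjoint) (auto simp: c_def)
    also have "\<dots> = (\<Sum>n=1..<N. (norm (fourier_coeff u (1 * int n)))\<^sup>2) + (\<Sum>n=1..<N. (norm (fourier_coeff u (-1 * int n)))\<^sup>2)"
      by (subst (1 2) sum.reindex) (auto simp: c_def inj_on_def)
    also have "\<dots> \<le> 2 / pi * (C * S)\<^sup>2 + 2 / pi * (C * S)\<^sup>2"
      by (intro add_mono half) auto
    finally show ?thesis by simp
  qed
  show sm: "(\<lambda>m. (norm (if m = 0 then 0 else fourier_coeff u m))\<^sup>2) summable_on UNIV"
    unfolding c_def[THEN fun_cong, symmetric]
    by (rule nonneg_bounded_partial_sums_imp_summable_on[where C = "4 / pi * (C * S)\<^sup>2"],
        simp, rule eventually_finite_subsets_at_top_weakI, rule fin)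
  have "(\<Sum>\<^sub>\<infinity>m\<in>UNIV. (norm (if m = 0 then 0 else fourier_coeff u m))\<^sup>2) \<le> 4 / pi * (C * S)\<^sup>2"
    by (rule infsum_le_finite_sums[OF sm]) (use fin in \<open>simp add: c_def\<close>)
  then have "2 * pi * (\<Sum>\<^sub>\<infinity>m\<in>UNIV. (norm (if m = 0 then 0 else fourier_coeff u m))\<^sup>2) \<le> 2 * pi * (4 / pi * (C * S)\<^sup>2)"
    by (intro mult_left_mono) auto
  \<comment> \<open>The two half lines give 2 pi * 4/pi = 8 \<le> 9, the origin of the constant 3
    C.\<close>
  also have "\<dots> \<le> (3 * C * S)\<^sup>2" by (simp add: power_mult_distrib)
  finally show "2 * pi * (\<Sum>\<^sub>\<infinity>m\<in>UNIV. (norm (if m = 0 then 0 else fourier_coeff u m))\<^sup>2) \<le>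
      (3 * C * (L1_norm circle g1 + Hdot_norm h1 + (L1_norm circle g2 + Hdot_norm h2)))\<^sup>2"
    by (simp add: S_def)
qed

text \<open>The two infima run independently, so nearly optimal p and q are chosen separately, each
  within d; the total excess 2 C d is e.\<close>

lemma ennreal_le_mult_add_INF:
  fixes f :: "'a \<Rightarrow> real" and k :: "'b \<Rightarrow> real"
  assumes "P \<noteq> {}" "Q \<noteq> {}" "C > 0"
    and nonneg: "\<And>p. p \<in> P \<Longrightarrow> 0 \<le> f p" "\<And>q. q \<in> Q \<Longrightarrow> 0 \<le> k q"
    and le: "\<And>p q. p \<in> P \<Longrightarrow> q \<in> Q \<Longrightarrow> X \<le> ennreal (C * (f p + k q))"
  shows "X \<le> ennreal C * ((INF p\<in>P. ennreal (f p)) + (INF q\<in>Q. ennreal (k q)))"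
proof (rule ennreal_le_epsilon)
  let ?I = "INF p\<in>P. ennreal (f p)" and ?J = "INF q\<in>Q. ennreal (k q)"
  fix e :: real assume e: "0 < e"
  define d where "d = e / (2 * C)"
  have d: "d > 0" using e \<open>C > 0\<close> by (simp add: d_def)
  have top: "?I < top" "?J < top"
    using assms(1,2) by (auto simp: INF_less_iff)
  then have "?I < ?I + ennreal d" "?J < ?J + ennreal d" using d by (auto simp: ennreal_add_left_cancel_less)
  then obtain p q where p: "p \<in> P" "ennreal (f p) < ?I + ennreal d" and q: "q \<in> Q" "ennreal (k q) < ?J + ennreal d"
    unfolding INF_less_iff by blast
  have "X \<le> ennreal (C * (f p + k q))" by (rule le[OF p(1) q(1)])
  also have "\<dots> = ennreal C * (ennreal (f p) + ennreal (k q))"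
    using nonneg(1)[OF p(1)] nonneg(2)[OF q(1)] \<open>C > 0\<close> by (simp add: ennreal_mult)
  also have "\<dots> \<le> ennreal C * ((?I + ennreal d) + (?J + ennreal d))"
    using p q by (intro mult_left_mono add_mono) auto
  also have "\<dots> = ennreal C * (?I + ?J) + ennreal C * (ennreal d + ennreal d)"
    by (simp add: algebra_simps)
  also have "ennreal C * (ennreal d + ennreal d) = ennreal e"
    using d \<open>C > 0\<close> by (simp add: d_def ennreal_mult[symmetric] ennreal_plus[symmetric] del: ennreal_plus)
  finally show "X \<le> ennreal C * (?I + ?J) + ennreal e" .
qed

lemma assertion_A_imp_B:
  assumes assertion_A shows assertion_B
proof -
  obtain C where C: "C > 0" and A: "\<And>f. f holomorphic_on ball 0 1 \<Longrightarrow> L2_norm disc f \<le> ennreal C * boundary_norm f"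
    using assms unfolding assertion_A_def by blast
  show ?thesis unfolding assertion_B_def
  proof (intro exI[of _ "3 * C"] conjI ballI impI)
    show "0 < 3 * C" using C by simp
    fix u assume u: "u \<in> distributions"
    assume "quarter_laplacian u \<in> L1_plus Hdot_space \<and> riesz_transform (quarter_laplacian u) \<in> L1_plus Hdot_space"
    then have ne: "decompositions Hdot_space (quarter_laplacian u) \<noteq> {}"
      "decompositions Hdot_space (riesz_transform (quarter_laplacian u)) \<noteq> {}" by (auto simp: L1_plus_def)
    note bound = bergman_imp_coeff_bound[OF C A, of _ _ u]
    define c where "c = (\<lambda>m. if m = 0 then 0 else fourier_coeff u m)"
    have "(\<lambda>m. (norm (c m))\<^sup>2) summable_on UNIV" using bound(1) ne unfolding c_def by fast
    \<comment> \<open>w depends on u alone and is fixed before the decompositions vary, so the same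
      w satisfies the bound for all of them and hence for the infima.\<close>
    then obtain w where w: "w \<in> L2 circle" "\<And>m. fourier_coeff (dist_of w) m = c m"
      and wn: "(LINT x|circle. (norm (w x))\<^sup>2) \<le> 2 * pi * (\<Sum>\<^sub>\<infinity>m\<in>UNIV. (norm (c m))\<^sup>2)"
      using riesz_fischer by blast
    have "L2_norm circle w \<le> ennreal (3 * C * ((case p of (g, h) \<Rightarrow> L1_norm circle g + Hdot_norm h) + (case q of (g, h) \<Rightarrow> L1_norm circle g + Hdot_norm h)))"
      if p: "p \<in> decompositions Hdot_space (quarter_laplacian u)"
        and q: "q \<in> decompositions Hdot_space (riesz_transform (quarter_laplacian u))" for p q
    proof -
      obtain g1 h1 g2 h2 where pq: "p = (g1, h1)" "q = (g2, h2)" by fastforce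
      have "(LINT x|circle. (norm (w x))\<^sup>2) \<le> (3 * C * (L1_norm circle g1 + Hdot_norm h1 + (L1_norm circle g2 + Hdot_norm h2)))\<^sup>2"
        using wn bound(2)[OF _ p[unfolded pq] q[unfolded pq]] unfolding c_def by linarith
      then have "sqrt (LINT x|circle. (norm (w x))\<^sup>2) \<le> 3 * C * (L1_norm circle g1 + Hdot_norm h1 + (L1_norm circle g2 + Hdot_norm h2))"
        using C by (intro real_le_lsqrt) (auto intro!: mult_nonneg_nonneg add_nonneg_nonneg Hdot_norm_nonneg L1_norm_nonneg)
      then show ?thesis using w(1) by (simp add: L2_norm_def pq ennreal_leI)
    qed
    then have "L2_norm circle w \<le> ennreal (3 * C) *
       ((INF p\<in>decompositions Hdot_space (quarter_laplacian u). ennreal (case p of (g, h) \<Rightarrow> L1_norm circle g + Hdot_norm h)) +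
        (INF q\<in>decompositions Hdot_space (riesz_transform (quarter_laplacian u)). ennreal (case q of (g, h) \<Rightarrow> L1_norm circle g + Hdot_norm h)))"
      using C by (intro ennreal_le_mult_add_INF ne) (auto intro!: add_nonneg_nonneg Hdot_norm_nonneg L1_norm_nonneg)
    then have L2: "L2_norm circle w \<le> ennreal (3 * C) * (L1_plus_norm Hdot_space Hdot_norm (quarter_laplacian u) +
           L1_plus_norm Hdot_space Hdot_norm (riesz_transform (quarter_laplacian u)))"
      unfolding L1_plus_norm_def by (simp add: case_prod_beta)
    have ci: "integrable circle (\<lambda>\<theta>. mean u)" by (intro integrable_circle_continuous continuous_intros)
    have "dist_eq (\<lambda>\<phi>. u \<phi> - dist_of (\<lambda>\<theta>. mean u) \<phi>) (dist_of w)"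
    proof (rule dist_eqI)
      show "(\<lambda>\<phi>. u \<phi> - dist_of (\<lambda>\<theta>. mean u) \<phi>) \<in> distributions"
        by (intro distribution_diff u dist_of_distribution ci)
      show "dist_of w \<in> distributions" by (intro dist_of_distribution L2_integrable w)
      show "fourier_coeff (\<lambda>\<phi>. u \<phi> - dist_of (\<lambda>\<theta>. mean u) \<phi>) m = fourier_coeff (dist_of w) m" for m
        by (simp add: fourier_coeff_diff fourier_coeff_const w(2) c_def)
    qed
    moreover have "w \<in> L2_star" using w by (simp add: L2_star_def c_def)
    ultimately show "\<exists>w\<in>L2_star. dist_eq (\<lambda>\<phi>. u \<phi> - dist_of (\<lambda>\<theta>. mean u) \<phi>) (dist_of w) \<and>
        L2_norm circle w \<le> ennreal (3 * C) * (L1_plus_norm Hdot_space Hdot_norm (quarter_laplacian u) +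
           L1_plus_norm Hdot_space Hdot_norm (riesz_transform (quarter_laplacian u)))"
      using L2 by blast
  qed
qed

subsection \<open>From the circle to the Bergman space\<close>

text \<open>The circle restriction itself serves as Sobolev part, with zero L^1 part. The weight (1
  + n^2)^(-1/2) is at most 2/(n+1), which matches the Bergman weight.\<close>

lemma bergman_imp_boundary_norm_finite:
  assumes "f \<in> bergman"
  shows "boundary_norm f < \<infinity>"
proof -
  have hol: "f holomorphic_on ball 0 1" and fin: "L2_norm disc f < \<infinity>" using assms by (auto simp: bergman_def)
  obtain a where f: "\<forall>z. norm z < 1 \<longrightarrow> (\<lambda>n. a n * z ^ n) sums f z"
    using holomorphic_power_series_at_0[OF hol] .
  obtain B where B: "0 \<le> B" "L2_norm disc f = ennreal B" using fin by (cases "L2_norm disc f") auto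
  \<comment> \<open>The factor 2 comes from the weight comparison and is absorbed by 2 \<le> pi, so
    the final bound is B itself.\<close>
  define q where "q = (\<lambda>n. 2 * ((norm (a n))\<^sup>2 / real (Suc n)))"
  have q: "summable q" "suminf q \<le> B\<^sup>2"
  proof -
    have le: "(\<Sum>n<N. q n) \<le> B\<^sup>2" for N
    proof -
      have "(\<Sum>n<N. q n) \<le> (\<Sum>n<N. pi * (norm (a n))\<^sup>2 / real (Suc n))"
        unfolding q_def times_divide_eq_right using pi_gt3 by (intro sum_mono divide_right_mono mult_right_mono) auto
      also have "\<dots> \<le> B\<^sup>2" using bergman_coeff_leD[OF hol f, of B N] B by simp
      finally show ?thesis .
    qed
    show "summable q" by (rule summableI_nonneg_bounded[OF _ le]) (simp add: q_def)
    then show "suminf q \<le> B\<^sup>2" by (rule suminf_le_const) (rule le)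
  qed
  have "L1_plus_norm H_space H_norm (dist_of (\<lambda>\<theta>. f (of_real r * cis \<theta>))) \<le> ennreal B"
    if r: "0 < r" "r < 1" for r
  proof -
    have r0: "0 \<le> r" using r by simp
    note F = circle_restriction[OF f r0 r(2)]
    define c where "c = (\<lambda>m. poisson_coeff r m * half_line_coeff a m)"
    have Fs: "(\<lambda>m. norm (c m)) summable_on UNIV" using F(1) by (simp add: c_def)
    define k where "k = (\<lambda>m. (1 + \<bar>real_of_int m\<bar>\<^sup>2) powr (-1/2) * (norm (c m))\<^sup>2)"
    have kq: "k (int n) \<le> q n" for n
    proof -
      have "(norm (c (int n)))\<^sup>2 \<le> (norm (a n))\<^sup>2"
      proof (rule power_mono)
        have "r ^ n * norm (a n) \<le> 1 * norm (a n)"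
          using r by (intro mult_right_mono power_le_one) auto
        then show "norm (c (int n)) \<le> norm (a n)"
          using r by (simp add: c_def half_line_coeff_def poisson_coeff_def norm_mult norm_power)
      qed simp
      moreover have "(1 + \<bar>real_of_int (int n)\<bar>\<^sup>2) powr (-1/2) \<le> 2 * inverse (real (Suc n))"
      proof -
        have "(real (Suc n))\<^sup>2 \<le> 2\<^sup>2 * (1 + (real n)\<^sup>2)"
          using zero_le_power2[of "real n - 1"] zero_le_power2[of "real n"] unfolding of_nat_Suc power2_sum power2_diff by simp
        then have "real (Suc n) \<le> sqrt (2\<^sup>2 * (1 + (real n)\<^sup>2))" by (rule real_le_rsqrt)
        also have "\<dots> = 2 * sqrt (1 + (real n)\<^sup>2)" unfolding real_sqrt_mult by simp
        finally have "inverse (2 * sqrt (1 + (real n)\<^sup>2)) \<le> inverse (real (Suc n))"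
          by (intro le_imp_inverse_le) auto
        then show ?thesis by (simp add: powr_minus powr_half_sqrt add_nonneg_nonneg)
      qed
      ultimately have "k (int n) \<le> (2 * inverse (real (Suc n))) * (norm (a n))\<^sup>2"
        unfolding k_def by (intro mult_mono) auto
      then show ?thesis by (simp add: q_def divide_inverse mult_ac)
    qed
    have k0: "k m = 0" if "m < 0" for m using that by (simp add: k_def c_def half_line_coeff_def)
    have kn: "summable (\<lambda>n. k (int n))"
      by (rule summable_comparison_test'[OF q(1), where N = 0]) (use kq in \<open>simp add: k_def\<close>)
    then have "((\<lambda>n. k (int n)) has_sum (\<Sum>n. k (int n))) UNIV"
      by (intro norm_summable_imp_has_sum summable_sums) (simp_all add: k_def)
    then have ks: "(k has_sum (\<Sum>n. k (int n))) UNIV" using has_sum_half_line[of k] k0 by blast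
    have "(\<Sum>n. k (int n)) \<le> B\<^sup>2" using suminf_le[OF kq kn q(1)] q(2) by linarith
    moreover have "H_norm (dist_of (fourier_series c)) = sqrt (\<Sum>n. k (int n))"
      using H_norm_fourier_series[OF Fs] infsumI[OF ks] by (simp add: k_def)
    ultimately have "H_norm (dist_of (fourier_series c)) \<le> B"
      using B(1) real_le_lsqrt by simp
    moreover have "dist_of (fourier_series c) \<in> H_space"
      using H_spaceI[OF Fs] has_sum_imp_summable[OF ks] by (simp add: k_def)
    then have "((\<lambda>_. 0), dist_of (fourier_series c)) \<in> decompositions H_space (dist_of (\<lambda>\<theta>. f (of_real r * cis \<theta>)))"
      unfolding F(2) c_def[symmetric] by (simp add: decompositions_def L1_def dist_eq_def dist_of_def)
    then have "L1_plus_norm H_space H_norm (dist_of (\<lambda>\<theta>. f (of_real r * cis \<theta>)))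
      \<le> (case ((\<lambda>_. 0), dist_of (fourier_series c)) of (g, h) \<Rightarrow> ennreal (L1_norm circle g + H_norm h))"
      unfolding L1_plus_norm_def by (rule INF_lower)
    ultimately show ?thesis
      by (simp add: L1_norm_def) (meson ennreal_leI order_trans)
  qed
  then have "boundary_norm f \<le> ennreal B"
    unfolding boundary_norm_def
    by (intro Limsup_bounded eventually_at_leftI[of 0]) auto
  then show ?thesis using le_less_trans by fastforce
qed

text \<open>Termwise integration against the test function. It shows below that the multipliers
  applied to u yield distributions.\<close>

lemma multiplier_fourier_series:
  assumes "(\<lambda>m. norm (e m)) summable_on UNIV" "\<And>m. \<mu> m * fourier_coeff u m = e m"
  shows "dist_eq (fourier_multiplier \<mu> u) (dist_of (fourier_series e))"
  unfolding dist_eq_def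
proof
  fix \<phi> assume t: "\<phi> \<in> test_functions"
  then have "integrable circle \<phi>" by (intro integrable_circle_continuous test_continuous)
  from has_sum_integral_fourier_series[OF assms(1) this]
  show "fourier_multiplier \<mu> u \<phi> = dist_of (fourier_series e) \<phi>"
    unfolding fourier_multiplier_def dist_of_def assms(2) by (rule infsumI)
qed

text \<open>Removing the mean moves a decomposition in \<open>L\<^sup>1 + H\<^sup>-\<^sup>1\<^sup>/\<^sup>2\<close> to one in the homogeneous sum space.\<close>

lemma homogeneous_decomposition:
  assumes g: "g \<in> L1 circle" and h: "h \<in> H_space" and v: "v \<in> distributions" and \<kappa>: "norm \<kappa> = 1"
    and eq: "\<And>m. fourier_coeff v m = (if m = 0 then 0 else \<kappa> * (fourier_coeff (dist_of g) m + fourier_coeff h m))"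
  shows "v \<in> L1_plus Hdot_space"
    and "L1_plus_norm Hdot_space Hdot_norm v \<le> ennreal (2 * (L1_norm circle g + H_norm h))"
proof -
  have gi: "integrable circle g" using g by (simp add: L1_def)
  have hd: "h \<in> distributions" and hs: "(\<lambda>k::int. (1 + \<bar>of_int k\<bar>\<^sup>2) powr (-1/2) * (norm (fourier_coeff h k))\<^sup>2) summable_on UNIV"
    using h by (auto simp: H_space_def)
  \<comment> \<open>Homogeneous spaces have no zero mode, so the mean is taken out of each part
    separately. For g this costs 2 pi |c| \<le> \<open>L1_norm circle g\<close>, whence the factor
    2.\<close>
  define c where "c = fourier_coeff (dist_of g) 0"
  define g' where "g' = (\<lambda>x. \<kappa> * (g x + (-1) * c))"
  define h' where "h' = (\<lambda>\<phi>. \<kappa> * (h \<phi> - dist_of (\<lambda>_. fourier_coeff h 0) \<phi>))"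
  have const: "integrable circle (\<lambda>_. z)" for z :: complex by (intro integrable_circle_continuous continuous_intros)
  have g'i: "integrable circle g'" unfolding g'_def using gi const by simp
  have g'c: "fourier_coeff (dist_of g') m = \<kappa> * (if m = 0 then 0 else fourier_coeff (dist_of g) m)" for m
  proof -
    have "fourier_coeff (dist_of g') m = \<kappa> * fourier_coeff (dist_of (\<lambda>x. g x + (-1) * c)) m"
      unfolding g'_def fourier_coeff_dist_of mult.assoc integral_mult_right_zero by simp
    also have "fourier_coeff (dist_of (\<lambda>x. g x + (-1) * c)) m = fourier_coeff (dist_of g) m + (-1) * fourier_coeff (dist_of (\<lambda>_. c)) m"
      by (rule fourier_coeff_dist_of_add_scale[OF gi const])
    finally show ?thesis by (simp add: fourier_coeff_const c_def)
  qed
  have h'd: "h' \<in> distributions"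
    unfolding h'_def by (intro distribution_cmult distribution_diff hd dist_of_distribution const)
  have h'c: "fourier_coeff h' m = \<kappa> * (if m = 0 then 0 else fourier_coeff h m)" for m
    unfolding h'_def fourier_coeff_cmult fourier_coeff_diff fourier_coeff_const by simp
  have w: "inverse \<bar>real_of_int m\<bar> * (norm (fourier_coeff h' m))\<^sup>2 \<le> 2 * ((1 + \<bar>of_int m\<bar>\<^sup>2) powr (-1/2) * (norm (fourier_coeff h m))\<^sup>2)"
    if "m \<in> -{0}" for m
    using mult_right_mono[OF H_weight_ge[of m], of "(norm (fourier_coeff h m))\<^sup>2"] that
    by (simp add: h'c norm_mult \<kappa> mult.assoc)
  have hs2: "(\<lambda>k::int. 2 * ((1 + \<bar>of_int k\<bar>\<^sup>2) powr (-1/2) * (norm (fourier_coeff h k))\<^sup>2)) summable_on UNIV"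
    by (rule summable_on_cmult_right[OF hs])
  have h's: "(\<lambda>m::int. inverse \<bar>of_int m\<bar> * (norm (fourier_coeff h' m))\<^sup>2) summable_on -{0}"
    by (rule summable_on_comparison_test[OF summable_on_subset[OF hs2] w]) auto
  have h'H: "h' \<in> Hdot_space" by (rule Hdot_spaceI[OF h'd _ h's]) (simp add: h'c)
  have "dist_eq v (\<lambda>\<phi>. dist_of g' \<phi> + h' \<phi>)"
  proof (rule dist_eqI[OF v])
    show "(\<lambda>\<phi>. dist_of g' \<phi> + h' \<phi>) \<in> distributions"
      using distribution_add_scale[OF dist_of_distribution[OF g'i] h'd, of 1] by simp
    show "fourier_coeff v m = fourier_coeff (\<lambda>\<phi>. dist_of g' \<phi> + h' \<phi>) m" for m
      unfolding fourier_coeff_add g'c h'c eq by (simp add: algebra_simps)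
  qed
  then have dec: "(g', h') \<in> decompositions Hdot_space v"
    using g'i h'H by (simp add: decompositions_def L1_def)
  then show "v \<in> L1_plus Hdot_space" using v by (auto simp: L1_plus_def)
  have "L1_norm circle g' \<le> 2 * L1_norm circle g"
  proof -
    have "L1_norm circle g' \<le> (LINT x|circle. norm (g x) + norm c)"
      unfolding L1_norm_def
    proof (rule integral_mono)
      show "norm (g' x) \<le> norm (g x) + norm c" for x
        using norm_triangle_ineq4[of "g x" c] by (simp add: g'_def norm_mult \<kappa>)
    qed (use g'i gi in auto)
    also have "\<dots> = L1_norm circle g + 2 * pi * norm c"
      using gi emeasure_circle by (simp add: L1_norm_def measure_def)
    also have "2 * pi * norm c \<le> L1_norm circle g"
      using norm_fourier_coeff_le[OF gi, of 0] by (simp add: c_def field_simps)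
    finally show ?thesis by simp
  qed
  moreover have "Hdot_norm h' \<le> 2 * H_norm h"
  proof -
    have "(\<Sum>\<^sub>\<infinity>m\<in>-{0}. inverse \<bar>of_int m\<bar> * (norm (fourier_coeff h' m))\<^sup>2) \<le>
        (\<Sum>\<^sub>\<infinity>k\<in>UNIV. 2 * ((1 + \<bar>of_int k\<bar>\<^sup>2) powr (-1/2) * (norm (fourier_coeff h k))\<^sup>2))"
      by (rule infsum_mono_neutral[OF h's hs2]) (use w in auto)
    also have "\<dots> = 2 * (H_norm h)\<^sup>2"
      unfolding H_norm_def infsum_cmult_right' by (subst real_sqrt_pow2) (auto intro!: infsum_nonneg)
    \<comment> \<open>The weight comparison costs 2 under the square root, generously replaced by 4
      to match the L^1 part.\<close>
    also have "\<dots> \<le> (2 * H_norm h)\<^sup>2" by (simp add: power_mult_distrib)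
    finally show ?thesis unfolding Hdot_norm_def
      by (intro real_le_lsqrt) (auto simp: H_norm_def intro!: infsum_nonneg)
  qed
  ultimately have "ennreal (L1_norm circle g' + Hdot_norm h') \<le> ennreal (2 * (L1_norm circle g + H_norm h))"
    by (intro ennreal_leI) simp
  moreover have "L1_plus_norm Hdot_space Hdot_norm v \<le> (case (g', h') of (g, h) \<Rightarrow> ennreal (L1_norm circle g + Hdot_norm h))"
    unfolding L1_plus_norm_def using dec by (rule INF_lower)
  ultimately show "L1_plus_norm Hdot_space Hdot_norm v \<le> ennreal (2 * (L1_norm circle g + H_norm h))" by simp
qed

lemma H_norm_nonneg: "0 \<le> H_norm h"
  unfolding H_norm_def by (intro real_sqrt_ge_zero infsum_nonneg) auto

text \<open>B is blind to the mean, so the zeroth coefficient is controlled directly by the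
  decomposition; the Sobolev weight at 0 is 1.\<close>

lemma norm_coeff_0_le:
  assumes "g \<in> L1 circle" "h \<in> H_space"
  shows "norm (fourier_coeff (dist_of g) 0 + fourier_coeff h 0) \<le> L1_norm circle g + H_norm h"
proof -
  have "norm (fourier_coeff (dist_of g) 0) \<le> L1_norm circle g / (2 * pi)"
    using assms by (intro norm_fourier_coeff_le) (simp add: L1_def)
  also have "\<dots> \<le> L1_norm circle g / 1"
    using L1_norm_nonneg pi_gt3 by (intro divide_left_mono) auto
  finally have 1: "norm (fourier_coeff (dist_of g) 0) \<le> L1_norm circle g" by simp
  have "(\<Sum>k\<in>{0::int}. (1 + \<bar>of_int k\<bar>\<^sup>2) powr (-1/2) * (norm (fourier_coeff h k))\<^sup>2) \<le>
     (\<Sum>\<^sub>\<infinity>k\<in>UNIV. (1 + \<bar>of_int k\<bar>\<^sup>2) powr (-1/2) * (norm (fourier_coeff h k))\<^sup>2)"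
    using assms by (intro finite_sum_le_infsum) (auto simp: H_space_def)
  then have "norm (fourier_coeff h 0) \<le> H_norm h" unfolding H_norm_def by (intro real_le_rsqrt) simp
  with 1 show ?thesis using norm_triangle_ineq[of "fourier_coeff (dist_of g) 0" "fourier_coeff h 0"] by linarith
qed

context
  fixes C :: real
  assumes C: "C > 0"
    and B: "\<And>u. u \<in> distributions \<Longrightarrow> quarter_laplacian u \<in> L1_plus Hdot_space \<Longrightarrow>
     riesz_transform (quarter_laplacian u) \<in> L1_plus Hdot_space \<Longrightarrow>
     \<exists>w\<in>L2_star. dist_eq (\<lambda>\<phi>. u \<phi> - dist_of (\<lambda>\<theta>. mean u) \<phi>) (dist_of w) \<and>
        L2_norm circle w \<le> ennreal C *
          (L1_plus_norm Hdot_space Hdot_norm (quarter_laplacian u) +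
           L1_plus_norm Hdot_space Hdot_norm (riesz_transform (quarter_laplacian u)))"
begin

text \<open>Both hypotheses of B reduce to the given series without its mean, so one decomposition
  \<open>(g, h)\<close> serves for both. Bessel's inequality then reads the coefficients off
  w.\<close>

lemma circle_coeff_bound:
  assumes s: "(\<lambda>m. norm (half_line_coeff c m)) summable_on UNIV"
    and dec: "(g, h) \<in> decompositions H_space (dist_of (fourier_series (half_line_coeff c)))"
  shows "2 * pi * (\<Sum>n=1..<N. (norm (c n))\<^sup>2 / real n) \<le> (4 * C * (L1_norm circle g + H_norm h))\<^sup>2"
proof -
  define S where "S = L1_norm circle g + H_norm h"
  have S: "0 \<le> S" by (simp add: S_def L1_norm_nonneg H_norm_nonneg)
  have gh: "g \<in> L1 circle" "h \<in> H_space" using dec by (auto simp: decompositions_def)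
  have cc: "fourier_coeff (dist_of g) m + fourier_coeff h m = half_line_coeff c m" for m
    using decomposition_coeff[OF dec, of m] by (simp add: fourier_coeff_fourier_series[OF s])
  define p where "p = (\<lambda>m::int. \<bar>of_int m\<bar> powr (1/2) :: real)"
  \<comment> \<open>Division by \<open>p m\<close> does not increase moduli for m \<noteq> 0 and
    gives 0 at m = 0 (\<open>inverse 0 = 0\<close>), so d remains absolutely summable.\<close>
  define d where "d = (\<lambda>m. of_real (inverse (p m)) * half_line_coeff c m)"
  define e where "e = (\<lambda>m. if m = 0 then 0 else half_line_coeff c m)"
  have p1: "1 \<le> p m" if "m \<noteq> 0" for m
  proof -
    have "1 \<le> \<bar>real_of_int m\<bar>" using that by linarith
    then show ?thesis by (simp add: p_def ge_one_powr_ge_zero)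
  qed
  have ds: "(\<lambda>m. norm (d m)) summable_on UNIV"
  proof (rule summable_on_comparison_test[OF s])
    fix m
    have "inverse (p m) \<le> 1" "0 \<le> inverse (p m)"
      using p1[of m] by (cases "m = 0"; simp add: inverse_le_1_iff p_def)+
    then show "norm (d m) \<le> norm (half_line_coeff c m)"
      unfolding d_def norm_mult by (intro mult_left_le_one_le) (auto simp: norm_inverse)
  qed simp
  have es: "(\<lambda>m. norm (e m)) summable_on UNIV"
    by (rule summable_on_comparison_test[OF s]) (auto simp: e_def)
  then have ies: "(\<lambda>m. norm (\<i> * e m)) summable_on UNIV" by (simp add: norm_mult)
  define u where "u = dist_of (fourier_series d)"
  have uc: "fourier_coeff u m = d m" for m unfolding u_def by (rule fourier_coeff_fourier_series[OF ds])
  have u: "u \<in> distributions" unfolding u_def by (intro dist_of_distribution integrable_fourier_series ds)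
  have pd: "of_real (p m) * d m = e m" for m
    using p1[of m] by (auto simp: d_def e_def p_def simp flip: of_real_mult mult.assoc)
  have Lc: "fourier_coeff (quarter_laplacian u) m = e m" for m
    unfolding fourier_coeff_quarter_laplacian uc using pd by (simp add: p_def)
  \<comment> \<open>e lives on m > 0, where sgn m = 1; the Riesz transform is therefore the scalar
    \<i>, of modulus 1.\<close>
  have Rc: "\<i> * of_int (sgn m) * e m = \<i> * e m" for m
    by (auto simp: e_def half_line_coeff_def sgn_if)
  have "dist_eq (quarter_laplacian u) (dist_of (fourier_series e))"
    unfolding quarter_laplacian_def by (rule multiplier_fourier_series[OF es]) (use pd in \<open>simp add: uc p_def\<close>)
  then have L: "quarter_laplacian u \<in> distributions"
    by (rule distribution_dist_eq) (intro dist_of_distribution integrable_fourier_series es)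
  have "dist_eq (riesz_transform (quarter_laplacian u)) (dist_of (fourier_series (\<lambda>m. \<i> * e m)))"
    unfolding riesz_transform_def by (rule multiplier_fourier_series[OF ies]) (simp add: Lc Rc)
  then have R: "riesz_transform (quarter_laplacian u) \<in> distributions"
    by (rule distribution_dist_eq) (intro dist_of_distribution integrable_fourier_series ies)
  have Le: "fourier_coeff (quarter_laplacian u) m = (if m = 0 then 0 else 1 * (fourier_coeff (dist_of g) m + fourier_coeff h m))" for m
    by (simp add: Lc cc e_def)
  have Re: "fourier_coeff (riesz_transform (quarter_laplacian u)) m = (if m = 0 then 0 else \<i> * (fourier_coeff (dist_of g) m + fourier_coeff h m))" for m
    by (simp add: fourier_coeff_riesz_transform Lc Rc cc) (simp add: e_def)
  note L' = homogeneous_decomposition[OF gh L norm_one Le]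
  note R' = homogeneous_decomposition[OF gh R norm_ii Re]
  obtain w where w: "w \<in> L2_star" "dist_eq (\<lambda>\<phi>. u \<phi> - dist_of (\<lambda>\<theta>. mean u) \<phi>) (dist_of w)"
    and wn: "L2_norm circle w \<le> ennreal C *
          (L1_plus_norm Hdot_space Hdot_norm (quarter_laplacian u) +
           L1_plus_norm Hdot_space Hdot_norm (riesz_transform (quarter_laplacian u)))"
    using B[OF u L'(1) R'(1)] by blast
  note wn
  \<comment> \<open>Each of the two sum-space norms is at most 2 S, which makes 4 C S in
    total.\<close>
  also have "\<dots> \<le> ennreal C * (ennreal (2 * S) + ennreal (2 * S))"
    using L'(2) R'(2) unfolding S_def by (intro mult_left_mono add_mono) auto
  also have "\<dots> = ennreal (4 * C * S)"
    using C S by (simp add: ennreal_plus[symmetric] ennreal_mult[symmetric] del: ennreal_plus)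
  finally have wn: "L2_norm circle w \<le> ennreal (4 * C * S)" .
  have wL: "w \<in> L2 circle" using w by (simp add: L2_star_def)
  then have "sqrt (LINT x|circle. (norm (w x))\<^sup>2) \<le> 4 * C * S"
    using wn C S by (simp add: L2_norm_def ennreal_le_iff)
  then have w2: "(LINT x|circle. (norm (w x))\<^sup>2) \<le> (4 * C * S)\<^sup>2" by (rule sqrt_le_D)
  have "fourier_coeff (dist_of w) m = d m" if "m \<noteq> 0" for m
    using fourier_coeff_cong[OF w(2), of m] that by (simp add: fourier_coeff_diff fourier_coeff_const uc)
  then have "(\<Sum>m\<in>int ` {1..<N}. (norm (fourier_coeff (dist_of w) m))\<^sup>2) = (\<Sum>m\<in>int ` {1..<N}. (norm (d m))\<^sup>2)"
    by (intro sum.cong) auto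
  also have "\<dots> = (\<Sum>n=1..<N. (norm (c n))\<^sup>2 / real n)"
  proof (subst sum.reindex)
    show "sum ((\<lambda>m. (norm (d m))\<^sup>2) \<circ> int) {1..<N} = (\<Sum>n=1..<N. (norm (c n))\<^sup>2 / real n)"
    proof (rule sum.cong)
      fix n assume "n \<in> {1..<N}"
      then have "(p (int n))\<^sup>2 = real n" using power2_powr_half[of "int n"] by (simp add: p_def)
      then show "((\<lambda>m. (norm (d m))\<^sup>2) \<circ> int) n = (norm (c n))\<^sup>2 / real n"
        by (simp add: d_def half_line_coeff_def norm_mult power_mult_distrib norm_inverse power_inverse divide_inverse mult.commute)
    qed simp
  qed simp
  finally show ?thesis using bessel[OF wL, of "int ` {1..<N}"] w2 by (simp add: S_def)
qed

text \<open>A strict bound on the limsup gives, for every r close to 1, a decomposition of size at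
  most b. The resulting coefficient bounds are uniform in r and survive the limit because only
  finite sums are involved.\<close>

lemma boundary_norm_bound:
  assumes hol: "f holomorphic_on ball 0 1" and bd: "boundary_norm f < ennreal b" and "0 \<le> b"
  shows "L2_norm disc f \<le> ennreal ((4 + 4 * C) * b)"
proof -
  obtain a where f: "\<forall>z. norm z < 1 \<longrightarrow> (\<lambda>n. a n * z ^ n) sums f z"
    using holomorphic_power_series_at_0[OF hol] .
  have "\<forall>\<^sub>F r in at_left 1. L1_plus_norm H_space H_norm (dist_of (\<lambda>\<theta>. f (of_real r * cis \<theta>))) < ennreal b"
    using bd unfolding boundary_norm_def by (rule Limsup_lessD)
  moreover have "\<forall>\<^sub>F r in at_left (1::real). 0 < r \<and> r < 1" by (rule eventually_at_leftI[of 0]) auto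
  ultimately have ev: "\<forall>\<^sub>F r in at_left 1. norm (a 0) \<le> b \<and>
     (\<forall>N. 2 * pi * (\<Sum>n=1..<N. (norm (a n) * r ^ n)\<^sup>2 / real n) \<le> (4 * C * b)\<^sup>2)"
  proof eventually_elim
    case (elim r)
    then have r: "0 \<le> r" "r < 1" by auto
    note F = circle_restriction[OF f r, folded half_line_coeff_power]
    obtain g h where gh: "(g, h) \<in> decompositions H_space (dist_of (\<lambda>\<theta>. f (of_real r * cis \<theta>)))"
      and "ennreal (L1_norm circle g + H_norm h) < ennreal b"
      using elim unfolding L1_plus_norm_def INF_less_iff by auto
    then have le: "L1_norm circle g + H_norm h \<le> b" by (meson ennreal_less_iff ennreal_leI leI not_le \<open>0 \<le> b\<close> less_imp_le)
    note dec = gh[unfolded F(2)]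
    have "norm (fourier_coeff (dist_of g) 0 + fourier_coeff h 0) \<le> L1_norm circle g + H_norm h"
      using gh by (intro norm_coeff_0_le) (auto simp: decompositions_def)
    moreover have "fourier_coeff (dist_of g) 0 + fourier_coeff h 0 = a 0"
      using decomposition_coeff[OF dec, of 0] by (simp add: fourier_coeff_fourier_series[OF F(1)] half_line_coeff_def)
    moreover have "2 * pi * (\<Sum>n=1..<N. (norm (a n) * r ^ n)\<^sup>2 / real n) \<le> (4 * C * b)\<^sup>2" for N
    proof -
      have "2 * pi * (\<Sum>n=1..<N. (norm (a n * of_real r ^ n))\<^sup>2 / real n) \<le> (4 * C * (L1_norm circle g + H_norm h))\<^sup>2"
        by (rule circle_coeff_bound[OF F(1) dec])
      also have "\<dots> \<le> (4 * C * b)\<^sup>2"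
        using le C by (intro power_mono mult_left_mono) (auto intro!: mult_nonneg_nonneg add_nonneg_nonneg L1_norm_nonneg H_norm_nonneg)
      finally show ?thesis using r by (simp add: norm_mult norm_power)
    qed
    ultimately show ?case using le by simp
  qed
  have a0: "norm (a 0) \<le> b" using eventually_happens'[OF trivial_limit_at_left_real ev] by blast
  have aN: "2 * pi * (\<Sum>n=1..<N. (norm (a n))\<^sup>2 / real n) \<le> (4 * C * b)\<^sup>2" for N
  proof (rule tendsto_upperbound)
    show "\<forall>\<^sub>F r in at_left 1. 2 * pi * (\<Sum>n=1..<N. (norm (a n) * r ^ n)\<^sup>2 / real n) \<le> (4 * C * b)\<^sup>2"
      using ev by eventually_elim blast
    have "((\<lambda>r::real. 2 * pi * (\<Sum>n=1..<N. (norm (a n) * r ^ n)\<^sup>2 / real n)) \<longlongrightarrow>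
        2 * pi * (\<Sum>n=1..<N. (norm (a n) * 1 ^ n)\<^sup>2 / real n)) (at_left 1)"
      unfolding divide_inverse by (intro tendsto_intros)
    then show "((\<lambda>r::real. 2 * pi * (\<Sum>n=1..<N. (norm (a n) * r ^ n)\<^sup>2 / real n)) \<longlongrightarrow>
        2 * pi * (\<Sum>n=1..<N. (norm (a n))\<^sup>2 / real n)) (at_left 1)" by simp
  qed simp
  show ?thesis
  proof (rule bergman_coeff_leI[OF hol f])
    fix N
    \<comment> \<open>The range is enlarged to \<open>Suc N\<close> so that the term n = 0 can be
      split off even for N = 0.\<close>
    have "(\<Sum>n<N. pi * (norm (a n))\<^sup>2 / real (Suc n)) \<le> (\<Sum>n<Suc N. pi * (norm (a n))\<^sup>2 / real (Suc n))"
      by (intro sum_mono2) auto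
    also have "\<dots> = pi * (norm (a 0))\<^sup>2 + (\<Sum>n=1..<Suc N. pi * (norm (a n))\<^sup>2 / real (Suc n))"
      unfolding lessThan_atLeast0 by (subst sum.atLeast_Suc_lessThan) auto
    also have "\<dots> \<le> pi * b\<^sup>2 + (\<Sum>n=1..<Suc N. pi * (norm (a n))\<^sup>2 / real n)"
      using a0 by (intro add_mono mult_left_mono power_mono sum_mono divide_left_mono) auto
    also have "(\<Sum>n=1..<Suc N. pi * (norm (a n))\<^sup>2 / real n) = pi * (\<Sum>n=1..<Suc N. (norm (a n))\<^sup>2 / real n)"
      by (simp only: sum_distrib_left times_divide_eq_right)
    \<comment> \<open>Since pi < 4, the zeroth term is below (4 b)^2, and the rest is half of what
      \<open>aN\<close> bounds. A sum of squares of nonnegative numbers is at most the square of the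
      sum, hence 4 + 4 C.\<close>
    also have "pi * b\<^sup>2 + \<dots> \<le> (4 * b)\<^sup>2 + (4 * C * b)\<^sup>2"
    proof (rule add_mono)
      have "pi * b\<^sup>2 \<le> 16 * b\<^sup>2" using pi_less_4 by (intro mult_right_mono) auto
      then show "pi * b\<^sup>2 \<le> (4 * b)\<^sup>2" by (simp add: power_mult_distrib)
      have "0 \<le> pi * (\<Sum>n=1..<Suc N. (norm (a n))\<^sup>2 / real n)" by (intro mult_nonneg_nonneg sum_nonneg) auto
      with aN[of "Suc N"] show "pi * (\<Sum>n=1..<Suc N. (norm (a n))\<^sup>2 / real n) \<le> (4 * C * b)\<^sup>2" by linarith
    qed
    also have "\<dots> \<le> ((4 + 4 * C) * b)\<^sup>2"
      using C \<open>0 \<le> b\<close> unfolding distrib_right power2_sum by simp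
    finally show "(\<Sum>n<N. pi * (norm (a n))\<^sup>2 / real (Suc n)) \<le> ((4 + 4 * C) * b)\<^sup>2" .
  qed (use C \<open>0 \<le> b\<close> in simp)
qed

end

lemma assertion_B_imp_A:
  assumes assertion_B shows assertion_A
proof -
  obtain C where C: "C > 0" and B: "\<And>u. u \<in> distributions \<Longrightarrow> quarter_laplacian u \<in> L1_plus Hdot_space \<Longrightarrow>
     riesz_transform (quarter_laplacian u) \<in> L1_plus Hdot_space \<Longrightarrow>
     \<exists>w\<in>L2_star. dist_eq (\<lambda>\<phi>. u \<phi> - dist_of (\<lambda>\<theta>. mean u) \<phi>) (dist_of w) \<and>
        L2_norm circle w \<le> ennreal C *
          (L1_plus_norm Hdot_space Hdot_norm (quarter_laplacian u) +
           L1_plus_norm Hdot_space Hdot_norm (riesz_transform (quarter_laplacian u)))"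
    using assms unfolding assertion_B_def by blast
  note bound = boundary_norm_bound[OF C B]
  show ?thesis unfolding assertion_A_def
  proof (intro exI[of _ "4 + 4 * C"] conjI allI impI)
    show "0 < 4 + 4 * C" using C by simp
    fix f assume hol: "f holomorphic_on ball 0 1"
    have C4: "0 < 4 + 4 * C" using C by simp
    show le: "L2_norm disc f \<le> ennreal (4 + 4 * C) * boundary_norm f"
    proof (cases "boundary_norm f")
      case (real b)
      show ?thesis
      proof (rule ennreal_le_epsilon)
        fix e :: real assume e: "0 < e"
        \<comment> \<open>The slack d turns the value b into a strict upper bound, as
          \<open>boundary_norm_bound\<close> requires.\<close>
        define d where "d = e / (4 + 4 * C)"
        have d: "0 < d" using e C4 by (simp add: d_def)
        have "boundary_norm f < ennreal (b + d)" using real d by (simp add: ennreal_lessI)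
        then have "L2_norm disc f \<le> ennreal ((4 + 4 * C) * (b + d))"
          using real d by (intro bound hol) auto
        also have "(4 + 4 * C) * (b + d) = (4 + 4 * C) * b + e"
          using C4 by (simp add: d_def distrib_left)
        also have "ennreal \<dots> = ennreal (4 + 4 * C) * boundary_norm f + ennreal e"
          using real C4 e by (simp add: ennreal_mult del: ennreal_plus) (simp add: ennreal_mult[symmetric] ennreal_plus)
        finally show "L2_norm disc f \<le> ennreal (4 + 4 * C) * boundary_norm f + ennreal e" .
      qed
    next
      \<comment> \<open>Positivity of the constant matters here: 0 * \<infinity> would be 0.\<close>
      case top
      then show ?thesis using C4 by (simp add: ennreal_mult_top)
    qed
    show "f \<in> bergman \<longleftrightarrow> boundary_norm f < \<infinity>"
    proof
      assume "boundary_norm f < \<infinity>"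
      then have "ennreal (4 + 4 * C) * boundary_norm f < \<infinity>" by (simp add: ennreal_mult_less_top)
      then show "f \<in> bergman" using le hol by (auto simp: bergman_def intro: le_less_trans)
    qed (rule bergman_imp_boundary_norm_finite)
  qed
qed

theorem proposition4p1:
  shows "(assertion_A \<longrightarrow> assertion_B) \<and> (assertion_A \<longleftrightarrow> assertion_B)"
  using assertion_A_imp_B assertion_B_imp_A by blast

end
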